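(* Let $\mathcal{P}: A_0,\dots,A_{n-1}$ be a weakly closed path polyomino and let $K$ be a field. Then the polyomino ideal $I_{\mathcal{P}}\subset S=K[x_a\mid a\in V(\mathcal{P})]$ is of König type.
   Context: $\mathbb{N}$ is the set of nonnegative integers, and $(i,j)\le (k,l)$ in $\mathbb{N}^2$ means $i\le k$ and $j\le l$. For $a=(i,j)\le b=(k,l)$ put $[a,b]=\{m\in\mathbb{N}^2: a\le m\le b\}$; it is a proper interval if $i<k$ and $j<l$. The anti-diagonal vertices of a proper interval are $(i,l)$ and $(k,j)$. A cell is $C=[a,a+(1,1)]$; $V(C)$ is the set of its four vertices and its edges are the four pairs of adjacent vertices. For a finite collection of cells $\mathcal{P}$ in $(\mathbb{N}\setminus\{0\})^2$, $V(\mathcal{P})=\bigcup_{C\in\mathcal{P}}V(C)$. Weakly closed path: a finite non-empty collection of cells $\mathcal{P}$ is a weakly closed path (polyomino) if it is a sequence of cells $A_0,A_1,\dots,A_{n-1},A_n$ with $n\ge 6$ such that: (1) $A_0=A_n$; (2) $A_i\ne A_j$ for all $i\neq j$ with $i,j\in\{1,\dots,n\}$; (3) $A_0\cap A_{n-1}$ is a vertex; (4) $A_i\cap A_{i+1}$ is a common edge for all $i\in\{0,\dots,n-2\}$; (5) $V(A_i)\cap V(A_j)=\emptyset$ for all $i\in\{1,\dots,n\}$ and all $j\notin\{i-2,i-1,i,i+1,i+2\}$, where the indices are reduced modulo $n$. An inner interval of $\mathcal{P}$ is a proper interval $[a,b]$ with $a,b\in V(\mathcal{P})$ all of whose cells belong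 to $\mathcal{P}$. $I_{\mathcal{P}}$ is the ideal of $S=K[x_a\mid a\in V(\mathcal{P})]$ generated by all binomials $x_ax_b-x_cx_d$, where $[a,b]$ ranges over the inner intervals of $\mathcal{P}$ and $c,d$ are the anti-diagonal vertices of $[a,b]$. König type: a homogeneous ideal $I\subset S$ of height $h$ is of König type if there exist homogeneous polynomials $f_1,\dots,f_h$ forming part of a minimal system of homogeneous generators of $I$ and a monomial order $<$ on $S$ such that $\operatorname{in}_<(f_1),\dots,\operatorname{in}_<(f_h)$ is a regular sequence. *)

theory Defs
  imports
    "HOL-Library.Poly_Mapping"
    "HOL-Library.Product_Order"
    "HOL-Library.Extended_Nat"
    "HOL-Number_Theory.Cong"
    "HOL-Algebra.Ideal"
begin

section \<open>Cells, weakly closed paths and inner intervals\<close>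

text \<open>
  Points of the grid have type \<^typ>\<open>nat \<times> nat\<close>, with the componentwise order and addition
  of \<^theory>\<open>HOL-Library.Product_Order\<close>, so that the interval [a, b] is \<^term>\<open>{a..b::nat \<times> nat}\<close>.
  A cell is the interval [a, a + (1,1)], which as a subset of the grid consists of exactly its
  four vertices; hence V(C) is C itself.
\<close>

type_synonym point = "nat \<times> nat"

definition is_cell :: "point set \<Rightarrow> bool" where
  "is_cell C \<longleftrightarrow> (\<exists>a. C = {a..a + (1, 1)})"

definition adjacent :: "point \<Rightarrow> point \<Rightarrow> bool" where
  "adjacent p q \<longleftrightarrow> q = p + (1, 0) \<or> p = q + (1, 0) \<or> q = p + (0, 1) \<or> p = q + (0, 1)"

definition edges :: "point set \<Rightarrow> point set set" where
  "edges C = {{p, q} | p q. p \<in> C \<and> q \<in> C \<and> adjacent p q}"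

definition vertices :: "point set set \<Rightarrow> point set" where
  "vertices P = \<Union>P"

definition cell_collection :: "point set set \<Rightarrow> bool" where
  "cell_collection P \<longleftrightarrow> finite P \<and> (\<forall>C\<in>P. is_cell C \<and> C \<subseteq> {(1, 1)..})"

definition weakly_closed_path :: "point set set \<Rightarrow> nat \<Rightarrow> (nat \<Rightarrow> point set) \<Rightarrow> bool" where
  "weakly_closed_path P n A \<longleftrightarrow>
     cell_collection P \<and> P = A ` {0..n} \<and> n \<ge> 6 \<and>
     A 0 = A n \<and>
     (\<forall>i\<in>{1..n}. \<forall>j\<in>{1..n}. i \<noteq> j \<longrightarrow> A i \<noteq> A j) \<and>
     (\<exists>v. A 0 \<inter> A (n - 1) = {v}) \<and>
     (\<forall>i\<in>{0..n - 2}. A i \<inter> A (i + 1) \<in> edges (A i) \<inter> edges (A (i + 1))) \<and>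
     (\<forall>i\<in>{1..n}. \<forall>j\<in>{1..n}.
        (\<forall>d\<in>{-2..2::int}. \<not> [int j = int i + d] (mod int n)) \<longrightarrow> A i \<inter> A j = {})"

definition proper_interval :: "point \<Rightarrow> point \<Rightarrow> bool" where
  "proper_interval a b \<longleftrightarrow> fst a < fst b \<and> snd a < snd b"

definition inner_interval :: "point set set \<Rightarrow> point \<Rightarrow> point \<Rightarrow> bool" where
  "inner_interval P a b \<longleftrightarrow>
     proper_interval a b \<and> a \<in> vertices P \<and> b \<in> vertices P \<and>
     (\<forall>C. is_cell C \<and> C \<subseteq> {a..b} \<longrightarrow> C \<in> P)"


section \<open>Polynomial rings\<close>

text \<open>
  Polynomials are finitely supported functions from monomials (exponent vectors) to coefficients.
  The polynomial ring in the variables \<open>x\<^sub>v\<close> with \<open>v \<in> V\<close> consists of those in which only these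
  variables occur.
\<close>

type_synonym 'v monom = "'v \<Rightarrow>\<^sub>0 nat"
type_synonym ('v, 'k) mpoly = "'v monom \<Rightarrow>\<^sub>0 'k"

definition monomials :: "'v set \<Rightarrow> 'v monom set" where
  "monomials V = {m. Poly_Mapping.keys m \<subseteq> V}"

definition mpoly_ring :: "'v set \<Rightarrow> ('v, 'k::field) mpoly ring" where
  "mpoly_ring V =
     \<lparr>carrier = {p. Poly_Mapping.keys p \<subseteq> monomials V}, mult = (*), one = 1, zero = 0, add = (+)\<rparr>"

definition Var :: "'v \<Rightarrow> ('v, 'k::field) mpoly" where
  "Var v = Poly_Mapping.single (Poly_Mapping.single v 1) 1"

definition monom_degree :: "'v monom \<Rightarrow> nat" where
  "monom_degree m = (\<Sum>v\<in>Poly_Mapping.keys m. Poly_Mapping.lookup m v)"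

definition homogeneous :: "('v, 'k::field) mpoly \<Rightarrow> bool" where
  "homogeneous p \<longleftrightarrow> (\<exists>d. \<forall>m\<in>Poly_Mapping.keys p. monom_degree m = d)"

lemma monomials_plus:
  fixes m m' :: "'v monom"
  assumes "m \<in> monomials V" "m' \<in> monomials V"
  shows "m + m' \<in> monomials V"
  using assms Poly_Mapping.keys_add[of m m'] by (auto simp: monomials_def)

lemma cring_mpoly_ring: "cring (mpoly_ring V :: ('v, 'k::field) mpoly ring)"
proof (rule cringI)
  show "abelian_group (mpoly_ring V :: ('v, 'k) mpoly ring)"
  proof (rule abelian_groupI)
    fix x y :: "('v, 'k) mpoly"
    assume "x \<in> carrier (mpoly_ring V)" "y \<in> carrier (mpoly_ring V)"
    then show "x \<oplus>\<^bsub>mpoly_ring V\<^esub> y \<in> carrier (mpoly_ring V)"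
      using Poly_Mapping.keys_add[of x y] by (auto simp: mpoly_ring_def)
  next
    fix x :: "('v, 'k) mpoly"
    assume "x \<in> carrier (mpoly_ring V)"
    then have "- x \<in> carrier (mpoly_ring V)" "(- x) \<oplus>\<^bsub>mpoly_ring V\<^esub> x = \<zero>\<^bsub>mpoly_ring V\<^esub>"
      by (auto simp: mpoly_ring_def)
    then show "\<exists>y\<in>carrier (mpoly_ring V). y \<oplus>\<^bsub>mpoly_ring V\<^esub> x = \<zero>\<^bsub>mpoly_ring V\<^esub>"
      by blast
  qed (auto simp: mpoly_ring_def add_ac)
next
  show "comm_monoid (mpoly_ring V :: ('v, 'k) mpoly ring)"
  proof (rule comm_monoidI)
    fix x y :: "('v, 'k) mpoly"
    assume "x \<in> carrier (mpoly_ring V)" "y \<in> carrier (mpoly_ring V)"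
    then show "x \<otimes>\<^bsub>mpoly_ring V\<^esub> y \<in> carrier (mpoly_ring V)"
      using Poly_Mapping.keys_mult[of x y] monomials_plus[of _ V]
      by (fastforce simp: mpoly_ring_def)
  qed (auto simp: mpoly_ring_def mult_ac monomials_def)
next
  fix x y z :: "('v, 'k) mpoly"
  show "(x \<oplus>\<^bsub>mpoly_ring V\<^esub> y) \<otimes>\<^bsub>mpoly_ring V\<^esub> z =
        x \<otimes>\<^bsub>mpoly_ring V\<^esub> z \<oplus>\<^bsub>mpoly_ring V\<^esub> y \<otimes>\<^bsub>mpoly_ring V\<^esub> z"
    by (simp add: mpoly_ring_def distrib_right)
qed

definition polyomino_ideal :: "point set set \<Rightarrow> (point, 'k::field) mpoly set" where
  "polyomino_ideal P = Idl\<^bsub>mpoly_ring (vertices P)\<^esub>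
     {Var (i, j) * Var (k, l) - Var (i, l) * Var (k, j) | i j k l. inner_interval P (i, j) (k, l)}"


section \<open>Height and regular sequences\<close>

definition prime_height :: "('a, 'b) ring_scheme \<Rightarrow> 'a set \<Rightarrow> enat" where
  "prime_height R p = Sup {enat n | n.
     \<exists>Q :: nat \<Rightarrow> 'a set. (\<forall>i\<le>n. primeideal (Q i) R) \<and> (\<forall>i<n. Q i \<subset> Q (Suc i)) \<and> Q n = p}"

definition ideal_height :: "('a, 'b) ring_scheme \<Rightarrow> 'a set \<Rightarrow> enat" where
  "ideal_height R I = Inf {prime_height R p | p. primeideal p R \<and> I \<subseteq> p}"

text \<open>
  The first condition says that multiplication by the i-th element is injective on the quotient
  by the ideal of the preceding ones.
\<close>

definition regular_sequence :: "('a, 'b) ring_scheme \<Rightarrow> 'a list \<Rightarrow> bool" where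
  "regular_sequence R fs \<longleftrightarrow>
     set fs \<subseteq> carrier R \<and>
     (\<forall>i<length fs. \<forall>g\<in>carrier R.
        fs ! i \<otimes>\<^bsub>R\<^esub> g \<in> Idl\<^bsub>R\<^esub> (set (take i fs)) \<longrightarrow> g \<in> Idl\<^bsub>R\<^esub> (set (take i fs))) \<and>
     Idl\<^bsub>R\<^esub> (set fs) \<noteq> carrier R"


section \<open>Monomial orders and ideals of Koenig type\<close>

text \<open>A pair \<open>(s, t)\<close> belongs to the order \<open>r\<close> iff \<open>s \<le> t\<close>.\<close>

definition monomial_order :: "'v set \<Rightarrow> 'v monom rel \<Rightarrow> bool" where
  "monomial_order V r \<longleftrightarrow>
     linear_order_on (monomials V) r \<and>
     (\<forall>s\<in>monomials V. (0, s) \<in> r) \<and>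
     (\<forall>s\<in>monomials V. \<forall>t\<in>monomials V. \<forall>u\<in>monomials V. (s, t) \<in> r \<longrightarrow> (s + u, t + u) \<in> r)"

text \<open>The initial monomial, without its coefficient; meaningful only for nonzero \<open>p\<close>.\<close>

definition initial :: "'v monom rel \<Rightarrow> ('v, 'k::field) mpoly \<Rightarrow> ('v, 'k) mpoly" where
  "initial r p = Poly_Mapping.single (THE m. m \<in> Poly_Mapping.keys p \<and> (\<forall>m'\<in>Poly_Mapping.keys p. (m', m) \<in> r)) 1"

definition homogeneous_generators ::
    "'v set \<Rightarrow> ('v, 'k::field) mpoly set \<Rightarrow> ('v, 'k) mpoly set \<Rightarrow> bool" where
  "homogeneous_generators V I G \<longleftrightarrow>
     G \<subseteq> carrier (mpoly_ring V) \<and> (\<forall>g\<in>G. homogeneous g) \<and> I = Idl\<^bsub>mpoly_ring V\<^esub> G"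

definition homogeneous_ideal :: "'v set \<Rightarrow> ('v, 'k::field) mpoly set \<Rightarrow> bool" where
  "homogeneous_ideal V I \<longleftrightarrow> (\<exists>G. homogeneous_generators V I G)"

definition minimal_homogeneous_generators ::
    "'v set \<Rightarrow> ('v, 'k::field) mpoly set \<Rightarrow> ('v, 'k) mpoly set \<Rightarrow> bool" where
  "minimal_homogeneous_generators V I G \<longleftrightarrow>
     homogeneous_generators V I G \<and> (\<forall>H. H \<subset> G \<longrightarrow> Idl\<^bsub>mpoly_ring V\<^esub> H \<noteq> I)"

definition koenig_type :: "'v set \<Rightarrow> ('v, 'k::field) mpoly set \<Rightarrow> bool" where
  "koenig_type V I \<longleftrightarrow>
     homogeneous_ideal V I \<and>
     (\<exists>fs G r. ideal_height (mpoly_ring V) I = enat (length fs) \<and>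
        minimal_homogeneous_generators V I G \<and> distinct fs \<and> set fs \<subseteq> G \<and>
        monomial_order V r \<and>
        regular_sequence (mpoly_ring V) (map (initial r) fs))"

end

theory Submission
  imports Defs
begin

text \<open>
  The cells number the height. Upper bound: every cell relation determines the weight of the upper
  right corner of the cell, so the toric ideal of all weights satisfying these relations is a prime
  that contains the polyomino ideal and has a residue ring of dimension at least
  \<open>|V| - |P|\<close>. Lower bound and regular sequence both follow from \<open>|P|\<close> inner minors with pairwise
  coprime initial monomials. To find them, the path is traversed backwards: of the two new
  vertices of each cell, one is paired with a vertex \<open>u\<close> left over from the cell before, and the other
  one is left over for the next cell. The two ends of
  the path share a vertex. If no further cells meet there, the last cell is paired so that the
  shared vertex is used at most once. Otherwise one end cell is attached to a closed ring of the others,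
  and all vertices have to be paired; then weights compatible with the closing of the ring exist
  since the ring turns at least once.
\<close>

section \<open>Attaching cells\<close>

text \<open>For an open path the weights are no obstacle: each cell brings a vertex \<open>L\<close>
  that no earlier minor contains, and the weight of \<open>L\<close> alone can enforce the new
  inequality. The obstacle is the ring with a pendant cell. Both new vertices of that cell are
  paired, and the inequalities of its two minors add up to w L + w m < w u + w e, where {e, m} is
  the first edge of the ring and {L, u} the last one. But the first minor demands w e - w m < w L -
  w u for its own new edge {L, u}, and every straight step increases w L - w u strictly, so a ring
  without corners would be contradictory. At a corner the fourth vertex of the new minor lies on the
  preceding edge instead of being \<open>L\<close>. The old \<open>L\<close> and \<open>u\<close>
  can then be raised together, and the new difference becomes as negative as desired. A straight
  path cannot close up, which supplies the corner.

  Both height bounds come from counting monomials with bounded exponents: there are (t + 1)^a of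
  them in a variables with exponents up to t, and comparing such powers for large t compares the
  numbers of variables.\<close>

definition cell :: "point \<Rightarrow> point set" where
  "cell c = {c..c + (1, 1)}"

lemma cell_Pair: "cell (x, y) = {(x, y), (Suc x, y), (x, Suc y), (Suc x, Suc y)}"
  by (auto simp: cell_def less_eq_prod_def)

lemma mem_cell: "p \<in> cell c \<longleftrightarrow>
    fst c \<le> fst p \<and> fst p \<le> Suc (fst c) \<and> snd c \<le> snd p \<and> snd p \<le> Suc (snd c)"
  by (auto simp: cell_def less_eq_prod_def)

lemma is_cell_iff: "is_cell C \<longleftrightarrow> (\<exists>c. C = cell c)"
  by (simp add: is_cell_def cell_def)

lemma cell_subset_iff: "cell c \<subseteq> {a..b} \<longleftrightarrow> a \<le> c \<and> c + (1, 1) \<le> b"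
  by (simp add: cell_def less_eq_prod_def)

lemma inj_cell: "cell c = cell d \<longleftrightarrow> c = d"
  by (simp add: cell_def Icc_eq_Icc less_eq_prod_def)

lemma inner_intervalI:
  assumes "i < k" "j < l"
    and "\<And>x y. i \<le> x \<Longrightarrow> x < k \<Longrightarrow> j \<le> y \<Longrightarrow> y < l \<Longrightarrow> cell (x, y) \<in> P"
  shows "inner_interval P (i, j) (k, l)"
proof -
  have "cell (i, j) \<in> P" "cell (k - 1, l - 1) \<in> P" using assms by auto
  moreover have "(i, j) \<in> cell (i, j)" "(k, l) \<in> cell (k - 1, l - 1)"
    using assms by (auto simp: mem_cell)
  ultimately have "(i, j) \<in> vertices P" "(k, l) \<in> vertices P" by (auto simp: vertices_def)
  then show ?thesis using assms
    by (auto simp: inner_interval_def proper_interval_def is_cell_iff cell_subset_iff less_eq_prod_def)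
qed

text \<open>The two monomials of an inner 2-minor, in either order: \<open>L, M\<close> are opposite corners of an
  inner interval, and \<open>X, Y\<close> are the other two.\<close>

definition minor :: "point set set \<Rightarrow> point \<Rightarrow> point \<Rightarrow> point \<Rightarrow> point \<Rightarrow> bool" where
  "minor P L M X Y \<longleftrightarrow> fst L \<noteq> fst M \<and> snd L \<noteq> snd M \<and>
     {X, Y} = {(fst L, snd M), (fst M, snd L)} \<and>
     inner_interval P (min (fst L) (fst M), min (snd L) (snd M)) (max (fst L) (fst M), max (snd L) (snd M))"

lemma adjacent_iff: "adjacent p q \<longleftrightarrow>
   fst p = fst q \<and> (snd p = Suc (snd q) \<or> snd q = Suc (snd p)) \<or>
   snd p = snd q \<and> (fst p = Suc (fst q) \<or> fst q = Suc (fst p))"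
  by (cases p; cases q) (auto simp: adjacent_def)

lemma adjacent_sym: "adjacent p q \<longleftrightarrow> adjacent q p"
  by (auto simp: adjacent_iff)

text \<open>Attaching the cell \<open>c\<close> to \<open>d\<close> along an edge: the free vertex \<open>u\<close> of \<open>d\<close> is paired with the
  new vertex \<open>L\<close> of \<open>c\<close> that is not on the line through \<open>u\<close> in the direction of the step.\<close>

lemma attach_horizontal:
  assumes "c = (x', y)" "d = (x, y)" "x' = Suc x \<or> x = Suc x'"
    and P: "cell c \<in> P" "cell d \<in> P \<or> u \<in> cell c" and u: "u \<in> cell d"
  defines "z \<equiv> (if x' < x then x' else Suc x')"
  defines "y' \<equiv> 2 * y + 1 - snd u"
  shows "cell c - cell d = {(z, y'), (z, snd u)}" "(z, y') \<noteq> (z, snd u)"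
    and "minor P (z, y') u (z, snd u) (fst u, y')" "(fst u, y') \<in> cell d"
proof -
  obtain ux uy where ueq: "u = (ux, uy)" by (cases u)
  have uc: "x \<le> ux" "ux \<le> Suc x" "y \<le> uy" "uy \<le> Suc y" using u assms ueq by (auto simp: mem_cell)
  then have uy: "uy = y \<or> uy = Suc y" by auto
  show "cell c - cell d = {(z, y'), (z, snd u)}" "(z, y') \<noteq> (z, snd u)"
    using uy assms(1-3) by (auto simp: cell_Pair z_def y'_def ueq)
  show "(fst u, y') \<in> cell d" using uc assms(2) by (auto simp: mem_cell y'_def ueq)
  \<comment> \<open>\<open>y'\<close> is the other one of \<open>y\<close> and \<open>Suc y\<close>:
    its definition reflects the coordinate of \<open>u\<close> in the middle of the row.\<close>
  have mm: "min y' uy = y" "max y' uy = Suc y" "y' \<noteq> uy" using uy by (auto simp: y'_def ueq)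
  have "inner_interval P (min z ux, y) (max z ux, Suc y)"
  proof (rule inner_intervalI)
    show "min z ux < max z ux" using assms(3) uc by (auto simp: z_def)
  next
    fix a b assume ab: "min z ux \<le> a" "a < max z ux" "y \<le> b" "b < Suc y"
    then have "b = y" by auto
    \<comment> \<open>If \<open>u\<close> lies on the common edge, the interval is
      \<open>cell c\<close> alone; otherwise it consists of both cells.\<close>
    moreover have "a = x' \<or> a = x \<and> u \<notin> cell c"
      using ab assms(1-3) uc by (auto simp: z_def ueq mem_cell split: if_splits)
    ultimately show "cell (a, b) \<in> P" using P assms(1,2) by auto
  qed simp
  then show "minor P (z, y') u (z, snd u) (fst u, y')"
    using mm uc assms(3) by (auto simp: minor_def ueq z_def)
qed

lemma attach_vertical:
  assumes "c = (x, y')" "d = (x, y)" "y' = Suc y \<or> y = Suc y'"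
    and P: "cell c \<in> P" "cell d \<in> P \<or> u \<in> cell c" and u: "u \<in> cell d"
  defines "z \<equiv> (if y' < y then y' else Suc y')"
  defines "x' \<equiv> 2 * x + 1 - fst u"
  shows "cell c - cell d = {(x', z), (fst u, z)}" "(x', z) \<noteq> (fst u, z)"
    and "minor P (x', z) u (fst u, z) (x', snd u)" "(x', snd u) \<in> cell d"
proof -
  obtain ux uy where ueq: "u = (ux, uy)" by (cases u)
  have uc: "x \<le> ux" "ux \<le> Suc x" "y \<le> uy" "uy \<le> Suc y" using u assms ueq by (auto simp: mem_cell)
  then have ux: "ux = x \<or> ux = Suc x" by auto
  show "cell c - cell d = {(x', z), (fst u, z)}" "(x', z) \<noteq> (fst u, z)"
    using ux assms(1-3) by (auto simp: cell_Pair z_def x'_def ueq)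
  show "(x', snd u) \<in> cell d" using uc assms(2) by (auto simp: mem_cell x'_def ueq)
  have mm: "min x' ux = x" "max x' ux = Suc x" "x' \<noteq> ux" using ux by (auto simp: x'_def ueq)
  have "inner_interval P (x, min z uy) (Suc x, max z uy)"
  proof (rule inner_intervalI)
    show "min z uy < max z uy" using assms(3) uc by (auto simp: z_def)
  next
    fix a b assume ab: "min z uy \<le> b" "b < max z uy" "x \<le> a" "a < Suc x"
    then have "a = x" by auto
    moreover have "b = y' \<or> b = y \<and> u \<notin> cell c"
      using ab assms(1-3) uc by (auto simp: z_def ueq mem_cell split: if_splits)
    ultimately show "cell (a, b) \<in> P" using P assms(1,2) by auto
  qed simp
  then show "minor P (x', z) u (fst u, z) (x', snd u)"
    using mm uc assms(3) by (auto simp: minor_def ueq z_def)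
qed

lemma adjacent_cases:
  assumes "adjacent c d"
  obtains (horizontal) x x' y where "c = (x', y)" "d = (x, y)" "x' = Suc x \<or> x = Suc x'"
  | (vertical) x y y' where "c = (x, y')" "d = (x, y)" "y' = Suc y \<or> y = Suc y'"
  using assms by (cases c; cases d) (auto simp: adjacent_iff)

text \<open>The first cell has no vertex left over from a predecessor, so the vertex
  \<open>m\<close> of its edge towards \<open>d\<close> takes that place. As \<open>m\<close> lies
  on the common edge, the minor is that of \<open>cell c\<close> alone.\<close>

lemma attach_first:
  assumes "adjacent c d" "cell c \<in> P" "cell d \<inter> cell c = {e, m}" "e \<noteq> m"
  obtains L u where "cell c - cell d = {L, u}" "L \<noteq> u" "minor P L m u e"
  using assms(1)
proof (cases rule: adjacent_cases)
  case (horizontal x x' y)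
  have m: "m \<in> cell d" "m \<in> cell c" "e \<in> cell d" "e \<in> cell c" using assms(3) by auto
  have "e = (fst m, 2 * y + 1 - snd m)"
    using m assms(4) horizontal by (cases e; cases m) (auto simp: mem_cell)
  then show ?thesis using attach_horizontal[OF horizontal assms(2) _ m(1)] m(2) that by metis
next
  case (vertical x y y')
  have m: "m \<in> cell d" "m \<in> cell c" "e \<in> cell d" "e \<in> cell c" using assms(3) by auto
  have "e = (2 * x + 1 - fst m, snd m)"
    using m assms(4) vertical by (cases e; cases m) (auto simp: mem_cell)
  then show ?thesis using attach_vertical[OF vertical assms(2) _ m(1)] m(2) that by metis
qed

text \<open>\<open>d\<close> is the midpoint of \<open>g\<close> and \<open>c\<close>, so
  \<open>{L, u}\<close> is the edge common to \<open>d\<close> and \<open>c\<close>, and the minor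
  is that of \<open>cell c\<close>. With \<open>L\<close> in its second monomial, the inequality for
  this minor forces w L' - w u' > w L - w u.\<close>

lemma attach_straight:
  assumes "adjacent c d" "c + g = d + d" "cell c \<in> P" "cell d \<in> P" "cell d - cell g = {L, u}" "L \<noteq> u"
  obtains L' u' where "cell c - cell d = {L', u'}" "L' \<noteq> u'" "minor P L' u u' L"
  using assms(1)
proof (cases rule: adjacent_cases)
  case (horizontal x x' y)
  have u: "u \<in> cell d" "u \<notin> cell g" "L \<in> cell d" "L \<notin> cell g" using assms(5) by auto
  have "L = (fst u, 2 * y + 1 - snd u)"
    using u assms(2,6) horizontal by (cases L; cases u; cases g) (auto simp: mem_cell)
  then show ?thesis using attach_horizontal[OF horizontal assms(3) _ u(1)] assms(4) that by metis
next
  case (vertical x y y')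
  have u: "u \<in> cell d" "u \<notin> cell g" "L \<in> cell d" "L \<notin> cell g" using assms(5) by auto
  have "L = (2 * x + 1 - fst u, snd u)"
    using u assms(2,6) vertical by (cases L; cases u; cases g) (auto simp: mem_cell)
  then show ?thesis using attach_vertical[OF vertical assms(3) _ u(1)] assms(4) that by metis
qed

text \<open>The two vertices of \<open>d\<close> off \<open>g\<close> lie on one line in the
  direction of the step from \<open>d\<close> to \<open>c\<close>, so \<open>L'\<close> and
  \<open>u'\<close> do not depend on which of them is \<open>u\<close>. The fourth corner
  \<open>X\<close> lies on the edge common to \<open>d\<close> and \<open>g\<close>, hence differs
  from both of these vertices; this leaves the weight of \<open>u\<close> adjustable.\<close>

lemma attach_corner:
  assumes "adjacent c d" "adjacent d g" "c \<noteq> g" "c + g \<noteq> d + d" "cell c \<in> P" "cell d \<in> P"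
  obtains L' u' where "cell c - cell d = {L', u'}" "L' \<noteq> u'"
    "\<And>u. u \<in> cell d - cell g \<Longrightarrow> \<exists>X. X \<in> cell d \<inter> cell g \<and> minor P L' u u' X"
  using assms(1)
proof (cases rule: adjacent_cases)
  case (horizontal x x' y)
  have g: "g = (x, Suc y) \<or> (\<exists>y0. y = Suc y0 \<and> g = (x, y0))"
    using assms(2-4) horizontal by (cases g) (auto simp: adjacent_iff)
  define s where "s = (if g = (x, Suc y) then y else Suc y)"
  have s: "snd u = s" "(fst u, 2 * y + 1 - snd u) \<in> cell g" if "u \<in> cell d - cell g" for u
    using that g horizontal by (cases u; auto simp: mem_cell s_def)+
  have p: "(x, s) \<in> cell d" using g horizontal by (auto simp: mem_cell s_def)
  note h = attach_horizontal[OF horizontal assms(5) disjI1[OF assms(6)]]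
  show ?thesis
  proof (rule that)
    fix u assume u: "u \<in> cell d - cell g"
    show "\<exists>X. X \<in> cell d \<inter> cell g \<and>
        minor P (if x' < x then x' else Suc x', 2 * y + 1 - s) u (if x' < x then x' else Suc x', s) X"
      using h(3,4)[of u] s[OF u] u by (intro exI[of _ "(fst u, 2 * y + 1 - snd u)"]) simp
  qed (use h(1,2)[OF p] in simp_all)
next
  case (vertical x y y')
  have g: "g = (Suc x, y) \<or> (\<exists>x0. x = Suc x0 \<and> g = (x0, y))"
    using assms(2-4) vertical by (cases g) (auto simp: adjacent_iff)
  define s where "s = (if g = (Suc x, y) then x else Suc x)"
  have s: "fst u = s" "(2 * x + 1 - fst u, snd u) \<in> cell g" if "u \<in> cell d - cell g" for u
    using that g vertical by (cases u; auto simp: mem_cell s_def)+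
  have p: "(s, y) \<in> cell d" using g vertical by (auto simp: mem_cell s_def)
  note h = attach_vertical[OF vertical assms(5) disjI1[OF assms(6)]]
  show ?thesis
  proof (rule that)
    fix u assume u: "u \<in> cell d - cell g"
    show "\<exists>X. X \<in> cell d \<inter> cell g \<and>
        minor P (2 * x + 1 - s, if y' < y then y' else Suc y') u (s, if y' < y then y' else Suc y') X"
      using h(3,4)[of u] s[OF u] u by (intro exI[of _ "(2 * x + 1 - fst u, snd u)"]) simp
  qed (use h(1,2)[OF p] in simp_all)
qed


section \<open>Systems of minors along a path\<close>

type_synonym quad = "point \<times> point \<times> point \<times> point"

definition touched :: "quad list \<Rightarrow> point set" where
  "touched qs = (\<Union>(L, M, X, Y)\<in>set qs. {L, M, X, Y})"

text \<open>A list and not a set: its distinctness says at once that each monomial x_L x_M is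
  squarefree and that these monomials are pairwise coprime.\<close>

definition paired :: "quad list \<Rightarrow> point list" where
  "paired qs = concat (map (\<lambda>(L, M, X, Y). [L, M]) qs)"

text \<open>The inequality makes x_L x_M the initial monomial under every monomial order that
  refines the weight \<open>w\<close>. One \<open>w\<close> serves all minors, since a single order
  is required.\<close>

definition minor_system :: "point set set \<Rightarrow> (point \<Rightarrow> nat) \<Rightarrow> quad list \<Rightarrow> bool" where
  "minor_system P w qs \<longleftrightarrow> distinct (paired qs) \<and>
     (\<forall>(L, M, X, Y)\<in>set qs. minor P L M X Y \<and> w X + w Y < w L + w M)"

lemma touched_Cons: "touched ((L, M, X, Y) # qs) = {L, M, X, Y} \<union> touched qs"
  by (auto simp: touched_def)

lemma touched_Nil: "touched [] = {}"
  by (simp add: touched_def)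

lemma paired_Cons: "paired ((L, M, X, Y) # qs) = L # M # paired qs"
  by (simp add: paired_def)

lemma paired_Nil: "paired [] = []"
  by (simp add: paired_def)

lemma paired_touched: "set (paired qs) \<subseteq> touched qs"
proof (induction qs)
  case (Cons q qs)
  then show ?case by (cases q) (auto simp: touched_Cons paired_Cons)
qed (simp add: paired_Nil)

lemma minor_system_Nil: "minor_system P w []"
  by (simp add: minor_system_def paired_def)

lemma minor_system_Cons:
  "minor_system P w ((L, M, X, Y) # qs) \<longleftrightarrow> minor_system P w qs \<and>
     L \<noteq> M \<and> L \<notin> set (paired qs) \<and> M \<notin> set (paired qs) \<and> minor P L M X Y \<and> w X + w Y < w L + w M"
  by (auto simp: minor_system_def paired_Cons)

lemma minor_system_cong:
  assumes "minor_system P w qs" "\<And>v. v \<in> touched qs \<Longrightarrow> w' v = w v"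
  shows "minor_system P w' qs"
  using assms
proof (induction qs)
  case (Cons q qs)
  then show ?case by (cases q) (auto simp: minor_system_Cons touched_Cons)
qed (simp add: minor_system_Nil)

text \<open>Of \<open>cell (b 0)\<close> only the edge towards \<open>b 1\<close> counts as reached.
  The closing cell of a ring meets \<open>cell (b 0)\<close> again, and the vertices it finds there
  have to count as new.\<close>

definition region :: "(nat \<Rightarrow> point) \<Rightarrow> nat \<Rightarrow> point set" where
  "region b j = (\<Union>l\<in>{1..j}. cell (b l)) \<union> (cell (b 0) \<inter> cell (b 1))"

lemma region_Suc: "region b (Suc j) = cell (b (Suc j)) \<union> region b j"
  by (auto simp: region_def atLeastAtMostSuc_conv)

lemma region_base: "cell (b 0) \<inter> cell (b 1) \<subseteq> region b j"
  by (auto simp: region_def)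

lemma cell_region: "1 \<le> j \<Longrightarrow> cell (b j) \<subseteq> region b j"
  by (auto simp: region_def)

definition cell_path :: "point set set \<Rightarrow> (nat \<Rightarrow> point) \<Rightarrow> nat \<Rightarrow> bool" where
  "cell_path P b K \<longleftrightarrow>
     (\<forall>j<K. adjacent (b (Suc j)) (b j)) \<and>
     (\<forall>j. j + 2 \<le> K \<longrightarrow> b (j + 2) \<noteq> b j) \<and>
     (\<forall>j. 1 \<le> j \<and> j \<le> K \<longrightarrow> cell (b j) \<in> P) \<and>
     (\<forall>j<K. (cell (b (Suc j)) - cell (b j)) \<inter> region b j = {})"

text \<open>The path is traversed from its end \<open>b 1\<close>, whose edge \<open>{e, m}\<close> towards \<open>b 0\<close> contains the
  vertex \<open>e\<close> that is to remain unpaired. The vertex \<open>u\<close> is the one available for the next cell;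
  together with \<open>L\<close> it forms the edge of \<open>b j\<close> opposite to \<open>b (j - 1)\<close>.\<close>

definition partial_system ::
    "point set set \<Rightarrow> (nat \<Rightarrow> point) \<Rightarrow> point \<Rightarrow> nat \<Rightarrow> (point \<Rightarrow> nat) \<Rightarrow> quad list \<Rightarrow> point \<Rightarrow> point \<Rightarrow> bool" where
  "partial_system P b e j w qs L u \<longleftrightarrow>
     (\<exists>M X qs'. qs = (L, M, u, X) # qs' \<and> {M, X} \<union> touched qs' \<subseteq> region b (j - 1)) \<and>
     length qs = j \<and> minor_system P w qs \<and> cell (b j) - cell (b (j - 1)) = {L, u} \<and> L \<noteq> u \<and>
     e \<notin> set (paired qs)"

lemma new_vertices:
  assumes path: "cell_path P b K" and "1 \<le> j" "j \<le> K"
  shows "(cell (b j) - cell (b (j - 1))) \<inter> region b (j - 1) = {}"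
proof -
  have "\<forall>j<K. (cell (b (Suc j)) - cell (b j)) \<inter> region b j = {}"
    using path by (simp add: cell_path_def)
  from spec[OF this, of "j - 1"] show ?thesis using assms by simp
qed

lemma path_step:
  assumes path: "cell_path P b K" and "1 \<le> j" "j < K"
  shows "adjacent (b (Suc j)) (b j)" "adjacent (b j) (b (j - 1))" "b (Suc j) \<noteq> b (j - 1)"
    "cell (b (Suc j)) \<in> P" "cell (b j) \<in> P"
proof -
  obtain i where i: "j = Suc i" using assms by (cases j) auto
  have "b (i + 2) \<noteq> b i" using path assms unfolding cell_path_def i by auto
  then show "adjacent (b (Suc j)) (b j)" "adjacent (b j) (b (j - 1))" "b (Suc j) \<noteq> b (j - 1)"
    "cell (b (Suc j)) \<in> P" "cell (b j) \<in> P"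
    using path assms unfolding cell_path_def i by auto
qed

context
  fixes P b K e m
  assumes path: "cell_path P b K" and em: "cell (b 0) \<inter> cell (b 1) = {e, m}" "e \<noteq> m"
begin

lemma partial_touched:
  assumes "partial_system P b e j w qs L u"
  shows "touched qs \<subseteq> region b j"
proof -
  obtain M X qs' where q: "qs = (L, M, u, X) # qs'" "{M, X} \<union> touched qs' \<subseteq> region b (j - 1)"
    and j: "length qs = j" and c: "cell (b j) - cell (b (j - 1)) = {L, u}"
    using assms unfolding partial_system_def by blast
  obtain i where i: "j = Suc i" using q j by (cases j) auto
  show ?thesis using q c unfolding i by (auto simp: touched_Cons region_Suc)
qed

lemma partial_unpaired:
  assumes "partial_system P b e j w qs L u" "j \<le> K"
  shows "u \<notin> set (paired qs)" "1 \<le> j" "u \<noteq> e" "u \<noteq> m" "L \<noteq> e" "L \<noteq> m" "e \<in> region b i" "m \<in> region b i"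
proof -
  obtain M X qs' where q: "qs = (L, M, u, X) # qs'" "{M, X} \<union> touched qs' \<subseteq> region b (j - 1)"
    and j: "length qs = j" and c: "cell (b j) - cell (b (j - 1)) = {L, u}" "L \<noteq> u"
    using assms unfolding partial_system_def by blast
  show j1: "1 \<le> j" using q(1) j by auto
  have *: "L \<notin> region b (j - 1)" "u \<notin> region b (j - 1)"
    using new_vertices[OF path j1 assms(2)] c by auto
  show e: "e \<in> region b i" "m \<in> region b i" for i using region_base[of b i] em by auto
  show "u \<noteq> e" "u \<noteq> m" "L \<noteq> e" "L \<noteq> m" using * e by auto
  have "u \<notin> set (paired qs')" "u \<noteq> M" using * q(2) paired_touched[of qs'] by blast+
  then show "u \<notin> set (paired qs)" using c(2) by (simp add: q(1) paired_Cons)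
qed

text \<open>Weights of vertices not reached yet are free, so that each later step may choose those
  of its own new vertices.\<close>

lemma partial_cong:
  assumes "partial_system P b e j w qs L u" "\<And>v. v \<in> region b j \<Longrightarrow> w' v = w v"
  shows "partial_system P b e j w' qs L u"
proof -
  have "minor_system P w' qs"
  proof (rule minor_system_cong[of P w])
    show "minor_system P w qs" using assms(1) by (simp add: partial_system_def)
    show "w' v = w v" if "v \<in> touched qs" for v
      using that partial_touched[OF assms(1)] assms(2) by blast
  qed
  then show ?thesis using assms(1) by (simp add: partial_system_def)
qed

text \<open>The vertices \<open>L\<close> and \<open>u\<close> occur in the first minor only, one in each of its two monomials.\<close>

lemma partial_shift:
  assumes "partial_system P b e j w qs L u" "j \<le> K"
  shows "partial_system P b e j (w(L := w L + s, u := w u + s)) qs L u"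
proof -
  let ?w = "w(L := w L + s, u := w u + s)"
  obtain M X qs' where q: "qs = (L, M, u, X) # qs'" "{M, X} \<union> touched qs' \<subseteq> region b (j - 1)"
    and j: "length qs = j" and c: "cell (b j) - cell (b (j - 1)) = {L, u}" "L \<noteq> u"
    using assms unfolding partial_system_def by blast
  have *: "L \<notin> region b (j - 1)" "u \<notin> region b (j - 1)"
    using new_vertices[OF path partial_unpaired(2)[OF assms] assms(2)] c by auto
  have sys: "minor_system P w qs" using assms(1) by (simp add: partial_system_def)
  have ne: "M \<noteq> L" "M \<noteq> u" "X \<noteq> L" "X \<noteq> u" using q(2) * by blast+
  have sys': "minor_system P w qs'" "M \<notin> set (paired qs')" "L \<notin> set (paired qs')"
    "minor P L M u X" "w u + w X < w L + w M"
    using sys unfolding q(1) minor_system_Cons by blast+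
  have "minor_system P ?w qs'"
  proof (rule minor_system_cong[OF sys'(1)])
    fix v assume "v \<in> touched qs'"
    then have "v \<noteq> L" "v \<noteq> u" using q(2) * by blast+
    then show "?w v = w v" by simp
  qed
  then have "minor_system P ?w qs"
    using sys' ne c(2) unfolding q(1) minor_system_Cons by simp
  then show ?thesis using assms(1) by (simp add: partial_system_def)
qed

lemma partial_extend:
  assumes "partial_system P b e j w qs L u" "j < K" and X: "X \<in> cell (b j)"
    and new: "cell (b (Suc j)) - cell (b j) = {L', u'}" "L' \<noteq> u'" "minor P L' u u' X"
    and w: "w u' + w X < w L' + w u"
  shows "partial_system P b e (Suc j) w ((L', u, u', X) # qs) L' u'"
proof -
  note un = partial_unpaired[OF assms(1) less_imp_le[OF assms(2)]]
  have t: "touched qs \<subseteq> region b j" using partial_touched[OF assms(1)] .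
  have j1: "1 \<le> j" "j \<le> K" using un assms(2) by auto
  have uX: "u \<in> region b j" "X \<in> region b j"
    using assms(1) X cell_region[OF j1(1), of b] by (auto simp: partial_system_def)
  have L': "L' \<notin> region b j" using new_vertices[OF path, of "Suc j"] assms(2) new(1) by auto
  have "L' \<noteq> u" "L' \<notin> set (paired qs)" "L' \<noteq> e"
    using L' uX t paired_touched[of qs] un(7)[of j] j1 by auto
  then show ?thesis
    using assms un(1,3) j1 uX t unfolding partial_system_def
    by (auto simp: minor_system_Cons paired_Cons)
qed

lemma partial_first:
  assumes "1 \<le> K"
  obtains w L u qs where "partial_system P b e 1 w qs L u"
proof -
  have "adjacent (b 1) (b 0)" "cell (b 1) \<in> P" using path assms by (auto simp: cell_path_def)
  then obtain L u where *: "cell (b 1) - cell (b 0) = {L, u}" "L \<noteq> u" "minor P L m u e"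
    using attach_first em by metis
  have "partial_system P b e 1 ((\<lambda>_. 0)(L := 1)) [(L, m, u, e)] L u"
    using * em unfolding partial_system_def
    by (auto simp: touched_Nil minor_system_Cons minor_system_Nil paired_Cons paired_Nil region_def)
  then show ?thesis using that by blast
qed

lemma partial_exists:
  assumes "1 \<le> j" "j \<le> K"
  shows "\<exists>w qs L u. partial_system P b e j w qs L u"
  using assms
proof (induction j rule: nat_induct_at_least)
  case base
  then show ?case using partial_first by metis
next
  case (Suc j)
  then obtain w qs L u where sys: "partial_system P b e j w qs L u" by auto
  note st = path_step[OF path Suc.hyps, OF Suc_le_lessD[OF Suc.prems]]
  have Lu: "cell (b j) - cell (b (j - 1)) = {L, u}" "L \<noteq> u" using sys by (auto simp: partial_system_def)
  have "\<exists>L' u' X. cell (b (Suc j)) - cell (b j) = {L', u'} \<and> L' \<noteq> u' \<and> minor P L' u u' X \<and> X \<in> cell (b j)"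
  proof (cases "b (Suc j) + b (j - 1) = b j + b j")
    case True
    show ?thesis using attach_straight[OF st(1) True st(4,5) Lu] Lu by (metis DiffD1 insertI1)
  next
    case False
    show ?thesis using attach_corner[OF st(1-3) False st(4,5)] Lu by (metis IntD1 insertCI)
  qed
  then obtain L' u' X where new: "cell (b (Suc j)) - cell (b j) = {L', u'}" "L' \<noteq> u'"
    "minor P L' u u' X" "X \<in> cell (b j)" by blast
  have *: "L' \<notin> region b j" using new_vertices[OF path, of "Suc j"] Suc.prems new(1) by auto
  have "X \<noteq> L'" "u \<noteq> L'" using new Lu by auto
  \<comment> \<open>\<open>L'\<close> occurs in no earlier minor, so its weight can be chosen large
    enough for the new inequality.\<close>
  moreover define w' where "w' = w(L' := Suc (w u' + w X))"
  moreover have "partial_system P b e j w' qs L u"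
    by (rule partial_cong[OF sys]) (use * w'_def in auto)
  ultimately have "partial_system P b e (Suc j) w' ((L', u, u', X) # qs) L' u'"
    using new Suc.prems by (intro partial_extend) auto
  then show ?case by blast
qed

end

text \<open>The order of the quantifiers matters: in a ring with a pendant cell, \<open>e\<close> is chosen opposite to
  \<open>u\<close>. The inequality is what the two minors through the pendant cell need.\<close>

lemma flexible_corner:
  assumes path: "cell_path P b K" and j: "1 \<le> j" "j < K"
    and corner: "b (Suc j) + b (j - 1) \<noteq> b j + b j"
  shows "\<exists>L u. \<forall>e m N. cell (b 0) \<inter> cell (b 1) = {e, m} \<and> e \<noteq> m \<longrightarrow>
    (\<exists>w qs. partial_system P b e (Suc j) w qs L u \<and> w L + w m + N \<le> w u + w e)"
proof -
  note st = path_step[OF path j]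
  obtain L' u' where new: "cell (b (Suc j)) - cell (b j) = {L', u'}" "L' \<noteq> u'"
    and X: "\<And>u. u \<in> cell (b j) - cell (b (j - 1)) \<Longrightarrow>
      \<exists>X. X \<in> cell (b j) \<inter> cell (b (j - 1)) \<and> minor P L' u u' X"
    using attach_corner[OF st(1-3) corner st(4,5)] by metis
  show ?thesis
  proof (rule exI[of _ L'], rule exI[of _ u'], intro allI impI, elim conjE)
    fix e m N assume em: "cell (b 0) \<inter> cell (b 1) = {e, m}" "e \<noteq> m"
    obtain w qs L u where sys: "partial_system P b e j w qs L u"
      using partial_exists[OF path em] j by (metis less_imp_le)
    have Lu: "cell (b j) - cell (b (j - 1)) = {L, u}" "L \<noteq> u" using sys by (auto simp: partial_system_def)
    obtain X where X: "X \<in> cell (b j)" "X \<in> cell (b (j - 1))" "minor P L' u u' X" using X[of u] Lu by auto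
    have *: "L' \<notin> region b j" "u' \<notin> region b j"
      using new_vertices[OF path, of "Suc j"] j new(1) by auto
    note un = partial_unpaired[OF path em sys less_imp_le[OF j(2)]]
    \<comment> \<open>In the new minor \<open>u\<close> and \<open>u'\<close> can carry the same
      weight, and \<open>L'\<close> then only has to exceed \<open>X\<close>. Shifting
      \<open>L\<close> and \<open>u\<close> by \<open>s\<close> thus raises \<open>u'\<close> but
      not \<open>L'\<close>, and \<open>s\<close> is the value that w L' + w m + N is going to
      have.\<close>
    define s where "s = w X + w m + N + 1"
    define w1 where "w1 = w(L := w L + s, u := w u + s)"
    define w2 where "w2 = w1(L' := Suc (w X), u' := w1 u)"
    have sys1: "partial_system P b e j w1 qs L u"
      unfolding w1_def using partial_shift[OF path em sys] j by simp
    have sys2: "partial_system P b e j w2 qs L u"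
      by (rule partial_cong[OF path em sys1]) (use * in \<open>auto simp: w2_def\<close>)
    have "X \<noteq> L" "X \<noteq> u" "X \<noteq> L'" "X \<noteq> u'" using X Lu new(1) by auto
    moreover have "u \<noteq> L'" "u \<noteq> u'" using Lu new(1) by auto
    moreover have "e \<noteq> L'" "e \<noteq> u'" "m \<noteq> L'" "m \<noteq> u'" using un(7,8)[of j] * by auto
    ultimately have w2: "w2 X = w X" "w2 u = w u + s" "w2 u' = w u + s" "w2 L' = Suc (w X)"
        "w2 e = w e" "w2 m = w m"
      using new(2) un(3-6) by (auto simp: w2_def w1_def)
    have "partial_system P b e (Suc j) w2 ((L', u, u', X) # qs) L' u'"
      using w2 j by (intro partial_extend[OF path em sys2 _ X(1) new X(3)]) auto
    moreover have "w2 L' + w2 m + N \<le> w2 u' + w2 e" using w2 by (simp add: s_def)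
    ultimately show "\<exists>w qs. partial_system P b e (Suc j) w qs L' u' \<and> w L' + w m + N \<le> w u' + w e"
      by blast
  qed
qed

text \<open>Every straight step consumes slack: \<open>L'\<close> needs a weight above that of
  \<open>L\<close>, while \<open>u'\<close> keeps that of \<open>u\<close>. One unit per step is
  enough, and the arbitrary \<open>N\<close> pays for it.\<close>

lemma flexible_after_corner:
  assumes path: "cell_path P b K" and i: "1 \<le> i" "i < K" "b (Suc i) + b (i - 1) \<noteq> b i + b i"
    and "Suc i \<le> j" "j \<le> K"
  shows "\<exists>L u. \<forall>e m N. cell (b 0) \<inter> cell (b 1) = {e, m} \<and> e \<noteq> m \<longrightarrow>
    (\<exists>w qs. partial_system P b e j w qs L u \<and> w L + w m + N \<le> w u + w e)"
  using assms(5,6)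
proof (induction j rule: nat_induct_at_least)
  case base
  show ?case using flexible_corner[OF path i] .
next
  case (Suc j)
  have j: "1 \<le> j" "j < K" using i Suc by auto
  show ?case
  proof (cases "b (Suc j) + b (j - 1) = b j + b j")
    case False
    then show ?thesis using flexible_corner[OF path j] by blast
  next
    case True
    note st = path_step[OF path j]
    obtain L u where sys: "\<forall>e m N. cell (b 0) \<inter> cell (b 1) = {e, m} \<and> e \<noteq> m \<longrightarrow>
        (\<exists>w qs. partial_system P b e j w qs L u \<and> w L + w m + N \<le> w u + w e)"
      using Suc.IH j by (metis less_imp_le)
    \<comment> \<open>The form of the edge \<open>{L, u}\<close> is known only through an actual
      system; if no \<open>e\<close> and \<open>m\<close> exist, the claim is vacuous.\<close>
    show ?thesis
    proof (cases "\<exists>e m. cell (b 0) \<inter> cell (b 1) = {e, m} \<and> e \<noteq> m")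
      case True': True
      then have Lu: "cell (b j) - cell (b (j - 1)) = {L, u}" "L \<noteq> u"
        using sys unfolding partial_system_def by blast+
      obtain L' u' where new: "cell (b (Suc j)) - cell (b j) = {L', u'}" "L' \<noteq> u'" "minor P L' u u' L"
        using attach_straight[OF st(1) True st(4,5) Lu] .
      have *: "L' \<notin> region b j" "u' \<notin> region b j"
        using new_vertices[OF path, of "Suc j"] j new(1) by auto
      show ?thesis
      proof (rule exI[of _ L'], rule exI[of _ u'], intro allI impI, elim conjE)
        fix e m N assume em: "cell (b 0) \<inter> cell (b 1) = {e, m}" "e \<noteq> m"
        obtain w qs where w: "partial_system P b e j w qs L u" "w L + w m + Suc N \<le> w u + w e"
          using sys em by blast
        note un = partial_unpaired[OF path em w(1) less_imp_le[OF j(2)]]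
        define w2 where "w2 = w(L' := Suc (w L), u' := w u)"
        have sys2: "partial_system P b e j w2 qs L u"
          by (rule partial_cong[OF path em w(1)]) (use * in \<open>auto simp: w2_def\<close>)
        have L: "L \<in> cell (b j)" "L \<noteq> L'" "L \<noteq> u'" "u \<noteq> L'" "u \<noteq> u'" using Lu new(1) by auto
        moreover have "e \<noteq> L'" "e \<noteq> u'" "m \<noteq> L'" "m \<noteq> u'" using un(7,8)[of j] * by auto
        ultimately have w2: "w2 L = w L" "w2 u = w u" "w2 u' = w u" "w2 L' = Suc (w L)"
            "w2 e = w e" "w2 m = w m"
          using new(2) by (auto simp: w2_def)
        have "partial_system P b e (Suc j) w2 ((L', u, u', L) # qs) L' u'"
          using w2 j by (intro partial_extend[OF path em sys2 _ L(1) new]) auto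
        then show "\<exists>w qs. partial_system P b e (Suc j) w qs L' u' \<and> w L' + w m + N \<le> w u' + w e"
          using w2 w(2) by (intro exI[of _ w2] exI[of _ "(L', u, u', L) # qs"]) auto
      qed
    qed blast
  qed
qed


section \<open>Closing the path\<close>

lemma adjacent_if_edge:
  assumes "cell c \<inter> cell d = {p, q}" "p \<noteq> q" "c \<noteq> d"
  shows "adjacent c d"
proof -
  have "p \<in> cell c" "p \<in> cell d" "q \<in> cell c" "q \<in> cell d" using assms(1) by auto
  moreover have "fst p \<noteq> fst q \<or> snd p \<noteq> snd q" "fst c \<noteq> fst d \<or> snd c \<noteq> snd d"
    using assms(2,3) by (auto simp: prod_eq_iff)
  ultimately show ?thesis unfolding mem_cell adjacent_iff by linarith
qed

definition diagonal :: "point \<Rightarrow> point \<Rightarrow> bool" where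
  "diagonal c d \<longleftrightarrow> (fst c = Suc (fst d) \<or> fst d = Suc (fst c)) \<and> (snd c = Suc (snd d) \<or> snd d = Suc (snd c))"

lemma diagonal_sym: "diagonal c d \<longleftrightarrow> diagonal d c"
  by (auto simp: diagonal_def)

text \<open>The common vertices form the interval from the componentwise maximum of \<open>c\<close>
  and \<open>d\<close> to their componentwise minimum plus (1, 1). It is a single point only if both
  coordinates differ by exactly one.\<close>

lemma diagonal_if_vertex:
  assumes "cell c \<inter> cell d = {v}"
  shows "diagonal c d"
proof -
  obtain x y x' y' where c: "c = (x, y)" "d = (x', y')" by (cases c; cases d)
  have v: "v \<in> cell c" "v \<in> cell d" using assms by auto
  then have near: "x \<le> Suc x'" "x' \<le> Suc x" "y \<le> Suc y'" "y' \<le> Suc y" by (auto simp: c mem_cell)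
  have "(max x x', max y y') = v"
  proof -
    have "(max x x', max y y') \<in> cell c \<inter> cell d" using near by (auto simp: c mem_cell)
    then show ?thesis using assms by auto
  qed
  moreover have "(Suc (min x x'), Suc (min y y')) = v"
  proof -
    have "(Suc (min x x'), Suc (min y y')) \<in> cell c \<inter> cell d" using near by (auto simp: c mem_cell)
    then show ?thesis using assms by auto
  qed
  ultimately have "max x x' = Suc (min x x')" "max y y' = Suc (min y y')" by auto
  then show ?thesis unfolding diagonal_def c by (auto simp: max_def min_def split: if_splits)
qed

lemma adjacent_edge:
  assumes "adjacent c d"
  obtains e m where "cell c \<inter> cell d = {e, m}" "e \<noteq> m"
  using assms
proof (cases rule: adjacent_cases)
  case (horizontal x x' y)
  then show ?thesis using that[of "(max x x', y)" "(max x x', Suc y)"] by (auto simp: cell_Pair)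
next
  case (vertical x y y')
  then show ?thesis using that[of "(x, max y y')" "(Suc x, max y y')"] by (auto simp: cell_Pair)
qed

lemma cell_between:
  assumes "adjacent c d" "adjacent d g" "c \<noteq> g"
  shows "cell c \<inter> cell g \<subseteq> cell d"
proof -
  have "fst c \<noteq> fst g \<or> snd c \<noteq> snd g" using assms(3) by (auto simp: prod_eq_iff)
  then show ?thesis using assms(1,2) unfolding adjacent_iff by (intro subsetI) (simp add: mem_cell, linarith)
qed

text \<open>Two neighbours of \<open>d\<close> on sides that are not opposite share a vertex, so
  disjoint ones lie opposite to each other.\<close>

lemma cell_opposite:
  assumes "adjacent c d" "adjacent d g" "cell c \<inter> cell g = {}"
  shows "cell d - cell c = cell d \<inter> cell g"
proof -
  obtain x y x' y' where c: "c = (x, y)" "g = (x', y')" by (cases c; cases g)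
  have "(max x x', max y y') \<notin> cell c \<inter> cell g" using assms by auto
  then have "Suc x < x' \<or> Suc x' < x \<or> Suc y < y' \<or> Suc y' < y" by (auto simp: c mem_cell)
  then show ?thesis using assms(1,2) unfolding adjacent_iff c set_eq_iff
    by (intro allI) (simp add: mem_cell, linarith)
qed

text \<open>This yields the case distinction at the shared vertex: the cell next to one end of the
  path either borders on the other end or stays clear of it.\<close>

lemma adjacent_or_disjoint:
  assumes "diagonal c d" "adjacent c g"
  shows "adjacent g d \<or> cell g \<inter> cell d = {}"
proof (rule disjCI)
  assume "cell g \<inter> cell d \<noteq> {}"
  then obtain p where "p \<in> cell g" "p \<in> cell d" by auto
  then show "adjacent g d" using assms unfolding mem_cell adjacent_iff diagonal_def by linarith
qed

lemma vertex_in_middle: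
  assumes "diagonal c d" "adjacent c g" "adjacent g d"
  shows "cell c \<inter> cell d \<subseteq> cell g"
  using assms unfolding adjacent_iff diagonal_def by (intro subsetI) (simp add: mem_cell, linarith)

text \<open>\<open>h\<close> lies on the side of \<open>d\<close> opposite to \<open>g\<close>,
  hence one step further away from \<open>c\<close> than \<open>d\<close> does.\<close>

lemma disjoint_beyond:
  assumes "diagonal c d" "adjacent c g" "adjacent g d" "adjacent h d" "cell h \<inter> cell g = {}"
  shows "cell c \<inter> cell h = {}"
proof -
  obtain x y x' y' where c: "h = (x, y)" "g = (x', y')" by (cases h; cases g)
  have "(max x x', max y y') \<notin> cell h \<inter> cell g" using assms by auto
  then have "Suc x < x' \<or> Suc x' < x \<or> Suc y < y' \<or> Suc y' < y" by (auto simp: c mem_cell)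
  then show ?thesis using assms(1-4) unfolding adjacent_iff diagonal_def c set_eq_iff
    by (intro allI) (simp add: mem_cell, linarith)
qed

lemma inner_interval_cell: "cell (x, y) \<in> P \<Longrightarrow> inner_interval P (x, y) (Suc x, Suc y)"
  by (rule inner_intervalI) (auto simp: less_Suc_eq_le dest: le_antisym)

text \<open>The shared vertex \<open>v\<close> has to stay out of the paired diagonal, as the other
  end of the path may have paired it already. So the minor of \<open>cell c\<close> pairs
  \<open>M\<close>, the other vertex off \<open>d\<close>, with its opposite corner
  \<open>e\<close>, and this \<open>e\<close> is the vertex to be kept unpaired elsewhere.\<close>

lemma attach_last:
  assumes "adjacent c d" "v \<in> cell c - cell d" "cell c \<in> P"
  obtains e m M where "cell d \<inter> cell c = {e, m}" "e \<noteq> m" "M \<in> cell c - cell d" "M \<noteq> v" "minor P e M m v"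
proof -
  obtain x y where c: "c = (x, y)" by (cases c)
  obtain vx vy where v: "v = (vx, vy)" by (cases v)
  \<comment> \<open>\<open>(x', y')\<close> is the corner of the cell opposite to
    \<open>v\<close>.\<close>
  define x' where "x' = 2 * x + 1 - vx"
  define y' where "y' = 2 * y + 1 - vy"
  have vc: "vx = x \<and> x' = Suc x \<or> vx = Suc x \<and> x' = x" "vy = y \<and> y' = Suc y \<or> vy = Suc y \<and> y' = y"
    using assms(2) by (auto simp: c v mem_cell x'_def y'_def)
  have "inner_interval P (x, y) (Suc x, Suc y)" using assms(3) inner_interval_cell c by simp
  then have *: "minor P p q r v" if "fst p \<noteq> fst q" "snd p \<noteq> snd q" "{r, v} = {(fst p, snd q), (fst q, snd p)}"
      "p \<in> cell c" "q \<in> cell c" for p q r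
  proof -
    have "min (fst p) (fst q) = x" "max (fst p) (fst q) = Suc x"
      "min (snd p) (snd q) = y" "max (snd p) (snd q) = Suc y"
      using that(1,2,4,5) by (auto simp: c mem_cell)
    then show ?thesis using that \<open>inner_interval P (x, y) (Suc x, Suc y)\<close> by (simp add: minor_def)
  qed
  show ?thesis using assms(1)
  proof (cases rule: adjacent_cases)
    case (horizontal a b z)
    show ?thesis
    proof (rule that[of "(x', vy)" "(x', y')" "(vx, y')"])
      show "cell d \<inter> cell c = {(x', vy), (x', y')}" "(vx, y') \<in> cell c - cell d"
        using vc horizontal assms(2) by (auto simp: c v cell_Pair)
      show "minor P (x', vy) (vx, y') (x', y') v"
        using vc by (intro *) (auto simp: c v mem_cell)
    qed (use vc in \<open>auto simp: v\<close>)
  next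
    case (vertical a b z)
    show ?thesis
    proof (rule that[of "(vx, y')" "(x', y')" "(x', vy)"])
      show "cell d \<inter> cell c = {(vx, y'), (x', y')}" "(x', vy) \<in> cell c - cell d"
        using vc vertical assms(2) by (auto simp: c v cell_Pair)
      show "minor P (vx, y') (x', vy) (x', y') v"
        using vc by (intro *) (auto simp: c v mem_cell)
    qed (use vc in \<open>auto simp: v\<close>)
  qed
qed

text \<open>\<open>e\<close> is the corner of \<open>cell d\<close> opposite to \<open>u\<close>,
  and \<open>m\<close> the one opposite to \<open>L\<close>. Together the two minors pair
  \<open>s\<close>, \<open>t\<close>, \<open>u\<close> and \<open>e\<close>; their strict
  inequalities add up to w L + w m + 2 \<le> w u + w e.\<close>

lemma attach_pendant:
  assumes "adjacent c d" "adjacent d g" "diagonal c g" "cell c \<in> P" "cell d \<in> P"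
    and "cell d \<inter> cell g = {L, u}" "L \<noteq> u"
  obtains e m s t where "cell d - cell g = {e, m}" "e \<noteq> m" "cell c - cell d = {s, t}" "s \<noteq> t"
    "minor P s u t m" "minor P t e s L"
  using assms(1)
proof (cases rule: adjacent_cases)
  case (horizontal x x' y)
  obtain ux uy where u: "u = (ux, uy)" by (cases u)
  have "u \<in> cell d" "u \<in> cell g" "L \<in> cell d" "L \<in> cell g" using assms(6) by auto
  have g: "fst g = x" "snd g = Suc y \<or> y = Suc (snd g)"
    using assms(2,3) horizontal by (auto simp: adjacent_iff diagonal_def)
  define ux' where "ux' = 2 * x + 1 - ux"
  define uy' where "uy' = 2 * y + 1 - uy"
  have uc: "ux = x \<and> ux' = Suc x \<or> ux = Suc x \<and> ux' = x" "uy = y \<and> uy' = Suc y \<or> uy = Suc y \<and> uy' = y"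
    using \<open>u \<in> cell d\<close> by (auto simp: horizontal u mem_cell ux'_def uy'_def)
  have L: "L = (ux', uy)" using \<open>u \<in> cell g\<close> \<open>L \<in> cell d\<close> \<open>L \<in> cell g\<close> uc g assms(7) horizontal
    by (cases L) (auto simp: mem_cell u)
  have e: "(ux', uy') \<in> cell d" using uc by (auto simp: mem_cell horizontal)
  have "cell d - cell g = {(ux', uy'), (ux, uy')}"
    using uc g \<open>u \<in> cell g\<close> by (cases g) (auto simp: horizontal u cell_Pair)
  moreover have "(ux', uy') \<noteq> (ux, uy')" using uc by auto
  moreover have "Suc (2 * y) - uy' = uy" "Suc (2 * y) - uy = uy'" using uc by auto
  moreover note attach_horizontal[OF horizontal assms(4) disjI1[OF assms(5)] \<open>u \<in> cell d\<close>]
    attach_horizontal(3)[OF horizontal assms(4) disjI1[OF assms(5)] e]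
  ultimately show ?thesis
    using that[of "(ux', uy')" "(ux, uy')" "(if x' < x then x' else Suc x', uy')" "(if x' < x then x' else Suc x', uy)"]
    by (simp add: L u)
next
  case (vertical x y y')
  obtain ux uy where u: "u = (ux, uy)" by (cases u)
  have "u \<in> cell d" "u \<in> cell g" "L \<in> cell d" "L \<in> cell g" using assms(6) by auto
  have g: "snd g = y" "fst g = Suc x \<or> x = Suc (fst g)"
    using assms(2,3) vertical by (auto simp: adjacent_iff diagonal_def)
  define ux' where "ux' = 2 * x + 1 - ux"
  define uy' where "uy' = 2 * y + 1 - uy"
  have uc: "ux = x \<and> ux' = Suc x \<or> ux = Suc x \<and> ux' = x" "uy = y \<and> uy' = Suc y \<or> uy = Suc y \<and> uy' = y"
    using \<open>u \<in> cell d\<close> by (auto simp: vertical u mem_cell ux'_def uy'_def)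
  have L: "L = (ux, uy')" using \<open>u \<in> cell g\<close> \<open>L \<in> cell d\<close> \<open>L \<in> cell g\<close> uc g assms(7) vertical
    by (cases L) (auto simp: mem_cell u)
  have e: "(ux', uy') \<in> cell d" using uc by (auto simp: mem_cell vertical)
  have "cell d - cell g = {(ux', uy'), (ux', uy)}"
    using uc g \<open>u \<in> cell g\<close> by (cases g) (auto simp: vertical u cell_Pair)
  moreover have "(ux', uy') \<noteq> (ux', uy)" using uc by auto
  moreover have "Suc (2 * x) - ux' = ux" "Suc (2 * x) - ux = ux'" using uc by auto
  moreover note attach_vertical[OF vertical assms(4) disjI1[OF assms(5)] \<open>u \<in> cell d\<close>]
    attach_vertical(3)[OF vertical assms(4) disjI1[OF assms(5)] e]
  ultimately show ?thesis
    using that[of "(ux', uy')" "(ux', uy)" "(ux', if y' < y then y' else Suc y')" "(ux, if y' < y then y' else Suc y')"]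
    by (simp add: L u)
qed

text \<open>Cells two steps apart meet only inside the cell between them, and cells further apart
  are disjoint, so the vertices of a cell off its predecessor are new. \<open>far\<close> starts at
  index 1 because the closing cell may meet \<open>b 0\<close> again.\<close>

lemma cell_pathI:
  assumes "\<And>j. j < K \<Longrightarrow> adjacent (b (Suc j)) (b j)" "\<And>j. j + 2 \<le> K \<Longrightarrow> b (j + 2) \<noteq> b j"
    and "\<And>j. 1 \<le> j \<Longrightarrow> j \<le> K \<Longrightarrow> cell (b j) \<in> P"
    and far: "\<And>i j. 1 \<le> i \<Longrightarrow> i + 3 \<le> j \<Longrightarrow> j \<le> K \<Longrightarrow> cell (b i) \<inter> cell (b j) = {}"
  shows "cell_path P b K"
proof -
  have "(cell (b (Suc j)) - cell (b j)) \<inter> region b j = {}" if "j < K" for j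
  proof -
    have "(cell (b (Suc j)) - cell (b j)) \<inter> cell (b l) = {}" if l: "1 \<le> l" "l \<le> j" for l
    proof -
      consider "l = j" | "Suc l = j" | "l + 3 \<le> Suc j" using l by linarith
      then show ?thesis
      proof cases
        case 2
        then have "cell (b (Suc j)) \<inter> cell (b l) \<subseteq> cell (b j)"
          using assms(1)[of j] assms(1)[of l] assms(2)[of l] that \<open>j < K\<close> by (intro cell_between) auto
        then show ?thesis by blast
      next
        case 3
        then show ?thesis using far[of l "Suc j"] l \<open>j < K\<close> by auto
      qed auto
    qed
    moreover have "(cell (b (Suc j)) - cell (b j)) \<inter> (cell (b 0) \<inter> cell (b 1)) = {}"
    proof (cases j)
      case (Suc i)
      then show ?thesis using calculation[of 1] by auto
    qed auto
    ultimately show ?thesis unfolding region_def by fastforce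
  qed
  then show ?thesis using assms(1-3) by (auto simp: cell_path_def)
qed

text \<open>The last condition is disjointness at cyclic distance at least 3. The pairs
  \<open>a 1\<close>, \<open>a (n - 1)\<close> and \<open>a 0\<close>, \<open>a (n - 2)\<close> are
  at cyclic distance 2 across the shared vertex, and it stays open whether they meet.\<close>

definition weak_ring :: "point set set \<Rightarrow> nat \<Rightarrow> (nat \<Rightarrow> point) \<Rightarrow> bool" where
  "weak_ring P n a \<longleftrightarrow> n \<ge> 6 \<and> inj_on a {..<n} \<and> (\<forall>i<n. cell (a i) \<in> P) \<and>
     (\<forall>i. Suc i < n \<longrightarrow> adjacent (a i) (a (Suc i))) \<and> diagonal (a 0) (a (n - 1)) \<and>
     (\<forall>i j. j < n \<and> i + 3 \<le> j \<and> j + 3 \<le> n + i \<longrightarrow> cell (a i) \<inter> cell (a j) = {})"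

lemma weak_ring_rev:
  assumes "weak_ring P n a"
  shows "weak_ring P n (\<lambda>i. a (n - 1 - i))"
proof -
  have "inj_on (\<lambda>i. a (n - 1 - i)) {..<n}"
  proof (rule inj_onI)
    fix x y assume xy: "x \<in> {..<n}" "y \<in> {..<n}" "a (n - 1 - x) = a (n - 1 - y)"
    have "inj_on a {..<n}" using assms by (simp add: weak_ring_def)
    then have "n - 1 - x = n - 1 - y" using xy by (auto dest: inj_onD)
    then show "x = y" using xy by auto
  qed
  moreover have "adjacent (a (n - 1 - i)) (a (n - 1 - Suc i))" if "Suc i < n" for i
  proof -
    have "n - 1 - i = Suc (n - 1 - Suc i)" "Suc (n - 1 - Suc i) < n" using that by auto
    then show ?thesis using assms by (auto simp: weak_ring_def adjacent_sym)
  qed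
  moreover have "cell (a (n - 1 - i)) \<inter> cell (a (n - 1 - j)) = {}"
    if "j < n" "i + 3 \<le> j" "j + 3 \<le> n + i" for i j
  proof -
    have "n - 1 - i < n" "(n - 1 - j) + 3 \<le> n - 1 - i" "(n - 1 - i) + 3 \<le> n + (n - 1 - j)" using that by auto
    then have "cell (a (n - 1 - j)) \<inter> cell (a (n - 1 - i)) = {}" using assms unfolding weak_ring_def by blast
    then show ?thesis by blast
  qed
  ultimately show ?thesis using assms by (auto simp: weak_ring_def diagonal_sym)
qed

lemma weak_ringD:
  assumes "weak_ring P n a"
  shows "n \<ge> 6" "i < n \<Longrightarrow> j < n \<Longrightarrow> a i = a j \<longleftrightarrow> i = j" "i < n \<Longrightarrow> cell (a i) \<in> P"
    "Suc i < n \<Longrightarrow> adjacent (a i) (a (Suc i))" "diagonal (a 0) (a (n - 1))"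
    "j < n \<Longrightarrow> i + 3 \<le> j \<Longrightarrow> j + 3 \<le> n + i \<Longrightarrow> cell (a i) \<inter> cell (a j) = {}"
  using assms by (auto simp: weak_ring_def inj_on_def)

text \<open>The path runs from \<open>a (n - 2)\<close> down to \<open>a 0\<close>, and
  \<open>a (n - 1)\<close> serves as \<open>b 0\<close>, whose own minor is added at the end. Its
  vertex \<open>M\<close> belongs to no other cell and \<open>e\<close> was kept unpaired, so both
  are available.\<close>

lemma ring_system_generic:
  assumes ring: "weak_ring P n a"
    and disj: "cell (a 1) \<inter> cell (a (n - 1)) = {}" "cell (a 0) \<inter> cell (a (n - 2)) = {}"
    and v: "cell (a 0) \<inter> cell (a (n - 1)) = {v}"
  shows "\<exists>w qs. minor_system P w qs \<and> length qs = n"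
proof -
  note R = weak_ringD[OF ring]
  define b where "b j = a (n - 1 - j)" for j
  have path: "cell_path P b (n - 1)"
  proof (rule cell_pathI)
    fix j assume "j < n - 1"
    then show "adjacent (b (Suc j)) (b j)" using R(4)[of "n - 1 - Suc j"]
      by (simp add: b_def Suc_diff_Suc)
  next
    fix i j assume ij: "1 \<le> i" "i + 3 \<le> j" "j \<le> n - 1"
    show "cell (b i) \<inter> cell (b j) = {}"
    proof (cases "i = 1 \<and> j = n - 1")
      case True
      then have "b i = a (n - 2)" "b j = a 0" by (auto simp: b_def numeral_2_eq_2)
      then show ?thesis using disj(2) by (simp add: Int_commute)
    next
      case False
      then have "cell (b j) \<inter> cell (b i) = {}" unfolding b_def by (intro R(6)) (use ij in auto)
      then show ?thesis by auto
    qed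
  qed (use R(1-3) in \<open>auto simp: b_def\<close>)
  have b: "b 0 = a (n - 1)" "b 1 = a (n - 2)" by (auto simp: b_def numeral_2_eq_2)
  have adj: "adjacent (a (n - 1)) (a (n - 2))" using R(4)[of "n - 2"] R(1)
    by (simp add: adjacent_sym Suc_diff_Suc numeral_2_eq_2)
  have v': "v \<in> cell (a (n - 1)) - cell (a (n - 2))" using v disj(2) by auto
  have "cell (a (n - 1)) \<in> P" using R(1,3) by auto
  then obtain e m M where em: "cell (a (n - 2)) \<inter> cell (a (n - 1)) = {e, m}" "e \<noteq> m"
      and M: "M \<in> cell (a (n - 1)) - cell (a (n - 2))" "M \<noteq> v" "minor P e M m v"
    using attach_last[OF adj v'] by metis
  have em': "cell (b 0) \<inter> cell (b 1) = {e, m}" using em(1) b by auto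
  obtain w qs L u where sys: "partial_system P b e (n - 1) w qs L u"
  proof -
    have "1 \<le> n - 1" using R(1) by simp
    then show ?thesis using partial_exists[OF path em' em(2), of "n - 1"] that by blast
  qed
  have "M \<notin> region b (n - 1)"
  proof -
    have "M \<notin> cell (b l)" if l: "1 \<le> l" "l \<le> n - 1" for l
    proof -
      \<comment> \<open>At cyclic distance at least 3 from \<open>a (n - 1)\<close> the ring gives
        disjointness; the two nearest cells on either side need arguments of their own.\<close>
      consider "l = 1" | "l = 2" | "3 \<le> l" "l \<le> n - 3" | "l = n - 2" | "l = n - 1" using l by linarith
      then show ?thesis
      proof cases
        case 1
        then show ?thesis using M b by auto
      next
        case 2
        have "adjacent (b 0) (b 1)" "adjacent (b 1) (b 2)"
          using path R(1) by (auto simp: cell_path_def adjacent_sym numeral_2_eq_2)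
        moreover have "b 0 \<noteq> b 2" using R(1) R(2)[of "n - 1" "n - 1 - 2"] by (simp add: b_def)
        ultimately have "cell (b 0) \<inter> cell (b 2) \<subseteq> cell (b 1)" by (rule cell_between)
        then show ?thesis using M(1) unfolding b 2 by blast
      next
        case 3
        then have "cell (a (n - 1 - l)) \<inter> cell (a (n - 1)) = {}" by (intro R(6)) auto
        then show ?thesis using M(1) by (auto simp: b_def)
      next
        case 4
        then have "b l = a 1" using R(1) by (simp add: b_def)
        then show ?thesis using M(1) disj(1) by auto
      next
        case 5
        then have "b l = a 0" using R(1) by (simp add: b_def)
        then show ?thesis using M(1,2) v by auto
      qed
    qed
    then show ?thesis using M(1) b unfolding region_def by auto
  qed
  moreover have t: "touched qs \<subseteq> region b (n - 1)" using partial_touched[OF path em' em(2) sys] .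
  ultimately have M': "M \<notin> touched qs" "M \<notin> set (paired qs)" using paired_touched by blast+
  have sys': "minor_system P w qs" "length qs = n - 1" "e \<notin> set (paired qs)"
    using sys by (auto simp: partial_system_def)
  define w' where "w' = w(M := Suc (w m + w v))"
  have ne: "e \<noteq> M" "m \<noteq> M" "v \<noteq> M" using em M by auto
  have "minor_system P w' qs"
    by (rule minor_system_cong[OF sys'(1)]) (use M' in \<open>auto simp: w'_def\<close>)
  then have "minor_system P w' ((e, M, m, v) # qs)"
    using ne M(3) M' sys'(3) by (auto simp: minor_system_Cons w'_def)
  then show ?thesis using sys'(2) R(1) by (intro exI[of _ w'] exI[of _ "(e, M, m, v) # qs"]) auto
qed

text \<open>Without corners the path repeats its first step, and for \<open>K\<close> at least 2 its
  last cell is too far from \<open>b 0\<close> to be adjacent.\<close>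

lemma corner_exists:
  assumes path: "cell_path P b K" and "2 \<le> K" and adj: "adjacent (b K) (b 0)"
  shows "\<exists>i. 1 \<le> i \<and> i < K \<and> b (Suc i) + b (i - 1) \<noteq> b i + b i"
proof (rule ccontr)
  assume "\<not> ?thesis"
  then have straight: "b (Suc (Suc i)) + b i = b (Suc i) + b (Suc i)" if "Suc i < K" for i
    using that by (metis Suc_leI diff_Suc_1 zero_less_Suc One_nat_def)
  have *: "int (fst (b i)) = int (fst (b 0)) + int i * (int (fst (b 1)) - int (fst (b 0))) \<and>
     int (snd (b i)) = int (snd (b 0)) + int i * (int (snd (b 1)) - int (snd (b 0))) \<and>
     int (fst (b (Suc i))) = int (fst (b i)) + (int (fst (b 1)) - int (fst (b 0))) \<and>
     int (snd (b (Suc i))) = int (snd (b i)) + (int (snd (b 1)) - int (snd (b 0)))" if "i < K" for i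
    using that
  proof (induction i)
    case (Suc i)
    have "fst (b (Suc (Suc i))) + fst (b i) = 2 * fst (b (Suc i))"
      "snd (b (Suc (Suc i))) + snd (b i) = 2 * snd (b (Suc i))"
      using straight[of i] Suc.prems by (auto simp: prod_eq_iff)
    then have "int (fst (b (Suc (Suc i)))) + int (fst (b i)) = 2 * int (fst (b (Suc i)))"
      "int (snd (b (Suc (Suc i)))) + int (snd (b i)) = 2 * int (snd (b (Suc i)))" by linarith+
    then show ?case using Suc by (auto simp: algebra_simps)
  qed auto
  have 1: "adjacent (b 1) (b 0)" using path assms(2) by (auto simp: cell_path_def)
  define dx dy where "dx = int (fst (b 1)) - int (fst (b 0))" and "dy = int (snd (b 1)) - int (snd (b 0))"
  have "int (fst (b K)) = int (fst (b 0)) + int K * dx" "int (snd (b K)) = int (snd (b 0)) + int K * dy"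
    using *[of "K - 1"] assms(2) by (auto simp: dx_def dy_def algebra_simps of_nat_diff)
  moreover have "dx = 0 \<and> \<bar>dy\<bar> = 1 \<or> dy = 0 \<and> \<bar>dx\<bar> = 1" using 1 by (auto simp: adjacent_iff dx_def dy_def)
  then have "dx = 0 \<and> dy = 1 \<or> dx = 0 \<and> dy = - 1 \<or> dy = 0 \<and> dx = 1 \<or> dy = 0 \<and> dx = - 1" by auto
  ultimately show False using adj assms(2) unfolding adjacent_iff by (elim disjE conjE) auto
qed

text \<open>The neighbours \<open>a 2\<close> and \<open>a (n - 1)\<close> of
  \<open>b 0 = a 1\<close> are disjoint, hence on opposite sides of it, so the first edge
  \<open>{e, m}\<close> and the last edge \<open>{L, u}\<close> of the path are opposite edges of
  \<open>a 1\<close>. The path supplies n - 2 minors, and attaching \<open>a 0\<close> gives the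
  other two.\<close>

lemma ring_system_pendant:
  assumes ring: "weak_ring P n a" and adj: "adjacent (a 1) (a (n - 1))"
  shows "\<exists>w qs. minor_system P w qs \<and> length qs = n"
proof -
  note R = weak_ringD[OF ring]
  have n: "n - 1 < n" "n - 2 < n" "Suc (n - 2) = n - 1" using R(1) by auto
  define b where "b j = a (Suc j)" for j
  define K where "K = n - 2"
  have K: "1 \<le> K" "2 \<le> K" "K + 2 = n" using R(1) by (auto simp: K_def)
  have path: "cell_path P b K"
  proof (rule cell_pathI)
    fix j assume "j < K"
    then show "adjacent (b (Suc j)) (b j)" using R(4)[of "Suc j"] by (simp add: b_def K_def adjacent_sym)
  next
    fix i j assume ij: "1 \<le> i" "i + 3 \<le> j" "j \<le> K"
    show "cell (b i) \<inter> cell (b j) = {}" unfolding b_def by (rule R(6)) (use ij K in auto)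
  qed (use R(1-3) in \<open>auto simp: b_def K_def\<close>)
  have b: "b 0 = a 1" "b 1 = a 2" "b K = a (n - 1)" "b (K - 1) = a (n - 2)"
    using K by (auto simp: b_def K_def numeral_2_eq_2 Suc_diff_Suc)
  have adj': "adjacent (b K) (b 0)" using adj b by (simp add: adjacent_sym)
  obtain L u where flex: "\<forall>e m N. cell (b 0) \<inter> cell (b 1) = {e, m} \<and> e \<noteq> m \<longrightarrow>
      (\<exists>w qs. partial_system P b e K w qs L u \<and> w L + w m + N \<le> w u + w e)"
  proof -
    obtain i where "1 \<le> i" "i < K" "b (Suc i) + b (i - 1) \<noteq> b i + b i"
      using corner_exists[OF path K(2) adj'] by blast
    from flexible_after_corner[OF path this Suc_leI[OF this(2)] order_refl] that show ?thesis by blast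
  qed
  have a: "adjacent (a 0) (a 1)" "adjacent (a 1) (a 2)" "adjacent (a (n - 2)) (a (n - 1))"
    using R(1) R(4)[of 0] R(4)[of 1] R(4)[of "n - 2"] n(3) by (auto simp: numeral_2_eq_2)
  have "cell (a 2) \<inter> cell (a (n - 1)) = {}" using R(1) by (intro R(6)) auto
  then have far: "cell (a (n - 1)) \<inter> cell (a 2) = {}" by auto
  have e1: "cell (a 1) - cell (a (n - 1)) = cell (b 0) \<inter> cell (b 1)"
    using cell_opposite[OF _ a(2) far] adj b by (simp add: adjacent_sym)
  have "cell (a 1) \<inter> cell (a (n - 2)) = {}" using R(1) by (intro R(6)) auto
  then have far2: "cell (a (n - 2)) \<inter> cell (a 1) = {}" by auto
  have e2: "cell (b K) - cell (b (K - 1)) = cell (a 1) \<inter> cell (a (n - 1))"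
    using cell_opposite[OF a(3) _ far2] adj b by (auto simp: adjacent_sym)
  have P: "cell (a 0) \<in> P" "cell (a 1) \<in> P" using R(1,3) by auto
  have Lu: "cell (b K) - cell (b (K - 1)) = {L, u}" "L \<noteq> u"
  proof -
    obtain e m where "cell (b 0) \<inter> cell (b 1) = {e, m}" "e \<noteq> m"
      using adjacent_edge[OF a(2)] b(1,2) by metis
    then show "cell (b K) - cell (b (K - 1)) = {L, u}" "L \<noteq> u"
      using flex unfolding partial_system_def by blast+
  qed
  obtain e m s t where em: "cell (b 0) \<inter> cell (b 1) = {e, m}" "e \<noteq> m"
    and st: "cell (a 0) - cell (a 1) = {s, t}" "s \<noteq> t" "minor P s u t m" "minor P t e s L"
    using attach_pendant[OF a(1) adj R(5) P] e1 e2 Lu by metis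
  \<comment> \<open>The slack 2 is what the two strict inequalities of the pendant minors require in
    natural numbers.\<close>
  obtain w qs where sys: "partial_system P b e K w qs L u" and w: "w L + w m + 2 \<le> w u + w e"
    using flex em by blast
  have new: "{s, t} \<inter> region b K = {}"
  proof -
    have "(cell (a 0) - cell (a 1)) \<inter> cell (b l) = {}" if l: "1 \<le> l" "l \<le> K" for l
    proof -
      consider "l = 1" | "2 \<le> l" "l + 2 \<le> K" | "Suc l = K" | "l = K" using l by linarith
      then show ?thesis
      proof cases
        case 1
        have "a 0 \<noteq> a 2" using R(1,2) by auto
        then have "cell (a 0) \<inter> cell (a 2) \<subseteq> cell (a 1)" by (rule cell_between[OF a(1,2)])
        then show ?thesis unfolding 1 b(2) by blast
      next
        case 2
        then have "cell (a 0) \<inter> cell (a (Suc l)) = {}" using K by (intro R(6)) auto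
        then show ?thesis by (auto simp: b_def)
      next
        case 3
        then have "b l = a (n - 2)" using b(4) by (metis diff_Suc_1)
        then show ?thesis using disjoint_beyond[OF R(5) a(1) adj a(3) far2] by auto
      next
        case 4
        then show ?thesis using vertex_in_middle[OF R(5) a(1) adj] b by auto
      qed
    qed
    then have "p \<notin> cell (b l)" if "p \<in> cell (a 0)" "p \<notin> cell (a 1)" "l \<in> {1..K}" for p l
      using that by (metis DiffI IntI atLeastAtMost_iff empty_iff)
    then show ?thesis unfolding region_def b(1) st(1)[symmetric] by blast
  qed
  then have st': "s \<notin> touched qs" "t \<notin> touched qs" "s \<notin> set (paired qs)" "t \<notin> set (paired qs)"
    using partial_touched[OF path em sys] paired_touched[of qs] by blast+
  note un = partial_unpaired[OF path em sys order_refl]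
  have sys': "minor_system P w qs" "length qs = K" "e \<notin> set (paired qs)"
    using sys by (auto simp: partial_system_def)
  have "L \<in> region b K" "u \<in> region b K" using Lu cell_region[OF K(1), of b] by auto
  then have ne: "s \<noteq> L" "t \<noteq> L" "s \<noteq> u" "t \<noteq> u" "s \<noteq> e" "t \<noteq> e" "s \<noteq> m" "t \<noteq> m"
    using new un(7,8)[of K] by auto
  \<comment> \<open>With these values the minor pairing \<open>t\<close> and \<open>e\<close>
    demands w e + w L < w L + 1 + w e, and the one pairing \<open>s\<close> and \<open>u\<close>
    demands w L + 1 + w m < w e + w u, which the slack covers.\<close>
  define w' where "w' = w(s := w e, t := Suc (w L))"
  have w': "w' s = w e" "w' t = Suc (w L)" "w' L = w L" "w' u = w u" "w' e = w e" "w' m = w m"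
    using ne st(2) by (auto simp: w'_def)
  have "minor_system P w' qs"
    by (rule minor_system_cong[OF sys'(1)]) (use st' in \<open>auto simp: w'_def\<close>)
  then have "minor_system P w' ((s, u, t, m) # (t, e, s, L) # qs)"
    using ne st un(1,3) st' sys'(3) w w' by (auto simp: minor_system_Cons paired_Cons)
  then show ?thesis using sys'(2) K(3)
    by (intro exI[of _ w'] exI[of _ "(s, u, t, m) # (t, e, s, L) # qs"]) auto
qed

text \<open>A pendant cell at the other end of the path is the same situation in the reversed
  ring.\<close>

lemma ring_system:
  assumes ring: "weak_ring P n a" and v: "cell (a 0) \<inter> cell (a (n - 1)) = {v}"
  shows "\<exists>w qs. minor_system P w qs \<and> length qs = n"
proof -
  note R = weak_ringD[OF ring]
  have a: "adjacent (a 0) (a 1)" "adjacent (a (n - 1)) (a (n - 2))"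
    using R(1) R(4)[of 0] R(4)[of "n - 2"] by (auto simp: adjacent_sym numeral_2_eq_2 Suc_diff_Suc)
  consider "adjacent (a 1) (a (n - 1))" | "adjacent (a (n - 2)) (a 0)"
    | "cell (a 1) \<inter> cell (a (n - 1)) = {}" "cell (a 0) \<inter> cell (a (n - 2)) = {}"
    using adjacent_or_disjoint[OF R(5) a(1)] adjacent_or_disjoint[OF _ a(2), of "a 0"] R(5)
    by (auto simp: diagonal_sym)
  then show ?thesis
  proof cases
    case 1
    then show ?thesis using ring_system_pendant[OF ring] by blast
  next
    case 2
    have "n - 1 - 1 = n - 2" "n - 1 - (n - 1) = 0" by auto
    then show ?thesis using ring_system_pendant[OF weak_ring_rev[OF ring]] 2 by metis
  next
    case 3
    then show ?thesis using ring_system_generic[OF ring] v by blast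
  qed
qed

section \<open>From weakly closed paths to rings of cells\<close>

lemma weakly_closed_path_ring:
  assumes "weakly_closed_path P n A"
  obtains a v where "weak_ring P n a" "P = (\<lambda>i. cell (a i)) ` {..<n}" "cell (a 0) \<inter> cell (a (n - 1)) = {v}"
proof -
  have P: "\<forall>C\<in>P. is_cell C" "P = A ` {0..n}" and n: "n \<ge> 6" and A0: "A 0 = A n"
    and inj: "\<forall>i\<in>{1..n}. \<forall>j\<in>{1..n}. i \<noteq> j \<longrightarrow> A i \<noteq> A j"
    and v: "\<exists>v. A 0 \<inter> A (n - 1) = {v}"
    and edge: "\<forall>i\<in>{0..n - 2}. A i \<inter> A (i + 1) \<in> edges (A i) \<inter> edges (A (i + 1))"
    and far: "\<forall>i\<in>{1..n}. \<forall>j\<in>{1..n}.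
        (\<forall>d\<in>{-2..2::int}. \<not> [int j = int i + d] (mod int n)) \<longrightarrow> A i \<inter> A j = {}"
    using assms unfolding weakly_closed_path_def cell_collection_def by blast+
  define a where "a i = (SOME c. A i = cell c)" for i
  have A: "A i = cell (a i)" if "i \<le> n" for i
  proof -
    have "\<exists>c. A i = cell c" using P that by (auto simp: is_cell_iff)
    then show ?thesis unfolding a_def by (rule someI_ex)
  qed
  have P': "P = (\<lambda>i. cell (a i)) ` {..<n}"
  proof -
    have "{0..n} = insert n {..<n}" by auto
    then have "P = insert (A n) (A ` {..<n})" using P(2) by simp
    also have "\<dots> = A ` {..<n}" using A0 n by (metis (full_types) imageI insert_absorb lessThan_iff less_le_trans zero_less_numeral)
    also have "\<dots> = (\<lambda>i. cell (a i)) ` {..<n}" using A by (intro image_cong) auto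
    finally show ?thesis .
  qed
  \<comment> \<open>The conditions on the path use the indices 1, ..., n, the ring uses 0, ..., n -
    1; as \<open>A 0 = A n\<close>, the index 0 is read as n.\<close>
  define r where "r i = (if i = 0 then n else i)" for i
  have r: "r i \<in> {1..n}" "A (r i) = A i" if "i < n" for i using that n A0 by (auto simp: r_def)
  have inj': "A i \<noteq> A j" if "i < n" "j < n" "i \<noteq> j" for i j
  proof -
    have "r i \<noteq> r j" using that by (auto simp: r_def)
    then show ?thesis using inj r that by metis
  qed
  have "weak_ring P n a" unfolding weak_ring_def
  proof (intro conjI allI impI)
    show "6 \<le> n" by (fact n)
    show "inj_on a {..<n}" by (rule inj_onI) (use inj' A in \<open>metis lessThan_iff less_imp_le\<close>)
    show "cell (a i) \<in> P" if "i < n" for i using that P' by auto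
    show "adjacent (a i) (a (Suc i))" if i: "Suc i < n" for i
    proof -
      have "A i \<inter> A (Suc i) \<in> edges (A i)" using edge i by auto
      then obtain p q where "cell (a i) \<inter> cell (a (Suc i)) = {p, q}" "adjacent p q"
        using A[of i] A[of "Suc i"] i by (auto simp: edges_def)
      moreover have "p \<noteq> q" using \<open>adjacent p q\<close> by (auto simp: adjacent_iff)
      moreover have "a i \<noteq> a (Suc i)" using inj'[of i "Suc i"] A[of i] A[of "Suc i"] i by auto
      ultimately show ?thesis using adjacent_if_edge by blast
    qed
    show "diagonal (a 0) (a (n - 1))" using v A[of 0] A[of "n - 1"] by (auto intro: diagonal_if_vertex)
    fix i j assume ij: "j < n \<and> i + 3 \<le> j \<and> j + 3 \<le> n + i"
    have "A (r i) \<inter> A (r j) = {}"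
    proof -
      have "\<not> [int (r j) = int (r i) + d] (mod int n)" if d: "d \<in> {-2..2}" for d
      proof
        assume "[int (r j) = int (r i) + d] (mod int n)"
        moreover have "[int (r i) = int i] (mod int n)" "[int (r j) = int j] (mod int n)"
          by (auto simp: r_def cong_def)
        ultimately have "[int j = int i + d] (mod int n)"
          by (metis cong_add cong_refl cong_sym cong_trans)
        then have "int n dvd int j - (int i + d)" by (simp add: cong_iff_dvd_diff)
        moreover have "0 < int j - (int i + d)" "int j - (int i + d) < int n" using ij d by auto
        ultimately show False by (meson zdvd_not_zless)
      qed
      then show ?thesis using far r(1)[of i] r(1)[of j] ij by auto
    qed
    then show "cell (a i) \<inter> cell (a j) = {}" using r(2)[of i] r(2)[of j] A[of i] A[of j] ij by auto
  qed
  moreover obtain v where "cell (a 0) \<inter> cell (a (n - 1)) = {v}"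
    using v A[of 0] A[of "n - 1"] by auto
  ultimately show ?thesis using that P' by blast
qed

lemma weakly_closed_path_system:
  assumes "weakly_closed_path P n A"
  obtains w qs where "minor_system P w qs" "length qs = card P"
proof -
  obtain a v where a: "weak_ring P n a" "P = (\<lambda>i. cell (a i)) ` {..<n}" "cell (a 0) \<inter> cell (a (n - 1)) = {v}"
    using weakly_closed_path_ring[OF assms] .
  have "inj_on (\<lambda>i. cell (a i)) {..<n}" using a(1) by (auto simp: weak_ring_def inj_on_def inj_cell)
  then have "card P = n" using a(2) by (simp add: card_image)
  then show ?thesis using ring_system[OF a(1,3)] that by auto
qed


section \<open>The polynomial ring\<close>

lemma carrier_mpoly: "p \<in> carrier (mpoly_ring V) \<longleftrightarrow> Poly_Mapping.keys p \<subseteq> monomials V"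
  by (simp add: mpoly_ring_def)

lemma mpoly_ring_simps:
  "mult (mpoly_ring V) = (*)" "one (mpoly_ring V) = 1" "zero (mpoly_ring V) = 0" "add (mpoly_ring V) = (+)"
  by (simp_all add: mpoly_ring_def)

lemma zero_monomials: "0 \<in> monomials V"
  by (simp add: monomials_def)

lemma monomials_plus_iff: "s + t \<in> monomials V \<longleftrightarrow> s \<in> monomials V \<and> t \<in> monomials V"
  for s t :: "'v monom"
proof -
  have "Poly_Mapping.keys (s + t) = Poly_Mapping.keys s \<union> Poly_Mapping.keys t"
    by (auto simp: in_keys_iff lookup_add)
  then show ?thesis by (auto simp: monomials_def)
qed

lemma mpoly_carrier_closed:
  fixes p q :: "('v, 'k::field) mpoly"
  shows "0 \<in> carrier (mpoly_ring V :: ('v, 'k) mpoly ring)" "1 \<in> carrier (mpoly_ring V :: ('v, 'k) mpoly ring)"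
    and "p \<in> carrier (mpoly_ring V) \<Longrightarrow> q \<in> carrier (mpoly_ring V) \<Longrightarrow> p + q \<in> carrier (mpoly_ring V)"
    and "p \<in> carrier (mpoly_ring V) \<Longrightarrow> q \<in> carrier (mpoly_ring V) \<Longrightarrow> p * q \<in> carrier (mpoly_ring V)"
    and "p \<in> carrier (mpoly_ring V) \<Longrightarrow> - p \<in> carrier (mpoly_ring V)"
    and "p \<in> carrier (mpoly_ring V) \<Longrightarrow> q \<in> carrier (mpoly_ring V) \<Longrightarrow> p - q \<in> carrier (mpoly_ring V)"
    and "s \<in> monomials V \<Longrightarrow> Poly_Mapping.single s c \<in> carrier (mpoly_ring V :: ('v, 'k) mpoly ring)"
    and "p \<in> carrier (mpoly_ring V) \<Longrightarrow> p ^ n \<in> carrier (mpoly_ring V)"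
proof -
  interpret cring "mpoly_ring V :: ('v, 'k) mpoly ring" by (rule cring_mpoly_ring)
  show 0: "0 \<in> carrier (mpoly_ring V :: ('v, 'k) mpoly ring)" and 1: "1 \<in> carrier (mpoly_ring V :: ('v, 'k) mpoly ring)"
    using zero_closed one_closed by (auto simp: mpoly_ring_simps)
  show add: "p \<in> carrier (mpoly_ring V) \<Longrightarrow> q \<in> carrier (mpoly_ring V) \<Longrightarrow> p + q \<in> carrier (mpoly_ring V)" for p q :: "('v, 'k) mpoly"
    using a_closed by (auto simp: mpoly_ring_simps)
  show mult: "p \<in> carrier (mpoly_ring V) \<Longrightarrow> q \<in> carrier (mpoly_ring V) \<Longrightarrow> p * q \<in> carrier (mpoly_ring V)" for p q :: "('v, 'k) mpoly"
    using m_closed by (auto simp: mpoly_ring_simps)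
  show um: "p \<in> carrier (mpoly_ring V) \<Longrightarrow> - p \<in> carrier (mpoly_ring V)" for p :: "('v, 'k) mpoly"
    by (simp add: carrier_mpoly)
  show "p \<in> carrier (mpoly_ring V) \<Longrightarrow> q \<in> carrier (mpoly_ring V) \<Longrightarrow> p - q \<in> carrier (mpoly_ring V)"
    using add[of p "- q"] um by simp
  show "s \<in> monomials V \<Longrightarrow> Poly_Mapping.single s c \<in> carrier (mpoly_ring V :: ('v, 'k) mpoly ring)"
    by (simp add: carrier_mpoly)
  show "p \<in> carrier (mpoly_ring V) \<Longrightarrow> p ^ n \<in> carrier (mpoly_ring V)"
    by (induction n) (auto intro: mult 1)
qed

lemma mpoly_idealI:
  fixes I :: "('v, 'k::field) mpoly set"
  assumes "I \<subseteq> carrier (mpoly_ring V)" "0 \<in> I" "\<And>p q. p \<in> I \<Longrightarrow> q \<in> I \<Longrightarrow> p + q \<in> I"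
    and mult: "\<And>p q. p \<in> I \<Longrightarrow> q \<in> carrier (mpoly_ring V) \<Longrightarrow> q * p \<in> I"
  shows "ideal I (mpoly_ring V)"
proof -
  interpret cring "mpoly_ring V :: ('v, 'k) mpoly ring" by (rule cring_mpoly_ring)
  have um: "- p \<in> I" if "p \<in> I" for p
    using mult[OF that, of "- 1"] mpoly_carrier_closed(2,5) by auto
  have "\<ominus>\<^bsub>mpoly_ring V\<^esub> p = - p" if "p \<in> carrier (mpoly_ring V)" for p :: "('v, 'k) mpoly"
    using that by (intro minus_equality) (auto simp: mpoly_ring_simps mpoly_carrier_closed)
  then have "subgroup I (add_monoid (mpoly_ring V))"
    using assms um by (intro add.subgroupI) (auto simp: mpoly_ring_simps a_inv_def[symmetric] subset_iff)
  then show ?thesis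
    using mult assms(1) by (intro idealI ring_axioms) (auto simp: mpoly_ring_simps mult.commute)
qed

lemma mpoly_ideal:
  fixes I :: "('v, 'k::field) mpoly set"
  assumes "ideal I (mpoly_ring V)"
  shows "0 \<in> I" "p \<in> I \<Longrightarrow> q \<in> I \<Longrightarrow> p + q \<in> I" "p \<in> I \<Longrightarrow> q \<in> carrier (mpoly_ring V) \<Longrightarrow> q * p \<in> I"
    "p \<in> I \<Longrightarrow> q \<in> I \<Longrightarrow> p - q \<in> I" "p \<in> I \<Longrightarrow> p \<in> carrier (mpoly_ring V)"
proof -
  interpret ideal I "mpoly_ring V" by (fact assms)
  show "0 \<in> I" using additive_subgroup.zero_closed[OF ideal.axioms(1)[OF assms]] by (simp add: mpoly_ring_simps)
  show add: "p \<in> I \<Longrightarrow> q \<in> I \<Longrightarrow> p + q \<in> I" for p q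
    using additive_subgroup.a_closed[OF ideal.axioms(1)[OF assms], of p q] by (simp add: mpoly_ring_simps)
  show mult: "p \<in> I \<Longrightarrow> q \<in> carrier (mpoly_ring V) \<Longrightarrow> q * p \<in> I" for p q
    using I_l_closed[of p q] by (simp add: mpoly_ring_simps)
  show "p \<in> I \<Longrightarrow> q \<in> I \<Longrightarrow> p - q \<in> I"
    using add[of p "- q"] mult[of q "- 1"] mpoly_carrier_closed(2,5) by auto
  show "p \<in> I \<Longrightarrow> p \<in> carrier (mpoly_ring V)" using a_subset by auto
qed

lemma mpoly_ideal_sum:
  fixes I :: "('v, 'k::field) mpoly set"
  assumes "ideal I (mpoly_ring V)" "\<And>i. i \<in> A \<Longrightarrow> f i \<in> I"
  shows "sum f A \<in> I"
  using assms(2) by (induction A rule: infinite_finite_induct) (auto intro: mpoly_ideal[OF assms(1)])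

lemma poly_mapping_sum_single: "p = (\<Sum>s\<in>Poly_Mapping.keys p. Poly_Mapping.single s (Poly_Mapping.lookup p s))"
proof (rule poly_mapping_eqI)
  fix s
  show "Poly_Mapping.lookup p s = Poly_Mapping.lookup (\<Sum>s\<in>Poly_Mapping.keys p. Poly_Mapping.single s (Poly_Mapping.lookup p s)) s"
    by (simp add: lookup_sum lookup_single when_def in_keys_iff)
qed

lemma lookup_single_mult:
  fixes p :: "('v, 'k::field) mpoly"
  shows "Poly_Mapping.lookup (Poly_Mapping.single s c * p) (s + t) = c * Poly_Mapping.lookup p t"
proof -
  have "Poly_Mapping.lookup (Poly_Mapping.single s c * p) (s + t) =
      (\<Sum>u\<in>Poly_Mapping.keys p. Poly_Mapping.lookup (Poly_Mapping.single (s + u) (c * Poly_Mapping.lookup p u)) (s + t))"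
    by (subst poly_mapping_sum_single[of p]) (simp add: sum_distrib_left mult_single lookup_sum)
  also have "\<dots> = (\<Sum>u\<in>Poly_Mapping.keys p. if u = t then c * Poly_Mapping.lookup p u else 0)"
    by (intro sum.cong) (auto simp: lookup_single when_def)
  also have "\<dots> = c * Poly_Mapping.lookup p t" by (auto simp: in_keys_iff)
  finally show ?thesis .
qed

lemma keys_single_mult:
  fixes p :: "('v, 'k::field) mpoly"
  shows "c \<noteq> 0 \<Longrightarrow> Poly_Mapping.keys (Poly_Mapping.single s c * p) = (+) s ` Poly_Mapping.keys p"
proof -
  assume c: "c \<noteq> 0"
  have "Poly_Mapping.keys (Poly_Mapping.single s c * p) \<subseteq> (+) s ` Poly_Mapping.keys p"
    using Poly_Mapping.keys_mult[of "Poly_Mapping.single s c" p] by (auto split: if_splits)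
  moreover have "(+) s ` Poly_Mapping.keys p \<subseteq> Poly_Mapping.keys (Poly_Mapping.single s c * p)"
    using c by (auto simp: in_keys_iff lookup_single_mult)
  ultimately show ?thesis by auto
qed


section \<open>Monomial orders\<close>

definition weight :: "('v \<Rightarrow> nat) \<Rightarrow> 'v monom \<Rightarrow> nat" where
  "weight w s = (\<Sum>v\<in>Poly_Mapping.keys s. w v * Poly_Mapping.lookup s v)"

lemma weight_superset:
  assumes "finite A" "Poly_Mapping.keys s \<subseteq> A"
  shows "weight w s = (\<Sum>v\<in>A. w v * Poly_Mapping.lookup s v)"
  unfolding weight_def using assms by (intro sum.mono_neutral_left) (auto simp: in_keys_iff)

lemma weight_add: "weight w (s + t) = weight w s + weight w t"
proof -
  let ?A = "Poly_Mapping.keys s \<union> Poly_Mapping.keys t"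
  have "Poly_Mapping.keys (s + t) \<subseteq> ?A" by (rule Poly_Mapping.keys_add)
  then show ?thesis
    using weight_superset[of ?A s w] weight_superset[of ?A t w] weight_superset[of ?A "s + t" w]
    by (simp add: lookup_add distrib_left sum.distrib)
qed

lemma weight_single: "weight w (Poly_Mapping.single v k) = w v * k"
  by (simp add: weight_def)

lemma weight_zero: "weight w 0 = 0"
  by (simp add: weight_def)

lemma monom_degree_weight: "monom_degree s = weight (\<lambda>_. 1) s"
  by (simp add: monom_degree_def weight_def)

lemma zero_le_monom: "(0 :: nat \<Rightarrow>\<^sub>0 nat) \<le> s"
proof (rule ccontr)
  assume "\<not> 0 \<le> s"
  then have "s < 0" by simp
  then show False by transfer (simp add: less_fun_def)
qed

text \<open>Ties are broken lexicographically, with the points enumerated in type \<^typ>\<open>nat\<close>, whose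
  monomials carry a linear order in the library.\<close>

lemma monomial_order_weight:
  fixes w :: "point \<Rightarrow> nat"
  obtains r where "monomial_order V r"
    "\<And>s t. s \<in> monomials V \<Longrightarrow> t \<in> monomials V \<Longrightarrow> weight w s < weight w t \<Longrightarrow> (s, t) \<in> r"
proof -
  define enc :: "point monom \<Rightarrow> nat monom" where "enc = Poly_Mapping.map_key prod_decode"
  have inj: "inj prod_decode" using bij_prod_decode by (rule bij_is_inj)
  have enc_add: "enc (s + t) = enc s + enc t" for s t
    by (simp add: enc_def map_key_plus[OF inj])
  have enc_0: "enc 0 = 0" by (simp add: enc_def map_key_zero[OF inj])
  have enc_inj: "s = t" if "enc s = enc t" for s t
  proof (rule poly_mapping_eqI)
    fix v
    have "Poly_Mapping.lookup (enc s) (prod_encode v) = Poly_Mapping.lookup (enc t) (prod_encode v)" using that by simp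
    then show "Poly_Mapping.lookup s v = Poly_Mapping.lookup t v" by (simp add: enc_def map_key.rep_eq[OF inj])
  qed
  define le where "le s t \<longleftrightarrow> weight w s < weight w t \<or> weight w s = weight w t \<and> enc s \<le> enc t" for s t
  define r where "r = {(s, t). s \<in> monomials V \<and> t \<in> monomials V \<and> le s t}"
  have "linear_order_on (monomials V) r"
    unfolding linear_order_on_def partial_order_on_def preorder_on_def
    by (auto simp: refl_on_def trans_def antisym_def total_on_def r_def le_def intro: enc_inj)
  moreover have "(0, s) \<in> r" if "s \<in> monomials V" for s
    using that by (auto simp: r_def le_def zero_monomials enc_0 weight_zero zero_le_monom)
  moreover have "(s + u, t + u) \<in> r" if "u \<in> monomials V" "(s, t) \<in> r" for s t u
    using that by (auto simp: r_def le_def monomials_plus enc_add weight_add)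
  ultimately have "monomial_order V r" by (auto simp: monomial_order_def)
  then show ?thesis by (rule that) (auto simp: r_def le_def)
qed

lemma initial_eqI:
  assumes "monomial_order V r" "s \<in> Poly_Mapping.keys p" "Poly_Mapping.keys p \<subseteq> monomials V"
    and "\<And>t. t \<in> Poly_Mapping.keys p \<Longrightarrow> (t, s) \<in> r"
  shows "initial r p = Poly_Mapping.single s 1"
proof -
  have "antisym r" using assms(1) by (auto simp: monomial_order_def linear_order_on_def partial_order_on_def)
  then have "(THE m. m \<in> Poly_Mapping.keys p \<and> (\<forall>m'\<in>Poly_Mapping.keys p. (m', m) \<in> r)) = s"
    using assms by (intro the_equality) (auto simp: antisym_def)
  then show ?thesis by (simp add: initial_def)
qed


section \<open>Monomial ideals\<close>

lemma ideal_monomial_multiples: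
  fixes T :: "'v monom set"
  shows "ideal {p :: ('v, 'k::field) mpoly. Poly_Mapping.keys p \<subseteq> monomials V \<and>
     (\<forall>m\<in>Poly_Mapping.keys p. \<exists>s\<in>T. \<exists>u. m = s + u)} (mpoly_ring V)" (is "ideal ?J _")
proof (rule mpoly_idealI)
  fix p q :: "('v, 'k) mpoly" assume "p \<in> ?J" "q \<in> ?J"
  then show "p + q \<in> ?J" using Poly_Mapping.keys_add[of p q] by blast
next
  fix p q :: "('v, 'k) mpoly" assume pq: "p \<in> ?J" "q \<in> carrier (mpoly_ring V)"
  then have "Poly_Mapping.keys (q * p) \<subseteq> monomials V"
    using mpoly_carrier_closed(4)[of q V p] by (simp add: carrier_mpoly)
  moreover have "\<exists>s\<in>T. \<exists>u. m = s + u" if "m \<in> Poly_Mapping.keys (q * p)" for m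
  proof -
    obtain a b where m: "m = a + b" "b \<in> Poly_Mapping.keys p"
      using \<open>m \<in> Poly_Mapping.keys (q * p)\<close> Poly_Mapping.keys_mult[of q p] by auto
    then obtain s u where "s \<in> T" "b = s + u" using pq by auto
    then have "m = s + (a + u)" using m by (simp add: ac_simps)
    then show ?thesis using \<open>s \<in> T\<close> by blast
  qed
  ultimately show "q * p \<in> ?J" by auto
qed (auto simp: carrier_mpoly)

lemma Idl_monomials:
  fixes T :: "'v monom set"
  assumes "T \<subseteq> monomials V"
  shows "Idl\<^bsub>mpoly_ring V\<^esub> ((\<lambda>s. Poly_Mapping.single s (1::'k::field)) ` T) =
    {p. Poly_Mapping.keys p \<subseteq> monomials V \<and> (\<forall>m\<in>Poly_Mapping.keys p. \<exists>s\<in>T. \<exists>u. m = s + u)}"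
    (is "Idl\<^bsub>?R\<^esub> ?S = ?J")
proof
  interpret cring ?R by (rule cring_mpoly_ring)
  have S: "?S \<subseteq> carrier ?R" using assms by (auto simp: carrier_mpoly)
  have "?S \<subseteq> ?J" using assms by (force intro: exI[of _ 0])
  then show "Idl\<^bsub>?R\<^esub> ?S \<subseteq> ?J" using ideal_monomial_multiples by (intro genideal_minimal) auto
  have I: "ideal (Idl\<^bsub>?R\<^esub> ?S) ?R" using genideal_ideal[OF S] .
  show "?J \<subseteq> Idl\<^bsub>?R\<^esub> ?S"
  proof
    fix p assume p: "p \<in> ?J"
    have "Poly_Mapping.single m (Poly_Mapping.lookup p m) \<in> Idl\<^bsub>?R\<^esub> ?S" if m: "m \<in> Poly_Mapping.keys p" for m
    proof -
      obtain s u where su: "s \<in> T" "m = s + u" using p m by auto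
      have "u \<in> monomials V" using p m su by (auto simp: monomials_plus_iff)
      moreover have "Poly_Mapping.single s 1 \<in> Idl\<^bsub>?R\<^esub> ?S" using genideal_self[OF S] su by auto
      ultimately have "Poly_Mapping.single u (Poly_Mapping.lookup p m) * Poly_Mapping.single s 1 \<in> Idl\<^bsub>?R\<^esub> ?S"
        by (intro mpoly_ideal(3)[OF I]) (auto simp: carrier_mpoly)
      then show ?thesis by (simp add: mult_single su add.commute)
    qed
    then have "(\<Sum>m\<in>Poly_Mapping.keys p. Poly_Mapping.single m (Poly_Mapping.lookup p m)) \<in> Idl\<^bsub>?R\<^esub> ?S"
      by (rule mpoly_ideal_sum[OF I])
    then show "p \<in> Idl\<^bsub>?R\<^esub> ?S" using poly_mapping_sum_single[of p] by simp
  qed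
qed

text \<open>The conclusion is the divisibility of \<open>k\<close> by \<open>t\<close>, with
  truncated subtraction as the quotient: wherever \<open>t\<close> has a positive exponent, that of
  \<open>s\<close> is zero, so \<open>k\<close> has to supply it.\<close>

lemma coprime_monomial_cancel:
  fixes s t k u :: "'v monom"
  assumes "Poly_Mapping.keys s \<inter> Poly_Mapping.keys t = {}" "s + k = t + u"
  shows "k = t + (k - t)"
proof (rule poly_mapping_eqI)
  fix v
  have "Poly_Mapping.lookup s v + Poly_Mapping.lookup k v = Poly_Mapping.lookup t v + Poly_Mapping.lookup u v"
    using assms(2) by (metis lookup_add)
  moreover have "Poly_Mapping.lookup s v = 0 \<or> Poly_Mapping.lookup t v = 0"
    using assms(1) by (auto simp: in_keys_iff)
  ultimately show "Poly_Mapping.lookup k v = Poly_Mapping.lookup (t + (k - t)) v"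
    by (auto simp: lookup_add minus_poly_mapping.rep_eq)
qed

text \<open>Membership in a monomial ideal is decided term by term, and a monomial coprime to the
  generators cancels from each divisibility.\<close>

lemma regular_sequence_coprime_monomials:
  fixes ss :: "'v monom list"
  assumes "set ss \<subseteq> monomials V" "0 \<notin> set ss"
    and coprime: "\<And>i j. i < j \<Longrightarrow> j < length ss \<Longrightarrow> Poly_Mapping.keys (ss ! i) \<inter> Poly_Mapping.keys (ss ! j) = {}"
  shows "regular_sequence (mpoly_ring V) (map (\<lambda>s. Poly_Mapping.single s (1::'k::field)) ss)"
    (is "regular_sequence ?R ?fs")
  unfolding regular_sequence_def
proof (intro conjI allI impI ballI)
  show "set ?fs \<subseteq> carrier ?R" using assms(1) by (auto simp: carrier_mpoly)
  have "1 \<notin> Idl\<^bsub>?R\<^esub> set ?fs"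
  proof
    assume "1 \<in> Idl\<^bsub>?R\<^esub> set ?fs"
    then have "\<exists>s\<in>set ss. \<exists>u. 0 = s + u" unfolding set_map Idl_monomials[OF assms(1)] by simp
    then obtain s u where su: "s \<in> set ss" "0 = s + u" by blast
    have "s = 0"
    proof (rule poly_mapping_eqI)
      fix v
      have "Poly_Mapping.lookup s v + Poly_Mapping.lookup u v = Poly_Mapping.lookup 0 v"
        unfolding su(2) by (rule lookup_add[symmetric])
      then show "Poly_Mapping.lookup s v = Poly_Mapping.lookup 0 v" by simp
    qed
    then show False using su(1) assms(2) by simp
  qed
  then show "Idl\<^bsub>?R\<^esub> set ?fs \<noteq> carrier ?R" using mpoly_carrier_closed(2) by auto
next
  fix i g assume i: "i < length ?fs" and g: "g \<in> carrier ?R"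
    and mem: "?fs ! i \<otimes>\<^bsub>?R\<^esub> g \<in> Idl\<^bsub>?R\<^esub> set (take i ?fs)"
  have eq: "set (take i ?fs) = (\<lambda>s. Poly_Mapping.single s 1) ` set (take i ss)" by (simp add: take_map)
  have sub: "set (take i ss) \<subseteq> monomials V" using assms(1) set_take_subset by fastforce
  have "Poly_Mapping.single (ss ! i) 1 * g \<in> Idl\<^bsub>?R\<^esub> set (take i ?fs)"
    using mem i by (simp add: mpoly_ring_simps)
  then have *: "\<exists>s\<in>set (take i ss). \<exists>u. ss ! i + k = s + u" if "k \<in> Poly_Mapping.keys g" for k
    using that unfolding eq Idl_monomials[OF sub] by (auto simp: keys_single_mult)
  have "\<exists>s\<in>set (take i ss). \<exists>u. k = s + u" if k: "k \<in> Poly_Mapping.keys g" for k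
  proof -
    obtain s u where s: "s \<in> set (take i ss)" "ss ! i + k = s + u" using *[OF k] by auto
    then obtain j where "j < i" "s = ss ! j" using i by (auto simp: in_set_conv_nth)
    then have "k = s + (k - s)"
      using coprime[of j i] i s(2) by (intro coprime_monomial_cancel[of "ss ! i"]) auto
    then show ?thesis using s(1) by blast
  qed
  then show "g \<in> Idl\<^bsub>?R\<^esub> set (take i ?fs)"
    using g unfolding eq Idl_monomials[OF sub] by (auto simp: carrier_mpoly)
qed


section \<open>Prime ideals and variables\<close>

lemma mpoly_prime:
  fixes Q :: "('v, 'k::field) mpoly set"
  assumes "primeideal Q (mpoly_ring V)"
  shows "ideal Q (mpoly_ring V)" "1 \<notin> Q"
    "p \<in> carrier (mpoly_ring V) \<Longrightarrow> q \<in> carrier (mpoly_ring V) \<Longrightarrow> p * q \<in> Q \<Longrightarrow> p \<in> Q \<or> q \<in> Q"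
proof -
  interpret primeideal Q "mpoly_ring V" by (fact assms)
  show "ideal Q (mpoly_ring V)" ..
  show "1 \<notin> Q" using one_imp_carrier I_notcarr by (auto simp: mpoly_ring_simps)
  show "p \<in> carrier (mpoly_ring V) \<Longrightarrow> q \<in> carrier (mpoly_ring V) \<Longrightarrow> p * q \<in> Q \<Longrightarrow> p \<in> Q \<or> q \<in> Q"
    using I_prime by (auto simp: mpoly_ring_simps)
qed

lemma mpoly_primeI:
  fixes Q :: "('v, 'k::field) mpoly set"
  assumes "ideal Q (mpoly_ring V)" "1 \<notin> Q"
    and "\<And>p q. p \<in> carrier (mpoly_ring V) \<Longrightarrow> q \<in> carrier (mpoly_ring V) \<Longrightarrow> p * q \<in> Q \<Longrightarrow> p \<in> Q \<or> q \<in> Q"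
  shows "primeideal Q (mpoly_ring V)"
proof (rule primeidealI[OF assms(1) cring_mpoly_ring])
  show "carrier (mpoly_ring V) \<noteq> Q" using assms(2) mpoly_carrier_closed(2) by blast
qed (use assms(3) in \<open>auto simp: mpoly_ring_simps\<close>)

section \<open>Chains of primes by contracting one variable at a time\<close>

definition prime_chain :: "('a, 'b) ring_scheme \<Rightarrow> nat \<Rightarrow> (nat \<Rightarrow> 'a set) \<Rightarrow> bool" where
  "prime_chain R n C \<longleftrightarrow> (\<forall>i\<le>n. primeideal (C i) R) \<and> (\<forall>i<n. C i \<subset> C (Suc i))"

lemma prime_height_chains: "prime_height R p = Sup {enat n | n. \<exists>C. prime_chain R n C \<and> C n = p}"
  by (simp add: prime_height_def prime_chain_def conj_assoc)

lemma mpoly_induct [case_names zero single add]: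
  fixes p :: "'a \<Rightarrow>\<^sub>0 'b::comm_monoid_add"
  assumes "P 0" "\<And>s a. P (Poly_Mapping.single s a)" "\<And>p q. P p \<Longrightarrow> P q \<Longrightarrow> P (p + q)"
  shows "P p"
proof -
  have "P (\<Sum>s\<in>A. Poly_Mapping.single s (Poly_Mapping.lookup p s))" for A
    by (induction A rule: infinite_finite_induct) (auto intro: assms)
  then show ?thesis using poly_mapping_sum_single[of p] by metis
qed

text \<open>The coefficient of \<open>y^k\<close> when \<open>p\<close> is read as a polynomial in
  \<open>y\<close>; the test on \<open>t\<close> keeps it free of \<open>y\<close>.\<close>

definition var_coeff :: "'v \<Rightarrow> nat \<Rightarrow> ('v, 'k::field) mpoly \<Rightarrow> ('v, 'k) mpoly" where
  "var_coeff y k p = Abs_poly_mapping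
     (\<lambda>t. if Poly_Mapping.lookup t y = 0 then Poly_Mapping.lookup p (t + Poly_Mapping.single y k) else 0)"

lemma lookup_var_coeff: "Poly_Mapping.lookup (var_coeff y k p) t =
    (if Poly_Mapping.lookup t y = 0 then Poly_Mapping.lookup p (t + Poly_Mapping.single y k) else 0)"
proof -
  let ?f = "\<lambda>t. if Poly_Mapping.lookup t y = 0 then Poly_Mapping.lookup p (t + Poly_Mapping.single y k) else 0"
  have "(\<lambda>t. t + Poly_Mapping.single y k) ` {t. ?f t \<noteq> 0} \<subseteq> Poly_Mapping.keys p"
    by (auto simp: in_keys_iff split: if_splits)
  then have "finite ((\<lambda>t. t + Poly_Mapping.single y k) ` {t. ?f t \<noteq> 0})"
    using finite_keys finite_subset by blast
  then have "finite {t. ?f t \<noteq> 0}" by (rule finite_imageD) (auto simp: inj_on_def)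
  then show ?thesis by (simp add: var_coeff_def)
qed

lemma var_coeff_add: "var_coeff y k (p + q) = var_coeff y k p + var_coeff y k q"
  by (rule poly_mapping_eqI) (simp add: lookup_var_coeff lookup_add)

lemma var_coeff_zero: "var_coeff y k 0 = 0"
  by (rule poly_mapping_eqI) (simp add: lookup_var_coeff)

lemma var_split:
  fixes s :: "'v monom"
  obtains u where "s = u + Poly_Mapping.single y (Poly_Mapping.lookup s y)" "Poly_Mapping.lookup u y = 0"
proof
  let ?u = "s - Poly_Mapping.single y (Poly_Mapping.lookup s y)"
  show "s = ?u + Poly_Mapping.single y (Poly_Mapping.lookup s y)"
    by (rule poly_mapping_eqI) (auto simp: lookup_add minus_poly_mapping.rep_eq lookup_single when_def)
  show "Poly_Mapping.lookup ?u y = 0" by (simp add: minus_poly_mapping.rep_eq)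
qed

lemma var_coeff_single:
  assumes "Poly_Mapping.lookup u y = 0"
  shows "var_coeff y k (Poly_Mapping.single (u + Poly_Mapping.single y i) a) =
    (if i = k then Poly_Mapping.single u a else 0)"
proof (rule poly_mapping_eqI)
  fix t
  have "t = u \<and> i = k" if "u + Poly_Mapping.single y i = t + Poly_Mapping.single y k" "Poly_Mapping.lookup t y = 0"
  proof -
    have "Poly_Mapping.lookup (u + Poly_Mapping.single y i) y = Poly_Mapping.lookup (t + Poly_Mapping.single y k) y"
      using that by simp
    then have "i = k" using assms that(2) by (simp add: lookup_add)
    then show ?thesis using that by simp
  qed
  then show "Poly_Mapping.lookup (var_coeff y k (Poly_Mapping.single (u + Poly_Mapping.single y i) a)) t =
      Poly_Mapping.lookup (if i = k then Poly_Mapping.single u a else 0) t"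
    using assms by (auto simp: lookup_var_coeff lookup_single when_def)
qed

lemma var_coeff_mult:
  "var_coeff y k (p * q) = (\<Sum>i\<le>k. var_coeff y i p * var_coeff y (k - i) q)"
proof (induction p rule: mpoly_induct)
  case (single s a)
  show ?case
  proof (induction q rule: mpoly_induct)
    case (single t b)
    obtain u i where s: "s = u + Poly_Mapping.single y i" "Poly_Mapping.lookup u y = 0" using var_split[of s y] by metis
    obtain v j where t: "t = v + Poly_Mapping.single y j" "Poly_Mapping.lookup v y = 0" using var_split[of t y] by metis
    have st: "s + t = (u + v) + Poly_Mapping.single y (i + j)" by (simp add: s t single_add ac_simps)
    have "(\<Sum>l\<le>k. var_coeff y l (Poly_Mapping.single s a) * var_coeff y (k - l) (Poly_Mapping.single t b)) =
        (\<Sum>l\<le>k. if l = i then (if j = k - l then Poly_Mapping.single (u + v) (a * b) else 0) else 0)"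
      by (intro sum.cong) (auto simp: s t var_coeff_single mult_single)
    also have "\<dots> = (if i + j = k then Poly_Mapping.single (u + v) (a * b) else 0)" by auto
    also have "\<dots> = var_coeff y k (Poly_Mapping.single s a * Poly_Mapping.single t b)"
      unfolding mult_single st using s t by (simp add: var_coeff_single lookup_add)
    finally show ?case by simp
  qed (simp_all add: var_coeff_zero var_coeff_add distrib_left sum.distrib)
qed (simp_all add: var_coeff_zero var_coeff_add distrib_right sum.distrib)

lemma var_coeff_carrier:
  assumes "p \<in> carrier (mpoly_ring (insert y W))" "y \<notin> W"
  shows "var_coeff y k p \<in> carrier (mpoly_ring W)"
  unfolding carrier_mpoly
proof
  fix t assume "t \<in> Poly_Mapping.keys (var_coeff y k p)"
  then have t: "Poly_Mapping.lookup t y = 0" "t + Poly_Mapping.single y k \<in> Poly_Mapping.keys p"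
    by (auto simp: in_keys_iff lookup_var_coeff split: if_splits)
  then have "t + Poly_Mapping.single y k \<in> monomials (insert y W)" using assms by (auto simp: carrier_mpoly)
  then have "t \<in> monomials (insert y W)" by (simp add: monomials_plus_iff)
  then show "t \<in> monomials W" using t(1) by (auto simp: monomials_def in_keys_iff)
qed

lemma carrier_mpoly_mono: "W \<subseteq> V \<Longrightarrow> carrier (mpoly_ring W) \<subseteq> carrier (mpoly_ring V)"
  by (auto simp: mpoly_ring_def monomials_def)

lemma var_coeff_carrier': "p \<in> carrier (mpoly_ring V) \<Longrightarrow> var_coeff y k p \<in> carrier (mpoly_ring V)"
  using var_coeff_carrier[of p y "V - {y}" k] carrier_mpoly_mono[of V "insert y (V - {y})"]
    carrier_mpoly_mono[of "V - {y}" V] by auto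

lemma var_coeff_free:
  assumes "p \<in> carrier (mpoly_ring W)" "y \<notin> W"
  shows "var_coeff y k p = (if k = 0 then p else 0)"
proof (rule poly_mapping_eqI)
  fix t
  have y: "Poly_Mapping.lookup s y = 0" if "s \<in> Poly_Mapping.keys p" for s
    using that assms by (auto simp: carrier_mpoly monomials_def simp flip: not_in_keys_iff_lookup_eq_zero)
  have "Poly_Mapping.lookup p (t + Poly_Mapping.single y k) = 0" if "k \<noteq> 0"
    using y[of "t + Poly_Mapping.single y k"] that by (auto simp: lookup_add in_keys_iff)
  moreover have "Poly_Mapping.lookup p t = 0" if "Poly_Mapping.lookup t y \<noteq> 0"
    using y[of t] that by (auto simp: in_keys_iff)
  ultimately show "Poly_Mapping.lookup (var_coeff y k p) t = Poly_Mapping.lookup (if k = 0 then p else 0) t"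
    by (auto simp: lookup_var_coeff)
qed

lemma var_coeff_expand:
  fixes p :: "('v, 'k::field) mpoly"
  shows "p = (\<Sum>k\<in>(\<lambda>s. Poly_Mapping.lookup s y) ` Poly_Mapping.keys p.
     Poly_Mapping.single (Poly_Mapping.single y k) 1 * var_coeff y k p)" (is "p = sum ?g ?K")
proof (rule poly_mapping_eqI)
  fix s :: "'v monom"
  obtain u j where s: "s = u + Poly_Mapping.single y j" "Poly_Mapping.lookup u y = 0" using var_split[of s y] by metis
  have g: "Poly_Mapping.lookup (?g k) s = (if k = j then Poly_Mapping.lookup p s else 0)" for k
  proof (cases "k = j")
    case True
    then show ?thesis
      using lookup_single_mult[of "Poly_Mapping.single y k" 1 "var_coeff y k p" u] s
      by (simp add: lookup_var_coeff add.commute)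
  next
    case False
    have "s \<notin> Poly_Mapping.keys (?g k)"
    proof
      assume "s \<in> Poly_Mapping.keys (?g k)"
      then obtain t where t: "s = Poly_Mapping.single y k + t" "t \<in> Poly_Mapping.keys (var_coeff y k p)"
        by (auto simp: keys_single_mult)
      then have "Poly_Mapping.lookup t y = 0" by (auto simp: in_keys_iff lookup_var_coeff split: if_splits)
      then have "Poly_Mapping.lookup s y = k" unfolding t(1) by (simp add: lookup_add)
      moreover have "Poly_Mapping.lookup s y = j" unfolding s(1) using s(2) by (simp add: lookup_add)
      ultimately show False using False by simp
    qed
    then show ?thesis using False by (simp add: in_keys_iff)
  qed
  have "j = Poly_Mapping.lookup s y" unfolding s(1) using s(2) by (simp add: lookup_add)
  then have "j \<notin> ?K \<Longrightarrow> Poly_Mapping.lookup p s = 0" by (auto simp: in_keys_iff)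
  then show "Poly_Mapping.lookup p s = Poly_Mapping.lookup (sum ?g ?K) s"
    by (simp add: lookup_sum g)
qed

text \<open>The contraction of \<open>Q\<close> to the polynomials without \<open>y\<close>, extended again.\<close>

definition var_contract :: "'v set \<Rightarrow> 'v \<Rightarrow> ('v, 'k::field) mpoly set \<Rightarrow> ('v, 'k) mpoly set" where
  "var_contract V y Q = {p \<in> carrier (mpoly_ring V). \<forall>k. var_coeff y k p \<in> Q}"

lemma var_contract_subset:
  assumes "ideal Q (mpoly_ring V)" "y \<in> V"
  shows "var_contract V y Q \<subseteq> Q"
proof
  fix p assume p: "p \<in> var_contract V y Q"
  have "Poly_Mapping.single (Poly_Mapping.single y k) 1 * var_coeff y k p \<in> Q" for k
    using p assms(2) by (intro mpoly_ideal(3)[OF assms(1)])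
      (auto simp: var_contract_def carrier_mpoly monomials_def)
  then have "(\<Sum>k\<in>(\<lambda>s. Poly_Mapping.lookup s y) ` Poly_Mapping.keys p.
     Poly_Mapping.single (Poly_Mapping.single y k) 1 * var_coeff y k p) \<in> Q"
    by (intro mpoly_ideal_sum[OF assms(1)])
  then show "p \<in> Q" using var_coeff_expand[of p y] by simp
qed

text \<open>Gauss's argument: if neither factor is in the contraction, take the least
  \<open>k\<close> and \<open>l\<close> for which the coefficients of \<open>p\<close> and
  \<open>q\<close> are outside \<open>Q\<close>. In the coefficient of \<open>y^(k + l)\<close> of
  the product, every summand but the product of these two lies in \<open>Q\<close>.\<close>

lemma var_contract_prime:
  fixes Q :: "('v, 'k::field) mpoly set"
  assumes "primeideal Q (mpoly_ring V)"
  shows "primeideal (var_contract V y Q) (mpoly_ring V)"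
proof -
  note Q = mpoly_prime[OF assms]
  note I = mpoly_ideal[OF Q(1)]
  have "ideal (var_contract V y Q) (mpoly_ring V)"
  proof (rule mpoly_idealI)
    fix p q :: "('v, 'k) mpoly"
    assume "p \<in> var_contract V y Q" "q \<in> carrier (mpoly_ring V)"
    then show "q * p \<in> var_contract V y Q"
      by (auto simp: var_contract_def var_coeff_mult mpoly_carrier_closed
          intro!: mpoly_ideal_sum[OF Q(1)] I(3) var_coeff_carrier')
  qed (auto simp: var_contract_def var_coeff_zero var_coeff_add mpoly_carrier_closed I)
  then show ?thesis
  proof (rule mpoly_primeI)
    have "var_coeff y 0 (1 :: ('v, 'k) mpoly) = 1"
      using var_coeff_free[of 1 "{}" y 0] mpoly_carrier_closed(2) by auto
    then show "1 \<notin> var_contract V y Q" using Q(2) unfolding var_contract_def by (metis (no_types, lifting) mem_Collect_eq)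
  next
    fix p q :: "('v, 'k) mpoly"
    assume pq: "p \<in> carrier (mpoly_ring V)" "q \<in> carrier (mpoly_ring V)" "p * q \<in> var_contract V y Q"
    show "p \<in> var_contract V y Q \<or> q \<in> var_contract V y Q"
    proof (rule ccontr)
      assume "\<not> ?thesis"
      then have ex: "\<exists>k. var_coeff y k p \<notin> Q" "\<exists>k. var_coeff y k q \<notin> Q" using pq by (auto simp: var_contract_def)
      define k l where "k = (LEAST k. var_coeff y k p \<notin> Q)" and "l = (LEAST k. var_coeff y k q \<notin> Q)"
      have kl: "var_coeff y k p \<notin> Q" "var_coeff y l q \<notin> Q"
        unfolding k_def l_def using LeastI_ex[OF ex(1)] LeastI_ex[OF ex(2)] by simp_all
      have less: "i < k \<Longrightarrow> var_coeff y i p \<in> Q" "i < l \<Longrightarrow> var_coeff y i q \<in> Q" for i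
        unfolding k_def l_def by (auto dest: not_less_Least)
      let ?f = "\<lambda>i. var_coeff y i p * var_coeff y (k + l - i) q"
      have "?f i \<in> Q" if "i \<in> {..k + l} - {k}" for i
      proof (cases "i < k")
        case True
        show ?thesis using I(3)[OF less(1)[OF True] var_coeff_carrier'[OF pq(2), of y "k + l - i"]]
          by (simp only: mult.commute)
      next
        case False
        then have "k + l - i < l" using that by auto
        then show ?thesis using I(3)[OF less(2) var_coeff_carrier'[OF pq(1)]] by simp
      qed
      then have 1: "sum ?f ({..k + l} - {k}) \<in> Q" by (intro mpoly_ideal_sum[OF Q(1)])
      have 2: "sum ?f {..k + l} \<in> Q" using pq(3) by (auto simp: var_contract_def var_coeff_mult)
      have 3: "sum ?f {..k + l} = ?f k + sum ?f ({..k + l} - {k})" by (rule sum.remove) auto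
      from I(4)[OF 2 1] have "?f k \<in> Q" unfolding 3 by (simp only: add_diff_cancel_right')
      moreover have "var_coeff y k p \<in> carrier (mpoly_ring V)" "var_coeff y l q \<in> carrier (mpoly_ring V)"
        using pq by (simp_all add: var_coeff_carrier')
      ultimately show False using Q(3)[of "var_coeff y k p" "var_coeff y l q"] kl by simp
    qed
  qed
qed

text \<open>Each link contracts one variable \<open>y\<close> away. The inclusion is strict, since
  \<open>Q\<close> contains a nonzero polynomial in \<open>y\<close> and the variables of
  \<open>D\<close>; if it were in the contraction, its coefficients would lie in \<open>Q\<close>
  and thus vanish. The witnesses for the other variables are free of \<open>y\<close> and
  survive.\<close>

lemma chain_of_contractions:
  fixes Q :: "('v, 'k::field) mpoly set"
  assumes "primeideal Q (mpoly_ring V)" "distinct ys" "set ys \<subseteq> V - D"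
    and "Q \<inter> carrier (mpoly_ring D) \<subseteq> {0}"
    and "\<And>y. y \<in> set ys \<Longrightarrow> \<exists>g\<in>Q. g \<noteq> 0 \<and> g \<in> carrier (mpoly_ring (insert y D))"
  shows "\<exists>C. prime_chain (mpoly_ring V) (length ys) C \<and> C (length ys) = Q"
  using assms
proof (induction ys arbitrary: Q)
  case Nil
  then show ?case by (intro exI[of _ "\<lambda>_. Q"]) (auto simp: prime_chain_def)
next
  case (Cons y ys)
  define Q' where "Q' = var_contract V y Q"
  note Q = mpoly_prime[OF Cons.prems(1)]
  have sub: "Q' \<subseteq> Q" unfolding Q'_def using var_contract_subset[OF Q(1)] Cons.prems(3) by auto
  have prime: "primeideal Q' (mpoly_ring V)" unfolding Q'_def using var_contract_prime[OF Cons.prems(1)] .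
  have "\<exists>g\<in>Q'. g \<noteq> 0 \<and> g \<in> carrier (mpoly_ring (insert z D))" if z: "z \<in> set ys" for z
  proof -
    obtain g where g: "g \<in> Q" "g \<noteq> 0" "g \<in> carrier (mpoly_ring (insert z D))" using Cons.prems(5)[of z] z by auto
    have "y \<notin> insert z D" using Cons.prems(2,3) z by auto
    then have "var_coeff y k g \<in> Q" for k
      using var_coeff_free[OF g(3)] g(1) mpoly_ideal(1)[OF Q(1)] by auto
    then have "g \<in> Q'" using g(1) mpoly_ideal(5)[OF Q(1)] by (auto simp: Q'_def var_contract_def)
    then show ?thesis using g by auto
  qed
  then obtain C where C: "prime_chain (mpoly_ring V) (length ys) C" "C (length ys) = Q'"
    using Cons.IH[OF prime] Cons.prems(2-4) sub by auto
  have "Q' \<noteq> Q"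
  proof
    assume eq: "Q' = Q"
    obtain g where g: "g \<in> Q" "g \<noteq> 0" "g \<in> carrier (mpoly_ring (insert y D))" using Cons.prems(5)[of y] by auto
    have "y \<notin> D" using Cons.prems(3) by auto
    have "var_coeff y k g = 0" for k
      using g(1) eq var_coeff_carrier[OF g(3) \<open>y \<notin> D\<close>] Cons.prems(4) by (auto simp: Q'_def var_contract_def)
    then show False using var_coeff_expand[of g y] g(2) by simp
  qed
  then have "prime_chain (mpoly_ring V) (Suc (length ys)) (C(Suc (length ys) := Q))"
    using C sub Cons.prems(1) by (auto simp: prime_chain_def le_Suc_eq less_Suc_eq)
  then show ?case by (metis fun_upd_same length_Cons)
qed


section \<open>Counting monomials\<close>

text \<open>Bounding every exponent instead of the degree makes the number of monomials an exact
  power, and the bounds add under multiplication.\<close>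

definition box :: "'v set \<Rightarrow> nat \<Rightarrow> 'v monom set" where
  "box W T = {s \<in> monomials W. \<forall>v. Poly_Mapping.lookup s v \<le> T}"

lemma box_card:
  assumes "finite W"
  shows "finite (box W T)" "card (box W T) = (T + 1) ^ card W"
proof -
  let ?f = "\<lambda>s :: 'a monom. restrict (Poly_Mapping.lookup s) W"
  let ?g = "\<lambda>h. Abs_poly_mapping (\<lambda>v. if v \<in> W then h v else 0 :: nat)"
  have g: "Poly_Mapping.lookup (?g h) = (\<lambda>v. if v \<in> W then h v else 0)" for h
    using assms by (intro lookup_Abs_poly_mapping) (auto elim: finite_subset[rotated])
  have "bij_betw ?f (box W T) (W \<rightarrow>\<^sub>E {..T})"
  proof (rule bij_betw_byWitness[where f' = ?g])
    show "\<forall>s\<in>box W T. ?g (?f s) = s"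
    proof
      fix s assume "s \<in> box W T"
      then show "?g (?f s) = s" by (intro poly_mapping_eqI) (auto simp: g box_def monomials_def in_keys_iff)
    qed
    show "?g ` (W \<rightarrow>\<^sub>E {..T}) \<subseteq> box W T"
      by (auto simp: box_def monomials_def g in_keys_iff PiE_def Pi_def split: if_splits)
  qed (auto simp: box_def g PiE_def extensional_def restrict_def)
  moreover have "finite (W \<rightarrow>\<^sub>E {..T})" "card (W \<rightarrow>\<^sub>E {..T}) = (T + 1) ^ card W"
    using assms by (auto simp: card_PiE intro: finite_PiE)
  ultimately show "finite (box W T)" "card (box W T) = (T + 1) ^ card W"
    using bij_betw_finite bij_betw_same_card by metis+
qed

lemma polynomial_growth_le:
  fixes a b B C :: nat
  assumes "\<And>t. (t + 1) ^ a \<le> C * (B * t + 1) ^ b"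
  shows "a \<le> b"
proof (rule ccontr)
  assume "\<not> a \<le> b"
  then obtain d where a: "a = b + Suc d" using less_imp_Suc_add by (metis add_Suc_right not_le)
  \<comment> \<open>Chosen so that cancelling (t + 1)^b leaves (t + 1)^(d + 1) \<le> t.\<close>
  define t where "t = C * (B + 1) ^ b"
  have "(t + 1) ^ Suc d * (t + 1) ^ b \<le> C * (B * t + 1) ^ b" using assms[of t] by (simp only: a power_add mult.commute[of "(t + 1) ^ Suc d"])
  also have "B * t + 1 \<le> (B + 1) * (t + 1)" by simp
  then have "C * (B * t + 1) ^ b \<le> C * ((B + 1) * (t + 1)) ^ b" by (intro mult_left_mono power_mono) auto
  also have "\<dots> = t * (t + 1) ^ b" unfolding power_mult_distrib by (simp add: t_def mult.assoc)
  finally have "(t + 1) ^ Suc d \<le> t" by simp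
  moreover have "(t + 1) ^ 1 \<le> (t + 1) ^ Suc d" by (intro power_increasing) auto
  ultimately show False by simp
qed


text \<open>\<open>D\<close> is a maximal set of variables algebraically independent modulo
  \<open>Q\<close>. By maximality every further variable produces a nonzero element of
  \<open>Q\<close>, as the chain of contractions requires.\<close>

lemma maximal_free_variables:
  fixes Q :: "('v, 'k::field) mpoly set"
  assumes prime: "primeideal Q (mpoly_ring V)" and V: "finite V"
  obtains D C where "D \<subseteq> V" "Q \<inter> carrier (mpoly_ring D) \<subseteq> {0}"
    "prime_chain (mpoly_ring V) (card V - card D) C" "C (card V - card D) = Q"
proof -
  note Q = mpoly_prime[OF prime]
  let ?S = "{D. D \<subseteq> V \<and> Q \<inter> carrier (mpoly_ring D) \<subseteq> {0}}"
  \<comment> \<open>A nonzero constant in \<open>Q\<close> would be a unit, so the empty set of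
    variables is admissible.\<close>
  have "Q \<inter> carrier (mpoly_ring {}) \<subseteq> {0}"
  proof
    fix g assume g: "g \<in> Q \<inter> carrier (mpoly_ring {})"
    then have "Poly_Mapping.keys g \<subseteq> {0}" by (auto simp: carrier_mpoly monomials_def)
    then have eq: "g = Poly_Mapping.single 0 (Poly_Mapping.lookup g 0)"
      using poly_mapping_sum_single[of g] by (auto simp: subset_singleton_iff)
    have "Poly_Mapping.lookup g 0 = 0"
    proof (rule ccontr)
      assume c: "Poly_Mapping.lookup g 0 \<noteq> 0"
      have "Poly_Mapping.single 0 (inverse (Poly_Mapping.lookup g 0)) * g \<in> Q"
        using g by (intro mpoly_ideal(3)[OF Q(1)]) (auto simp: carrier_mpoly zero_monomials)
      moreover have "Poly_Mapping.single 0 (inverse (Poly_Mapping.lookup g 0)) * g = 1"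
        using c by (subst eq) (simp add: mult_single)
      ultimately show False using Q(2) by simp
    qed
    then show "g \<in> {0}" using eq by simp
  qed
  then have "{} \<in> ?S" by auto
  moreover have "finite ?S" using V by auto
  ultimately have "\<exists>D\<in>?S. \<forall>D'\<in>?S. D \<subseteq> D' \<longrightarrow> D = D'" by (intro finite_has_maximal) auto
  then obtain D where D: "D \<in> ?S" and max: "\<forall>D'\<in>?S. D \<subseteq> D' \<longrightarrow> D = D'" by (elim bexE)
  obtain ys where ys: "set ys = V - D" "distinct ys" using finite_distinct_list V by (metis finite_Diff)
  have len: "length ys = card V - card D"
    using ys D V by (metis (no_types, lifting) card_Diff_subset distinct_card finite_subset mem_Collect_eq)
  have "\<exists>g\<in>Q. g \<noteq> 0 \<and> g \<in> carrier (mpoly_ring (insert y D))" if y: "y \<in> set ys" for y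
  proof (rule ccontr)
    assume "\<not> ?thesis"
    then have "insert y D \<in> ?S" using y ys D by auto
    from bspec[OF max this] have "D = insert y D" by (simp add: subset_insertI)
    then show False using y ys by auto
  qed
  then obtain C where "prime_chain (mpoly_ring V) (length ys) C" "C (length ys) = Q"
    using chain_of_contractions[OF prime ys(2), of D] ys(1) D by auto
  then show ?thesis using that D len by auto
qed

text \<open>Modulo the binomials, every monomial is congruent to one of the same degree that is divisible
  by none of the \<open>n\<close> coprime initial monomials. There are so few of these that two monomials in
  the variables from \<open>D\<close> are congruent if \<open>D\<close> is too large.\<close>

lemma free_variables_bound:
  fixes Q :: "('v, 'k::field) mpoly set" and L M X Y :: "nat \<Rightarrow> 'v" and w :: "'v \<Rightarrow> nat"
  assumes I: "ideal Q (mpoly_ring V)" and V: "finite V" and D: "D \<subseteq> V" "Q \<inter> carrier (mpoly_ring D) \<subseteq> {0}"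
    and mem: "\<And>i. i < n \<Longrightarrow> L i \<in> V" "\<And>i. i < n \<Longrightarrow> M i \<in> V" "\<And>i. i < n \<Longrightarrow> X i \<in> V" "\<And>i. i < n \<Longrightarrow> Y i \<in> V"
    and LM: "\<And>i. i < n \<Longrightarrow> L i \<noteq> M i"
    and disj: "\<And>i j. i < n \<Longrightarrow> j < n \<Longrightarrow> i \<noteq> j \<Longrightarrow> {L i, M i} \<inter> {L j, M j} = {}"
    and w: "\<And>i. i < n \<Longrightarrow> w (X i) + w (Y i) < w (L i) + w (M i)"
    and Q: "\<And>i. i < n \<Longrightarrow> Poly_Mapping.single (Poly_Mapping.single (L i) 1 + Poly_Mapping.single (M i) 1) 1 -
      Poly_Mapping.single (Poly_Mapping.single (X i) 1 + Poly_Mapping.single (Y i) 1) 1 \<in> Q"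
  shows "card D + n \<le> card V"
proof -
  define std where "std t \<longleftrightarrow> t \<in> monomials V \<and>
    (\<forall>i<n. Poly_Mapping.lookup t (L i) = 0 \<or> Poly_Mapping.lookup t (M i) = 0)" for t
  let ?x = "\<lambda>s. Poly_Mapping.single s 1 :: ('v, 'k) mpoly"
  have "\<exists>t. std t \<and> monom_degree t = monom_degree s \<and> ?x s - ?x t \<in> Q" if "s \<in> monomials V" for s
    using that
  proof (induction "weight w s" arbitrary: s rule: less_induct)
    case less
    show ?case
    proof (cases "std s")
      case True
      then show ?thesis using mpoly_ideal(1)[OF I] by (intro exI[of _ s]) auto
    next
      case False
      then obtain i where i: "i < n" "Poly_Mapping.lookup s (L i) \<noteq> 0" "Poly_Mapping.lookup s (M i) \<noteq> 0"
        using less.prems by (auto simp: std_def)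
      define a where "a = Poly_Mapping.single (L i) 1 + Poly_Mapping.single (M i) (1::nat)"
      define b where "b = Poly_Mapping.single (X i) 1 + Poly_Mapping.single (Y i) (1::nat)"
      define u where "u = s - a"
      have s: "s = u + a"
        by (rule poly_mapping_eqI)
          (use i LM[of i] in \<open>auto simp: u_def a_def lookup_add minus_poly_mapping.rep_eq lookup_single when_def\<close>)
      have u: "u \<in> monomials V" using less.prems s by (auto simp: monomials_plus_iff)
      have b: "b \<in> monomials V" using mem i by (auto simp: b_def monomials_plus_iff) (auto simp: monomials_def)
      have "weight w (u + b) < weight w s" using w[OF i(1)] by (simp add: s a_def b_def weight_add weight_single)
      then obtain t where t: "std t" "monom_degree t = monom_degree (u + b)" "?x (u + b) - ?x t \<in> Q"
        using less.hyps u b by (metis monomials_plus)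
      have "?x u * (?x a - ?x b) \<in> Q"
        using Q[OF i(1)] u by (intro mpoly_ideal(3)[OF I]) (auto simp: carrier_mpoly a_def b_def)
      then have "(?x s - ?x (u + b)) + (?x (u + b) - ?x t) \<in> Q"
        using t(3) by (intro mpoly_ideal(2)[OF I]) (auto simp: right_diff_distrib mult_single s)
      moreover have "monom_degree (u + b) = monom_degree s"
        by (simp add: monom_degree_weight weight_add weight_single s a_def b_def)
      ultimately show ?thesis using t by (intro exI[of _ t]) auto
    qed
  qed
  then obtain nf where nf: "\<And>s. s \<in> monomials V \<Longrightarrow> std (nf s)"
    "\<And>s. s \<in> monomials V \<Longrightarrow> monom_degree (nf s) = monom_degree s" "\<And>s. s \<in> monomials V \<Longrightarrow> ?x s - ?x (nf s) \<in> Q"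
    by metis
  \<comment> \<open>Monomials with the same reduction are congruent modulo \<open>Q\<close>, and for
    monomials in the variables of \<open>D\<close> the difference must then vanish.\<close>
  have inj: "inj_on nf (monomials D)"
  proof (rule inj_onI)
    fix s t assume st: "s \<in> monomials D" "t \<in> monomials D" "nf s = nf t"
    then have "s \<in> monomials V" "t \<in> monomials V" using D(1) by (auto simp: monomials_def)
    from mpoly_ideal(4)[OF I nf(3)[OF this(1)] nf(3)[OF this(2)]]
    have "?x s - ?x t \<in> Q" using st(3) by simp
    moreover have "?x s - ?x t \<in> carrier (mpoly_ring D)" using st by (intro mpoly_carrier_closed)
    ultimately have "?x s - ?x t = 0" using D(2) by blast
    then show "s = t" by (metis right_minus_eq lookup_single_eq lookup_single_not_eq zero_neq_one)
  qed
  \<comment> \<open>One factor is selected from each pair: a monomial divisible by no initial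
    monomial avoids \<open>sel c\<close> for some \<open>c\<close>, so it involves at most card V -
    n variables.\<close>
  define sel where "sel c = (\<lambda>i. if i \<in> c then L i else M i) ` {..<n}" for c
  have sel: "sel c \<subseteq> V" "card (sel c) = n" for c
  proof -
    have "inj_on (\<lambda>i. if i \<in> c then L i else M i) {..<n}"
    proof (rule inj_onI, rule ccontr)
      fix i j assume ij: "i \<in> {..<n}" "j \<in> {..<n}" "i \<noteq> j"
        "(if i \<in> c then L i else M i) = (if j \<in> c then L j else M j)"
      then show False using disj[of i j] by (auto split: if_splits)
    qed
    then show "card (sel c) = n" unfolding sel_def by (simp only: card_image card_lessThan)
    show "sel c \<subseteq> V" using mem by (auto simp: sel_def)
  qed
  have std_box: "t \<in> (\<Union>c\<in>Pow {..<n}. box (V - sel c) T)" if t: "std t" "monom_degree t \<le> T" for t T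
  proof -
    let ?c = "{i. i < n \<and> Poly_Mapping.lookup t (L i) = 0}"
    have "Poly_Mapping.lookup t v = 0" if "v \<in> sel ?c" for v
      using that t(1) by (auto simp: sel_def std_def split: if_splits)
    then have "t \<in> monomials (V - sel ?c)" using t(1) by (auto simp: std_def monomials_def in_keys_iff)
    moreover have "Poly_Mapping.lookup t v \<le> T" for v
    proof (cases "v \<in> Poly_Mapping.keys t")
      case True
      then have "Poly_Mapping.lookup t v \<le> monom_degree t"
        unfolding monom_degree_def by (intro member_le_sum) auto
      then show ?thesis using t(2) by simp
    qed (auto simp: in_keys_iff)
    ultimately have "t \<in> box (V - sel ?c) T" by (simp add: box_def)
    then show ?thesis by (intro UN_I[of ?c]) auto
  qed
  have "(t + 1) ^ card D \<le> 2 ^ n * (card D * t + 1) ^ (card V - n)" for t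
  proof -
    \<comment> \<open>This bounds the degrees of the monomials in \<open>box D t\<close>. Reduction
      preserves degrees but not single exponents, so the boxes on the other side need this larger
      bound.\<close>
    let ?T = "card D * t"
    have fD: "finite D" using D(1) V finite_subset by blast
    have fin: "finite (\<Union>c\<in>Pow {..<n}. box (V - sel c) ?T)" using V box_card(1) by (intro finite_UN_I) auto
    have "nf ` box D t \<subseteq> (\<Union>c\<in>Pow {..<n}. box (V - sel c) ?T)"
    proof
      fix y assume "y \<in> nf ` box D t"
      then obtain s where s: "s \<in> box D t" "y = nf s" by auto
      then have sV: "s \<in> monomials V" using D(1) by (auto simp: box_def monomials_def)
      have "monom_degree s = (\<Sum>v\<in>D. Poly_Mapping.lookup s v)"
        using s(1) fD unfolding monom_degree_weight by (subst weight_superset[of D]) (auto simp: box_def monomials_def)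
      also have "\<dots> \<le> (\<Sum>v\<in>D. t)" using s(1) by (intro sum_mono) (auto simp: box_def)
      finally show "y \<in> (\<Union>c\<in>Pow {..<n}. box (V - sel c) ?T)"
        unfolding s(2) using nf sV by (intro std_box) auto
    qed
    moreover have "inj_on nf (box D t)" using inj by (rule inj_on_subset) (auto simp: box_def)
    ultimately have "card (box D t) \<le> card (\<Union>c\<in>Pow {..<n}. box (V - sel c) ?T)"
      using fin by (metis card_image card_mono)
    also have "\<dots> \<le> (\<Sum>c\<in>Pow {..<n}. card (box (V - sel c) ?T))" by (intro card_UN_le) auto
    also have "\<dots> = (\<Sum>c\<in>Pow {..<n}. (?T + 1) ^ (card V - n))"
    proof (intro sum.cong refl)
      fix c
      have "card (V - sel c) = card V - n"
        using sel[of c] V by (simp add: card_Diff_subset finite_subset)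
      then show "card (box (V - sel c) ?T) = (?T + 1) ^ (card V - n)" using V by (simp add: box_card)
    qed
    also have "\<dots> = 2 ^ n * (?T + 1) ^ (card V - n)" by (simp add: card_Pow)
    finally show ?thesis using box_card(2)[OF fD] by simp
  qed
  then have "card D \<le> card V - n" by (rule polynomial_growth_le)
  moreover have "n \<le> card V" using sel[of "{}"] V card_mono by metis
  ultimately show ?thesis by simp
qed

lemma prime_height_ge:
  fixes Q :: "('v, 'k::field) mpoly set" and L M X Y :: "nat \<Rightarrow> 'v" and w :: "'v \<Rightarrow> nat"
  assumes prime: "primeideal Q (mpoly_ring V)" and V: "finite V"
    and mem: "\<And>i. i < n \<Longrightarrow> L i \<in> V" "\<And>i. i < n \<Longrightarrow> M i \<in> V" "\<And>i. i < n \<Longrightarrow> X i \<in> V" "\<And>i. i < n \<Longrightarrow> Y i \<in> V"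
    and LM: "\<And>i. i < n \<Longrightarrow> L i \<noteq> M i"
    and disj: "\<And>i j. i < n \<Longrightarrow> j < n \<Longrightarrow> i \<noteq> j \<Longrightarrow> {L i, M i} \<inter> {L j, M j} = {}"
    and w: "\<And>i. i < n \<Longrightarrow> w (X i) + w (Y i) < w (L i) + w (M i)"
    and Q: "\<And>i. i < n \<Longrightarrow> Poly_Mapping.single (Poly_Mapping.single (L i) 1 + Poly_Mapping.single (M i) 1) 1 -
      Poly_Mapping.single (Poly_Mapping.single (X i) 1 + Poly_Mapping.single (Y i) 1) 1 \<in> Q"
  shows "enat n \<le> prime_height (mpoly_ring V) Q"
proof -
  obtain D C where D: "D \<subseteq> V" "Q \<inter> carrier (mpoly_ring D) \<subseteq> {0}"
    and C: "prime_chain (mpoly_ring V) (card V - card D) C" "C (card V - card D) = Q"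
    using maximal_free_variables[OF prime V] .
  have "card D + n \<le> card V"
    by (rule free_variables_bound[OF mpoly_prime(1)[OF prime] V D mem LM disj w Q])
  then have "enat n \<le> enat (card V - card D)" by simp
  also have "\<dots> \<le> prime_height (mpoly_ring V) Q"
    unfolding prime_height_chains using C by (intro Sup_upper) auto
  finally show ?thesis .
qed


section \<open>A prime ideal of small height\<close>

lemma box_mult:
  fixes p q :: "('v, 'k::field) mpoly"
  assumes "Poly_Mapping.keys p \<subseteq> box V S" "Poly_Mapping.keys q \<subseteq> box V T"
  shows "Poly_Mapping.keys (p * q) \<subseteq> box V (S + T)"
proof
  fix s assume "s \<in> Poly_Mapping.keys (p * q)"
  then obtain a b where "s = a + b" "a \<in> box V S" "b \<in> box V T" using assms Poly_Mapping.keys_mult[of p q] by blast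
  then show "s \<in> box V (S + T)" by (auto simp: box_def monomials_plus lookup_add add_mono)
qed

lemma box_power:
  fixes p :: "('v, 'k::field) mpoly"
  assumes "Poly_Mapping.keys p \<subseteq> box V T"
  shows "Poly_Mapping.keys (p ^ k) \<subseteq> box V (k * T)"
proof (induction k)
  case 0
  then show ?case by (auto simp: box_def zero_monomials)
next
  case (Suc k)
  then show ?case using box_mult[OF assms Suc] by simp
qed

lemma box_mono: "S \<le> T \<Longrightarrow> box V S \<subseteq> box V T"
  by (auto simp: box_def intro: order_trans)

lemma carrier_box:
  fixes p :: "('v, 'k::field) mpoly"
  assumes "p \<in> carrier (mpoly_ring V)"
  obtains T where "Poly_Mapping.keys p \<subseteq> box V T"
proof
  let ?T = "\<Sum>s\<in>Poly_Mapping.keys p. monom_degree s"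
  show "Poly_Mapping.keys p \<subseteq> box V ?T"
  proof
    fix s assume s: "s \<in> Poly_Mapping.keys p"
    have "Poly_Mapping.lookup s v \<le> ?T" for v
    proof (cases "v \<in> Poly_Mapping.keys s")
      case True
      have "Poly_Mapping.lookup s v \<le> monom_degree s"
        unfolding monom_degree_def using True by (intro member_le_sum) auto
      also have "\<dots> \<le> ?T" using s by (intro member_le_sum) auto
      finally show ?thesis .
    qed (simp add: in_keys_iff)
    then show "s \<in> box V ?T" using s assms by (auto simp: box_def carrier_mpoly)
  qed
qed

definition independent_mod :: "('v, 'k::field) mpoly set \<Rightarrow> 'i set \<Rightarrow> ('i \<Rightarrow> ('v, 'k) mpoly) \<Rightarrow> bool" where
  "independent_mod Q I b \<longleftrightarrow>
     (\<forall>c. (\<Sum>i\<in>I. Poly_Mapping.single 0 (c i) * b i) \<in> Q \<longrightarrow> (\<forall>i\<in>I. c i = 0))"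

lemma independent_modD:
  assumes "independent_mod Q I b" "(\<Sum>i\<in>I. Poly_Mapping.single 0 (c i) * b i) \<in> Q" "i \<in> I"
  shows "c i = 0"
  using assms unfolding independent_mod_def by simp

lemma independent_mod_reindex:
  assumes "independent_mod Q I b" "inj_on h I" "\<And>i. i \<in> I \<Longrightarrow> b' (h i) = b i"
  shows "independent_mod Q (h ` I) b'"
  unfolding independent_mod_def
proof (intro allI impI)
  fix c assume *: "(\<Sum>i\<in>h ` I. Poly_Mapping.single 0 (c i) * b' i) \<in> Q"
  have "(\<Sum>i\<in>h ` I. Poly_Mapping.single 0 (c i) * b' i) = (\<Sum>i\<in>I. Poly_Mapping.single 0 (c (h i)) * b i)"
    unfolding sum.reindex[OF assms(2)] by (intro sum.cong) (simp_all add: assms(3))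
  then have "c (h i) = 0" if "i \<in> I" for i
    using independent_modD[OF assms(1), of "\<lambda>i. c (h i)"] * that by simp
  then show "\<forall>i\<in>h ` I. c i = 0" by blast
qed

text \<open>The number \<open>a\<close> plays the role of the dimension of the residue ring of \<open>Q\<close>.\<close>

definition grows :: "'v set \<Rightarrow> ('v, 'k::field) mpoly set \<Rightarrow> nat \<Rightarrow> bool" where
  "grows V Q a \<longleftrightarrow> (\<exists>d. \<forall>t. \<exists>(I :: nat set) b. finite I \<and> card I = (t + 1) ^ a \<and>
     (\<forall>i\<in>I. Poly_Mapping.keys (b i) \<subseteq> box V (d * t)) \<and> independent_mod Q I b)"

text \<open>Modulo \<open>Q'\<close> only the summand for k = 0 remains, as \<open>f\<close> is in
  \<open>Q'\<close>, and independence annihilates its coefficients. The rest is \<open>f\<close>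
  times a shorter combination, and \<open>f\<close> cancels because \<open>Q\<close> is prime and
  does not contain it.\<close>

lemma power_combination_zero:
  fixes Q Q' :: "('v, 'k::field) mpoly set"
  assumes prime: "primeideal Q (mpoly_ring V)" and Q': "ideal Q' (mpoly_ring V)" "Q \<subseteq> Q'"
    and f: "f \<in> Q'" "f \<notin> Q" and ind: "independent_mod Q' I b"
    and b: "\<And>i. i \<in> I \<Longrightarrow> b i \<in> carrier (mpoly_ring V)"
    and sum: "(\<Sum>k\<le>t. f ^ k * (\<Sum>i\<in>I. Poly_Mapping.single 0 (c i k) * b i)) \<in> Q"
  shows "\<forall>k\<le>t. \<forall>i\<in>I. c i k = 0"
  using sum
proof (induction t arbitrary: c)
  case 0
  then have "(\<Sum>i\<in>I. Poly_Mapping.single 0 (c i 0) * b i) \<in> Q'" using Q'(2) by auto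
  then have "\<forall>i\<in>I. c i 0 = 0" using independent_modD[OF ind, of "\<lambda>i. c i 0"] by blast
  then show ?case by simp
next
  case (Suc t)
  note Q = mpoly_prime[OF prime]
  have fc: "f \<in> carrier (mpoly_ring V)" using f(1) mpoly_ideal(5)[OF Q'(1)] by blast
  define B where "B k = (\<Sum>i\<in>I. Poly_Mapping.single 0 (c i k) * b i)" for k
  have carrier: "ideal (carrier (mpoly_ring V :: ('v, 'k) mpoly ring)) (mpoly_ring V)"
    using ring.oneideal[OF cring.axioms(1)[OF cring_mpoly_ring]] .
  have Bc: "B k \<in> carrier (mpoly_ring V)" for k
    unfolding B_def using b by (intro mpoly_ideal_sum[OF carrier] mpoly_carrier_closed zero_monomials)
  define R where "R = (\<Sum>k\<le>t. f ^ k * B (Suc k))"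
  have Rc: "R \<in> carrier (mpoly_ring V)"
    unfolding R_def using Bc fc by (intro mpoly_ideal_sum[OF carrier] mpoly_carrier_closed)
  have eq: "(\<Sum>k\<le>Suc t. f ^ k * B k) = B 0 + R * f"
    unfolding R_def sum.atMost_Suc_shift by (simp add: sum_distrib_left mult_ac)
  have sQ: "B 0 + R * f \<in> Q" using Suc.prems unfolding B_def[symmetric] eq .
  have "R * f \<in> Q'" using mpoly_ideal(3)[OF Q'(1) f(1) Rc] .
  moreover have "B 0 + R * f \<in> Q'" using sQ Q'(2) by blast
  ultimately have "(B 0 + R * f) - R * f \<in> Q'" using mpoly_ideal(4)[OF Q'(1)] by blast
  then have "(\<Sum>i\<in>I. Poly_Mapping.single 0 (c i 0) * b i) \<in> Q'" by (simp add: B_def)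
  then have c0: "\<forall>i\<in>I. c i 0 = 0" using independent_modD[OF ind, of "\<lambda>i. c i 0"] by blast
  then have "B 0 = 0" by (simp add: B_def)
  then have "R \<in> Q" using sQ Q(3)[OF Rc fc] f(2) by auto
  then have "\<forall>k\<le>t. \<forall>i\<in>I. c i (Suc k) = 0" unfolding R_def B_def by (rule Suc.IH)
  then show ?case using c0 by (metis Suc_le_mono not0_implies_Suc)
qed

text \<open>Multiplying a family independent modulo \<open>Q'\<close> by the powers up to
  \<open>t\<close> of some \<open>f\<close> in \<open>Q' - Q\<close> gives a family independent
  modulo \<open>Q\<close>. The count is multiplied by t + 1, while the exponents stay linear in
  t.\<close>

lemma grows_Suc:
  fixes Q Q' :: "('v, 'k::field) mpoly set"
  assumes prime: "primeideal Q (mpoly_ring V)" and Q': "ideal Q' (mpoly_ring V)" "Q \<subset> Q'" and "grows V Q' a"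
  shows "grows V Q (Suc a)"
proof -
  obtain f where f: "f \<in> Q'" "f \<notin> Q" using Q'(2) by blast
  then obtain e where e: "Poly_Mapping.keys f \<subseteq> box V e" using carrier_box mpoly_ideal(5)[OF Q'(1)] by metis
  obtain d where d: "\<And>t. \<exists>(I :: nat set) b. finite I \<and> card I = (t + 1) ^ a \<and>
     (\<forall>i\<in>I. Poly_Mapping.keys (b i) \<subseteq> box V (d * t)) \<and> independent_mod Q' I b"
    using assms(4) unfolding grows_def by blast
  have "\<exists>(I :: nat set) b. finite I \<and> card I = (t + 1) ^ Suc a \<and>
     (\<forall>i\<in>I. Poly_Mapping.keys (b i) \<subseteq> box V ((d + e) * t)) \<and> independent_mod Q I b" for t
  proof -
    obtain I :: "nat set" and b where I: "finite I" "card I = (t + 1) ^ a"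
      "\<And>i. i \<in> I \<Longrightarrow> Poly_Mapping.keys (b i) \<subseteq> box V (d * t)" "independent_mod Q' I b"
      using d[of t] by blast
    \<comment> \<open>Pairs are coded as natural numbers, the index type fixed in
      \<open>grows\<close>.\<close>
    define b' where "b' m = (case prod_decode m of (i, k) \<Rightarrow> b i * f ^ k)" for m
    have bc: "b i \<in> carrier (mpoly_ring V)" if "i \<in> I" for i
      using I(3)[OF that] by (auto simp: carrier_mpoly box_def)
    have "independent_mod Q (I \<times> {..t}) (\<lambda>(i, k). b i * f ^ k)"
      unfolding independent_mod_def
    proof (intro allI impI)
      fix c assume "(\<Sum>x\<in>I \<times> {..t}. Poly_Mapping.single 0 (c x) * (case x of (i, k) \<Rightarrow> b i * f ^ k)) \<in> Q"
      also have "(\<Sum>x\<in>I \<times> {..t}. Poly_Mapping.single 0 (c x) * (case x of (i, k) \<Rightarrow> b i * f ^ k)) =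
          (\<Sum>i\<in>I. \<Sum>k\<le>t. Poly_Mapping.single 0 (c (i, k)) * (b i * f ^ k))"
        by (simp add: sum.cartesian_product split_def)
      also have "\<dots> = (\<Sum>k\<le>t. \<Sum>i\<in>I. Poly_Mapping.single 0 (c (i, k)) * (b i * f ^ k))" by (rule sum.swap)
      also have "\<dots> = (\<Sum>k\<le>t. f ^ k * (\<Sum>i\<in>I. Poly_Mapping.single 0 (c (i, k)) * b i))"
        by (simp add: sum_distrib_left mult_ac)
      finally have "\<forall>k\<le>t. \<forall>i\<in>I. c (i, k) = 0"
        using power_combination_zero[OF prime Q'(1) _ f I(4) bc, where t = t and c = "\<lambda>i k. c (i, k)"] Q'(2)
        by blast
      then show "\<forall>x\<in>I \<times> {..t}. c x = 0" by auto
    qed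
    then have "independent_mod Q (prod_encode ` (I \<times> {..t})) b'"
      by (rule independent_mod_reindex) (auto simp: b'_def inj_prod_encode)
    moreover have "card (prod_encode ` (I \<times> {..t})) = (t + 1) ^ Suc a"
      using I(2) by (simp add: card_image inj_prod_encode card_cartesian_product)
    moreover have "Poly_Mapping.keys (b' m) \<subseteq> box V ((d + e) * t)" if m: "m \<in> prod_encode ` (I \<times> {..t})" for m
    proof -
      obtain i k where ik: "m = prod_encode (i, k)" "i \<in> I" "k \<le> t" using m by auto
      have "Poly_Mapping.keys (b' m) \<subseteq> box V (d * t + k * e)"
        unfolding b'_def ik(1) using box_mult[OF I(3)[OF ik(2)] box_power[OF e, of k]] by simp
      also have "\<dots> \<subseteq> box V ((d + e) * t)" using ik(3) by (intro box_mono) (simp add: algebra_simps)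
      finally show ?thesis .
    qed
    ultimately show ?thesis using I(1) by (intro exI[of _ "prod_encode ` (I \<times> {..t})"] exI[of _ b']) auto
  qed
  then show ?thesis unfolding grows_def by blast
qed

text \<open>As 0 is in \<open>Q\<close>, the family is linearly independent over the field itself,
  and it lies in the span of the monomials in \<open>T\<close>.\<close>

lemma card_independent_le:
  fixes b :: "'i \<Rightarrow> ('v, 'k::field) mpoly"
  assumes "independent_mod Q I b" "0 \<in> Q" "finite I" "finite T" "\<And>i. i \<in> I \<Longrightarrow> Poly_Mapping.keys (b i) \<subseteq> T"
  shows "card I \<le> card T"
proof -
  let ?scale = "\<lambda>(c :: 'k) (p :: ('v, 'k) mpoly). Poly_Mapping.single 0 c * p"
  interpret vector_space ?scale
    by unfold_locales (simp_all add: distrib_left distrib_right single_add mult_single flip: mult.assoc)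
  let ?x = "\<lambda>s. Poly_Mapping.single s 1 :: ('v, 'k) mpoly"
  have zero: "\<forall>i\<in>I. c i = 0" if "(\<Sum>i\<in>I. ?scale (c i) (b i)) = 0" for c
  proof -
    have "(\<Sum>i\<in>I. ?scale (c i) (b i)) \<in> Q" using that assms(2) by simp
    then show ?thesis using independent_modD[OF assms(1)] by blast
  qed
  have inj: "inj_on b I"
  proof (rule inj_onI, rule ccontr)
    fix i j assume ij: "i \<in> I" "j \<in> I" "b i = b j" "i \<noteq> j"
    let ?c = "\<lambda>l. if l = i then 1 else if l = j then - 1 else 0 :: 'k"
    have "(\<Sum>l\<in>I. ?scale (?c l) (b l)) = (\<Sum>l\<in>{i, j}. ?scale (?c l) (b l))"
      using ij assms(3) by (intro sum.mono_neutral_right) auto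
    also have "\<dots> = ?scale 1 (b i) + ?scale (- 1) (b j)" using ij(4) by simp
    also have "\<dots> = 0" using ij(3) by (simp add: single_uminus)
    finally show False using zero[of ?c] ij(1) by auto
  qed
  have "independent (b ` I)"
  proof (rule independent_if_scalars_zero)
    fix g x assume "(\<Sum>x\<in>b ` I. ?scale (g x) x) = 0" and x: "x \<in> b ` I"
    then have "(\<Sum>i\<in>I. ?scale (g (b i)) (b i)) = 0" using inj by (simp add: sum.reindex)
    then show "g x = 0" using zero[of "\<lambda>i. g (b i)"] x by auto
  qed (use assms(3) in simp)
  moreover have "b ` I \<subseteq> span (?x ` T)"
  proof
    fix p assume "p \<in> b ` I"
    then have "Poly_Mapping.keys p \<subseteq> T" using assms(5) by auto
    then have "(\<Sum>s\<in>Poly_Mapping.keys p. ?scale (Poly_Mapping.lookup p s) (?x s)) \<in> span (?x ` T)"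
      by (intro span_sum span_scale span_base) auto
    then show "p \<in> span (?x ` T)" using poly_mapping_sum_single[of p] by (simp add: mult_single)
  qed
  ultimately have "card (b ` I) \<le> card (?x ` T)"
    using independent_span_bound[of "?x ` T" "b ` I"] assms(4) by simp
  also have "\<dots> \<le> card T" using assms(4) by (rule card_image_le)
  finally show ?thesis using inj by (simp add: card_image)
qed

lemma grows_le:
  assumes "grows V Q a" "0 \<in> Q" "finite V"
  shows "a \<le> card V"
proof -
  obtain d where d: "\<And>t. \<exists>(I :: nat set) b. finite I \<and> card I = (t + 1) ^ a \<and>
     (\<forall>i\<in>I. Poly_Mapping.keys (b i) \<subseteq> box V (d * t)) \<and> independent_mod Q I b"
    using assms(1) unfolding grows_def by blast
  have "(t + 1) ^ a \<le> 1 * (d * t + 1) ^ card V" for t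
    using d[of t] card_independent_le[of Q _ _ "box V (d * t)"] assms(2) box_card[OF assms(3)]
    by (metis mult_1)
  then show ?thesis by (rule polynomial_growth_le)
qed

text \<open>Going down the chain, each strict inclusion adds one to the exponent of growth; for the
  bottom prime it cannot exceed the number of variables.\<close>

lemma grows_chain:
  assumes "prime_chain (mpoly_ring V) n C" "grows V (C n) a" "finite V"
  shows "a + n \<le> card V"
proof -
  have "grows V (C (n - j)) (a + j)" if "j \<le> n" for j
    using that
  proof (induction j)
    case (Suc j)
    have eq: "n - j = Suc (n - Suc j)" using Suc.prems by simp
    have "primeideal (C (n - Suc j)) (mpoly_ring V)" "primeideal (C (n - j)) (mpoly_ring V)" "C (n - Suc j) \<subset> C (n - j)"
      using assms(1) Suc.prems unfolding prime_chain_def eq by auto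
    then show ?case using grows_Suc[OF _ mpoly_prime(1)] Suc by (metis Suc_leD add_Suc_right)
  qed (use assms(2) in simp)
  from this[of n] have "grows V (C 0) (a + n)" by simp
  moreover have "0 \<in> C 0" using assms(1) mpoly_ideal(1)[OF mpoly_prime(1)] by (auto simp: prime_chain_def)
  ultimately show ?thesis using grows_le assms(3) by blast
qed


section \<open>The toric ideal\<close>

definition toric_weight :: "('v \<Rightarrow> nat \<Rightarrow>\<^sub>0 int) \<Rightarrow> 'v monom \<Rightarrow> nat \<Rightarrow>\<^sub>0 int" where
  "toric_weight g s = (\<Sum>v\<in>Poly_Mapping.keys s. frag_cmul (int (Poly_Mapping.lookup s v)) (g v))"

lemma toric_weight_superset:
  assumes "finite A" "Poly_Mapping.keys s \<subseteq> A"
  shows "toric_weight g s = (\<Sum>v\<in>A. frag_cmul (int (Poly_Mapping.lookup s v)) (g v))"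
  unfolding toric_weight_def using assms by (intro sum.mono_neutral_left) (auto simp: in_keys_iff)

lemma toric_weight_add: "toric_weight g (s + t) = toric_weight g s + toric_weight g t"
proof -
  let ?A = "Poly_Mapping.keys s \<union> Poly_Mapping.keys t"
  have "Poly_Mapping.keys (s + t) \<subseteq> ?A" by (rule Poly_Mapping.keys_add)
  then show ?thesis
    using toric_weight_superset[of ?A s g] toric_weight_superset[of ?A t g] toric_weight_superset[of ?A "s + t" g]
    by (simp add: lookup_add frag_cmul_distrib sum.distrib)
qed

lemma toric_weight_single: "toric_weight g (Poly_Mapping.single v 1) = g v"
  by (simp add: toric_weight_def)

text \<open>The ring homomorphism into the group algebra of a free abelian group that sends x_v to
  the group element \<open>g v\<close>. Weights lie in a group because the cell relations are solved
  by subtraction. The group \<open>nat \<Rightarrow>\<^sub>0 int\<close> is linearly ordered, so its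
  group algebra has no zero divisors and the kernel is prime.\<close>

definition toric_map :: "('v \<Rightarrow> nat \<Rightarrow>\<^sub>0 int) \<Rightarrow> ('v, 'k::field) mpoly \<Rightarrow> (nat \<Rightarrow>\<^sub>0 int) \<Rightarrow>\<^sub>0 'k" where
  "toric_map g p = (\<Sum>s\<in>Poly_Mapping.keys p. Poly_Mapping.single (toric_weight g s) (Poly_Mapping.lookup p s))"

lemma toric_map_superset:
  assumes "finite A" "Poly_Mapping.keys p \<subseteq> A"
  shows "toric_map g p = (\<Sum>s\<in>A. Poly_Mapping.single (toric_weight g s) (Poly_Mapping.lookup p s))"
  unfolding toric_map_def using assms by (intro sum.mono_neutral_left) (auto simp: in_keys_iff)

lemma toric_map_add: "toric_map g (p + q) = toric_map g p + toric_map g q"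
proof -
  let ?A = "Poly_Mapping.keys p \<union> Poly_Mapping.keys q"
  have "Poly_Mapping.keys (p + q) \<subseteq> ?A" by (rule Poly_Mapping.keys_add)
  then show ?thesis
    using toric_map_superset[of ?A p g] toric_map_superset[of ?A q g] toric_map_superset[of ?A "p + q" g]
    by (simp add: lookup_add single_add sum.distrib)
qed

lemma toric_map_zero: "toric_map g 0 = 0"
  by (simp add: toric_map_def)

lemma toric_map_single: "toric_map g (Poly_Mapping.single s a) = Poly_Mapping.single (toric_weight g s) a"
  by (simp add: toric_map_def)

lemma toric_map_mult: "toric_map g (p * q) = toric_map g p * toric_map g q"
proof (induction p rule: mpoly_induct)
  case (single s a)
  show ?case
    by (induction q rule: mpoly_induct)
      (simp_all add: toric_map_zero toric_map_add toric_map_single toric_weight_add mult_single distrib_left)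
qed (simp_all add: toric_map_zero toric_map_add distrib_right)

lemma toric_map_diff: "toric_map g (p - q) = toric_map g p - toric_map g q"
  using toric_map_add[of g "p - q" q] by simp

lemma toric_map_sum: "toric_map g (sum f A) = (\<Sum>i\<in>A. toric_map g (f i))"
  by (induction A rule: infinite_finite_induct) (simp_all add: toric_map_zero toric_map_add)

definition toric_ideal :: "'v set \<Rightarrow> ('v \<Rightarrow> nat \<Rightarrow>\<^sub>0 int) \<Rightarrow> ('v, 'k::field) mpoly set" where
  "toric_ideal V g = {p \<in> carrier (mpoly_ring V). toric_map g p = 0}"

lemma toric_ideal_prime: "primeideal (toric_ideal V g :: ('v, 'k::field) mpoly set) (mpoly_ring V)"
proof (rule mpoly_primeI)
  have "toric_map g (1 :: ('v, 'k) mpoly) = 1"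
    using toric_map_single[of g 0 "1 :: 'k"] by (simp add: toric_weight_def)
  then show "(1 :: ('v, 'k) mpoly) \<notin> toric_ideal V g" by (simp add: toric_ideal_def)
  show "ideal (toric_ideal V g :: ('v, 'k) mpoly set) (mpoly_ring V)"
    by (rule mpoly_idealI)
      (auto simp: toric_ideal_def toric_map_zero toric_map_add toric_map_mult intro: mpoly_carrier_closed)
qed (auto simp: toric_ideal_def toric_map_mult)

text \<open>The exponents of a monomial in the variables of \<open>B\<close> are coordinates of its
  weight. Distinct monomials of this kind thus map to distinct group elements, which are linearly
  independent.\<close>

lemma toric_ideal_grows:
  fixes f :: "'v \<Rightarrow> nat"
  assumes "finite V" "B \<subseteq> V" "inj_on f B" and g: "\<And>v. v \<in> B \<Longrightarrow> g v = frag_of (f v)"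
  shows "grows V (toric_ideal V g :: ('v, 'k::field) mpoly set) (card B)"
  unfolding grows_def
proof (intro exI[of _ 1] allI)
  fix t
  have fB: "finite B" using assms finite_subset by blast
  let ?x = "\<lambda>s. Poly_Mapping.single s 1 :: ('v, 'k) mpoly"
  have inj: "inj_on (toric_weight g) (box B t)"
  proof (rule inj_onI, rule poly_mapping_eqI)
    fix s u v assume su: "s \<in> box B t" "u \<in> box B t" "toric_weight g s = toric_weight g u"
    have *: "Poly_Mapping.lookup (toric_weight g r) (f v) = int (Poly_Mapping.lookup r v)"
      if "r \<in> box B t" "v \<in> B" for r v
    proof -
      have "toric_weight g r = (\<Sum>v\<in>B. frag_cmul (int (Poly_Mapping.lookup r v)) (g v))"
        using that fB by (intro toric_weight_superset) (auto simp: box_def monomials_def)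
      also have "Poly_Mapping.lookup \<dots> (f v) = (\<Sum>x\<in>B. if x = v then int (Poly_Mapping.lookup r x) else 0)"
        using assms(3) that(2) by (auto simp: lookup_sum g inj_on_eq_iff intro!: sum.cong)
      finally show ?thesis using fB that(2) by simp
    qed
    show "Poly_Mapping.lookup s v = Poly_Mapping.lookup u v"
    proof (cases "v \<in> B")
      case True
      then show ?thesis using *[of s v] *[of u v] su by simp
    next
      case False
      then have "v \<notin> Poly_Mapping.keys s" "v \<notin> Poly_Mapping.keys u" using su by (auto simp: box_def monomials_def)
      then show ?thesis by (simp add: in_keys_iff)
    qed
  qed
  have ind: "independent_mod (toric_ideal V g) (box B t) ?x"
    unfolding independent_mod_def
  proof (intro allI impI ballI)
    fix c s assume "(\<Sum>s\<in>box B t. Poly_Mapping.single 0 (c s) * ?x s) \<in> toric_ideal V g" and s: "s \<in> box B t"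
    then have "(\<Sum>s\<in>box B t. Poly_Mapping.single (toric_weight g s) (c s)) = 0"
      by (simp add: toric_ideal_def toric_map_sum mult_single toric_map_single)
    then have "0 = Poly_Mapping.lookup (\<Sum>s\<in>box B t. Poly_Mapping.single (toric_weight g s) (c s)) (toric_weight g s)"
      by simp
    also have "\<dots> = (\<Sum>r\<in>box B t. if r = s then c r else 0)"
      using inj s by (auto simp: lookup_sum lookup_single when_def inj_on_eq_iff intro!: sum.cong)
    finally show "c s = 0" using box_card(1)[OF fB] s by simp
  qed
  obtain h :: "'v monom \<Rightarrow> nat" where h: "inj_on h (box B t)"
    using box_card(1)[OF fB] finite_imp_inj_to_nat_seg by metis
  have "independent_mod (toric_ideal V g) (h ` box B t) (\<lambda>i. ?x (the_inv_into (box B t) h i))"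
    by (rule independent_mod_reindex[OF ind h]) (simp add: the_inv_into_f_f[OF h])
  moreover have "Poly_Mapping.keys (?x (the_inv_into (box B t) h i)) \<subseteq> box V (1 * t)" if "i \<in> h ` box B t" for i
  proof -
    have "the_inv_into (box B t) h i \<in> box B t" using that h by (auto simp: the_inv_into_f_f)
    then show ?thesis using assms(2) by (auto simp: box_def monomials_def)
  qed
  moreover have "card (h ` box B t) = (t + 1) ^ card B" using box_card(2)[OF fB] h by (simp add: card_image)
  ultimately show "\<exists>(I :: nat set) b. finite I \<and> card I = (t + 1) ^ card B \<and>
     (\<forall>i\<in>I. Poly_Mapping.keys (b i) \<subseteq> box V (1 * t)) \<and> independent_mod (toric_ideal V g :: ('v, 'k) mpoly set) I b"
    using box_card(1)[OF fB] by (intro exI[of _ "h ` box B t"] exI[of _ "\<lambda>i. ?x (the_inv_into (box B t) h i)"]) auto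
qed

text \<open>Each cell relation determines the weight of its upper right corner. The corners of distinct
  cells are distinct, so the weights of all other vertices are free.\<close>

fun grid_weight :: "point set \<Rightarrow> (point \<Rightarrow> 'g) \<Rightarrow> nat \<Rightarrow> nat \<Rightarrow> 'g::ab_group_add" where
  "grid_weight Z f (Suc i) (Suc j) = (if (i, j) \<in> Z
     then grid_weight Z f (Suc i) j + grid_weight Z f i (Suc j) - grid_weight Z f i j else f (Suc i, Suc j))"
| "grid_weight Z f 0 j = f (0, j)"
| "grid_weight Z f (Suc i) 0 = f (Suc i, 0)"

lemma grid_weight_free:
  assumes "(i, j) \<notin> (\<lambda>c. c + (1, 1)) ` Z"
  shows "grid_weight Z f i j = f (i, j)"
proof (cases "i = 0 \<or> j = 0")
  case False
  then obtain i' j' where ij: "i = Suc i'" "j = Suc j'" by (metis not0_implies_Suc)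
  have "(i', j') \<notin> Z"
  proof
    assume "(i', j') \<in> Z"
    then have "(i', j') + (1, 1) \<in> (\<lambda>c. c + (1, 1)) ` Z" by (rule imageI)
    then show False using assms ij by simp
  qed
  then show ?thesis using ij by simp
qed (cases i; cases j; simp)

text \<open>The relations of the cells in the interval telescope, in the second coordinate for each
  fixed first one and then in the first.\<close>

lemma grid_weight_interval:
  assumes "\<And>x y. i \<le> x \<Longrightarrow> x < k \<Longrightarrow> j \<le> y \<Longrightarrow> y < l \<Longrightarrow> (x, y) \<in> Z" "i \<le> k" "j \<le> l"
  shows "grid_weight Z f i j + grid_weight Z f k l = grid_weight Z f i l + grid_weight Z f k j"
proof -
  let ?w = "grid_weight Z f"
  have rel: "?w x y + ?w (Suc x) (Suc y) = ?w x (Suc y) + ?w (Suc x) y" if "i \<le> x" "x < k" "j \<le> y" "y < l" for x y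
    using assms(1)[OF that] by simp
  have row: "?w x j + ?w (Suc x) l = ?w x l + ?w (Suc x) j" if "i \<le> x" "x < k" for x
    using assms(3)
  proof (induction rule: inc_induct)
    case (step y)
    have 1: "?w x y + ?w (Suc x) (Suc y) = ?w x (Suc y) + ?w (Suc x) y" by (rule rel) (use that step in auto)
    have 2: "?w x y = ?w x (Suc y) + ?w (Suc x) y - ?w (Suc x) (Suc y)"
      unfolding eq_diff_eq by (rule 1)
    have 3: "?w x l = ?w x (Suc y) + ?w (Suc x) l - ?w (Suc x) (Suc y)"
      unfolding eq_diff_eq by (rule step.IH[symmetric])
    show ?case unfolding 2 3 by (simp add: algebra_simps del: grid_weight.simps)
  qed (simp add: add.commute)
  show ?thesis using assms(2)
  proof (induction rule: inc_induct)
    case (step x)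
    have 2: "?w x j = ?w x l + ?w (Suc x) j - ?w (Suc x) l"
      unfolding eq_diff_eq by (rule row) (use step in auto)
    have 3: "?w k l = ?w (Suc x) l + ?w k j - ?w (Suc x) j"
      unfolding eq_diff_eq using step.IH by (simp only: add.commute)
    show ?case unfolding 2 3 by (simp add: algebra_simps del: grid_weight.simps)
  qed (simp add: add.commute)
qed

lemma inner_interval_cell_mem:
  assumes "inner_interval P (i, j) (k, l)" "i \<le> x" "x < k" "j \<le> y" "y < l"
  shows "cell (x, y) \<in> P"
proof -
  have "is_cell (cell (x, y))" "cell (x, y) \<subseteq> {(i, j)..(k, l)}"
    using assms by (auto simp: is_cell_iff cell_subset_iff less_eq_prod_def)
  then show ?thesis using assms(1) by (auto simp: inner_interval_def)
qed

lemma inner_interval_vertices: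
  assumes "inner_interval P (i, j) (k, l)" and v: "i \<le> fst v" "fst v \<le> k" "j \<le> snd v" "snd v \<le> l"
  shows "v \<in> vertices P"
proof -
  have less: "i < k" "j < l" using assms(1) by (auto simp: inner_interval_def proper_interval_def)
  define x y where "x = (if fst v = k then k - 1 else fst v)" and "y = (if snd v = l then l - 1 else snd v)"
  have "cell (x, y) \<in> P"
    using v less by (intro inner_interval_cell_mem[OF assms(1)]) (auto simp: x_def y_def)
  moreover have "v \<in> cell (x, y)" using v less by (auto simp: mem_cell x_def y_def)
  ultimately show ?thesis by (auto simp: vertices_def)
qed

lemma cell_collection_prime:
  assumes "cell_collection P"
  obtains Q :: "(point, 'k::field) mpoly set"
  where "primeideal Q (mpoly_ring (vertices P))" "polyomino_ideal P \<subseteq> Q"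
    "prime_height (mpoly_ring (vertices P)) Q \<le> enat (card P)"
proof -
  define V where "V = vertices P"
  define Z where "Z = {c. cell c \<in> P}"
  have P: "P = cell ` Z" using assms by (auto simp: Z_def cell_collection_def is_cell_iff)
  have inj: "inj_on cell Z" by (auto simp: inj_on_def inj_cell)
  have finP: "finite P" using assms by (simp add: cell_collection_def)
  then have finZ: "finite Z" "card Z = card P" using P inj by (auto simp: finite_image_iff card_image)
  have "finite C" if "C \<in> P" for C using that P by (auto simp: cell_Pair)
  then have finV: "finite V" using finP by (auto simp: V_def vertices_def)
  define B where "B = V - (\<lambda>c. c + (1, 1)) ` Z"
  have sub: "(\<lambda>c. c + (1, 1)) ` Z \<subseteq> V" by (auto simp: V_def vertices_def P mem_cell)
  have "inj_on (\<lambda>c. c + (1, 1) :: point) Z" by (rule inj_onI) (simp add: prod_eq_iff)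
  then have "card ((\<lambda>c. c + (1, 1) :: point) ` Z) = card P" using finZ by (simp add: card_image)
  then have cardB: "card B + card P = card V"
    using sub finV finZ(1) card_mono[OF finV sub] by (simp add: B_def card_Diff_subset)
  define f where "f v = frag_of (prod_encode v)" for v
  define g where "g v = grid_weight Z f (fst v) (snd v)" for v
  define Q :: "(point, 'k) mpoly set" where "Q = toric_ideal V g"
  have prime: "primeideal Q (mpoly_ring V)" unfolding Q_def by (rule toric_ideal_prime)
  have grows: "grows V Q (card B)"
    unfolding Q_def
  proof (rule toric_ideal_grows[OF finV _ inj_prod_encode])
    show "g v = frag_of (prod_encode v)" if "v \<in> B" for v
      using that grid_weight_free[of "fst v" "snd v" Z f] by (simp add: B_def g_def f_def)
  qed (simp add: B_def)
  have "polyomino_ideal P \<subseteq> Q"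
    unfolding polyomino_ideal_def V_def[symmetric]
  proof (rule ring.genideal_minimal[OF cring.axioms(1)[OF cring_mpoly_ring] mpoly_prime(1)[OF prime]], rule subsetI)
    fix p :: "(point, 'k) mpoly"
    assume "p \<in> {Var (i, j) * Var (k, l) - Var (i, l) * Var (k, j) |i j k l. inner_interval P (i, j) (k, l)}"
    then obtain i j k l where p: "p = Var (i, j) * Var (k, l) - Var (i, l) * Var (k, j)"
      and inner: "inner_interval P (i, j) (k, l)" by auto
    have less: "i < k" "j < l" using inner by (auto simp: inner_interval_def proper_interval_def)
    have Z: "(x, y) \<in> Z" if "i \<le> x" "x < k" "j \<le> y" "y < l" for x y
      using inner_interval_cell_mem[OF inner that] by (simp add: Z_def)
    have V: "v \<in> V" if v: "i \<le> fst v" "fst v \<le> k" "j \<le> snd v" "snd v \<le> l" for v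
      using inner_interval_vertices[OF inner v] by (simp add: V_def)
    have "g (i, j) + g (k, l) = g (i, l) + g (k, j)"
      unfolding g_def fst_conv snd_conv by (rule grid_weight_interval) (use Z less in auto)
    moreover have "Poly_Mapping.single (Poly_Mapping.single u 1 + Poly_Mapping.single v 1) (1 :: 'k) \<in> carrier (mpoly_ring V)"
      if "u \<in> V" "v \<in> V" for u v
      using that by (intro mpoly_carrier_closed(7)) (auto simp: monomials_plus_iff, auto simp: monomials_def)
    ultimately show "p \<in> Q"
      using V less unfolding p Q_def toric_ideal_def Var_def mult_single
      by (auto simp: toric_map_single toric_weight_add toric_weight_single[unfolded One_nat_def]
          toric_map_diff intro!: mpoly_carrier_closed(6))
  qed
  moreover have "prime_height (mpoly_ring V) Q \<le> enat (card P)"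
    unfolding prime_height_chains
  proof (rule Sup_least)
    fix h assume "h \<in> {enat n |n. \<exists>C. prime_chain (mpoly_ring V) n C \<and> C n = Q}"
    then obtain n C where h: "h = enat n" "prime_chain (mpoly_ring V) n C" "C n = Q" by auto
    then have "card B + n \<le> card V" using grows_chain[OF h(2) _ finV] grows by simp
    then show "h \<le> enat (card P)" using cardB h(1) by simp
  qed
  ultimately show ?thesis using that prime by (simp add: V_def)
qed


section \<open>Inner minors\<close>

definition pair_monom :: "'v \<Rightarrow> 'v \<Rightarrow> 'v monom" where
  "pair_monom a b = Poly_Mapping.single a 1 + Poly_Mapping.single b 1"

lemma keys_pair_monom: "Poly_Mapping.keys (pair_monom a b) = {a, b}"
  by (auto simp: pair_monom_def in_keys_iff lookup_add lookup_single when_def split: if_splits)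

lemma pair_monom_eqD: "pair_monom a b = pair_monom c d \<Longrightarrow> {a, b} = {c, d}"
  by (metis keys_pair_monom)

lemma pair_monom_cong: "{a, b} = {c, d} \<Longrightarrow> pair_monom a b = pair_monom c d"
  by (auto simp: pair_monom_def doubleton_eq_iff add.commute)

lemma pair_monom_monomials: "a \<in> V \<Longrightarrow> b \<in> V \<Longrightarrow> pair_monom a b \<in> monomials V"
  by (simp add: monomials_def keys_pair_monom)

lemma monom_degree_add: "monom_degree (s + t) = monom_degree s + monom_degree t"
  by (simp add: monom_degree_weight weight_add)

lemma monom_degree_pair: "monom_degree (pair_monom a b) = 2"
  by (simp add: pair_monom_def monom_degree_weight weight_add weight_single)

lemma monom_degree_eq_0: "monom_degree s = 0 \<longleftrightarrow> s = 0"
  by (auto simp: monom_degree_def in_keys_iff intro: poly_mapping_eqI)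

abbreviation pair_term :: "'v \<Rightarrow> 'v \<Rightarrow> ('v, 'k::field) mpoly" where
  "pair_term a b \<equiv> Poly_Mapping.single (pair_monom a b) 1"

lemma Var_mult: "Var a * Var b = pair_term a b"
  by (simp add: Var_def mult_single pair_monom_def)

definition inner_minors :: "point set set \<Rightarrow> (point, 'k::field) mpoly set" where
  "inner_minors P =
     {Var (i, j) * Var (k, l) - Var (i, l) * Var (k, j) | i j k l. inner_interval P (i, j) (k, l)}"

lemma inner_minors_cases:
  assumes "f \<in> inner_minors P"
  obtains i j k l where "f = pair_term (i, j) (k, l) - pair_term (i, l) (k, j)" "inner_interval P (i, j) (k, l)"
    "i < k" "j < l" "{(i, j), (k, l), (i, l), (k, j)} \<subseteq> vertices P"
proof -
  obtain i j k l where f: "f = pair_term (i, j) (k, l) - pair_term (i, l) (k, j)" "inner_interval P (i, j) (k, l)"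
    using assms by (auto simp: inner_minors_def Var_mult)
  moreover have "i < k" "j < l" using f(2) by (auto simp: inner_interval_def proper_interval_def)
  moreover have "{(i, j), (k, l), (i, l), (k, j)} \<subseteq> vertices P"
    using inner_interval_vertices[OF f(2)] \<open>i < k\<close> \<open>j < l\<close> by auto
  ultimately show ?thesis using that by blast
qed

lemma inner_minors_generators: "homogeneous_generators (vertices P) (polyomino_ideal P) (inner_minors P)"
proof -
  have "f \<in> carrier (mpoly_ring (vertices P))" "homogeneous f" if f: "f \<in> inner_minors P" for f
  proof -
    obtain i j k l where 1: "f = pair_term (i, j) (k, l) - pair_term (i, l) (k, j)"
      "{(i, j), (k, l), (i, l), (k, j)} \<subseteq> vertices P"
      using inner_minors_cases[OF f] by metis
    show "f \<in> carrier (mpoly_ring (vertices P))"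
      unfolding 1(1) using 1(2) by (intro mpoly_carrier_closed pair_monom_monomials) auto
    have "Poly_Mapping.keys f \<subseteq> {pair_monom (i, j) (k, l), pair_monom (i, l) (k, j)}"
      unfolding 1(1) by (auto simp: in_keys_iff lookup_minus lookup_single when_def split: if_splits)
    then show "homogeneous f" unfolding homogeneous_def by (intro exI[of _ 2]) (auto simp: monom_degree_pair)
  qed
  then show ?thesis
    unfolding homogeneous_generators_def polyomino_ideal_def inner_minors_def[symmetric] by blast
qed

text \<open>A term \<open>m\<close> of \<open>q * p\<close> comes from a term of \<open>p\<close>
  dividing \<open>m\<close>, so from one of smaller degree or from \<open>m\<close> itself, and both
  have coefficient zero. Such an ideal separates the one generator containing \<open>m\<close> from
  all others.\<close>

lemma ideal_low_degree_coeff: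
  fixes m :: "'v monom"
  assumes "monom_degree m = d"
  shows "ideal {p \<in> carrier (mpoly_ring V :: ('v, 'k::field) mpoly ring). Poly_Mapping.lookup p m = 0 \<and>
    (\<forall>s. monom_degree s < d \<longrightarrow> Poly_Mapping.lookup p s = 0)} (mpoly_ring V)"
    (is "ideal ?J _")
proof (rule mpoly_idealI)
  fix p q :: "('v, 'k) mpoly"
  assume p: "p \<in> ?J" and q: "q \<in> carrier (mpoly_ring V)"
  have "Poly_Mapping.lookup (q * p) s = 0" if s: "s = m \<or> monom_degree s < d" for s
  proof (induction q rule: mpoly_induct)
    case (single t a)
    show ?case
    proof (cases "\<exists>u. s = t + u")
      case True
      then obtain u where u: "s = t + u" by blast
      have "Poly_Mapping.lookup p u = 0"
      proof (cases "t = 0")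
        case False
        then have "monom_degree u < monom_degree s"
          using monom_degree_eq_0[of t] by (simp add: u monom_degree_add)
        then show ?thesis using p s assms by auto
      qed (use p s u in auto)
      then show ?thesis by (simp add: u lookup_single_mult)
    next
      case False
      then have "s \<notin> Poly_Mapping.keys (Poly_Mapping.single t a * p)"
        using Poly_Mapping.keys_mult[of "Poly_Mapping.single t a" p] by (auto split: if_splits)
      then show ?thesis by (simp add: in_keys_iff)
    qed
  qed (simp_all add: lookup_add distrib_right)
  then show "q * p \<in> ?J" using p q by (auto intro: mpoly_carrier_closed)
qed (auto simp: lookup_add intro: mpoly_carrier_closed)

text \<open>The main diagonal of an inner interval gives a monomial of degree 2 that occurs in no other
  inner minor.\<close>

lemma inner_minors_minimal:
  "minimal_homogeneous_generators (vertices P) (polyomino_ideal P :: (point, 'k::field) mpoly set) (inner_minors P)"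
  unfolding minimal_homogeneous_generators_def
proof (intro conjI allI impI)
  show "homogeneous_generators (vertices P) (polyomino_ideal P) (inner_minors P)"
    by (rule inner_minors_generators)
  fix H :: "(point, 'k) mpoly set" assume H: "H \<subset> inner_minors P"
  let ?R = "mpoly_ring (vertices P) :: (point, 'k) mpoly ring"
  interpret cring ?R by (rule cring_mpoly_ring)
  obtain f where f: "f \<in> inner_minors P" "f \<notin> H" using H by blast
  then obtain i j k l where fe: "f = pair_term (i, j) (k, l) - pair_term (i, l) (k, j)" "i < k" "j < l"
    using inner_minors_cases by metis
  define m where "m = pair_monom (i, j) (k, l)"
  define J where "J = {p \<in> carrier ?R. Poly_Mapping.lookup p m = 0 \<and>
    (\<forall>s. monom_degree s < 2 \<longrightarrow> Poly_Mapping.lookup p s = 0)}"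
  have J: "ideal J ?R" unfolding J_def by (rule ideal_low_degree_coeff) (simp add: m_def monom_degree_pair)
  have "H \<subseteq> J"
  proof
    fix g assume g: "g \<in> H"
    then have gG: "g \<in> inner_minors P" using H by blast
    then obtain i' j' k' l' where ge: "g = pair_term (i', j') (k', l') - pair_term (i', l') (k', j')" "i' < k'" "j' < l'"
      using inner_minors_cases by metis
    have "g \<in> carrier ?R" using gG inner_minors_generators[of P] by (auto simp: homogeneous_generators_def)
    moreover have "m \<noteq> pair_monom (i', l') (k', j')"
      using fe(2,3) ge(2,3) by (auto simp: m_def doubleton_eq_iff dest!: pair_monom_eqD)
    moreover have "m \<noteq> pair_monom (i', j') (k', l')"
    proof
      assume "m = pair_monom (i', j') (k', l')"
      then have "i = i' \<and> j = j' \<and> k = k' \<and> l = l'"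
        using fe(2,3) ge(2,3) by (auto simp: m_def doubleton_eq_iff dest!: pair_monom_eqD)
      then show False using f(2) g fe(1) ge(1) by simp
    qed
    ultimately show "g \<in> J"
      by (auto simp: J_def ge(1) lookup_minus lookup_single when_def monom_degree_pair)
  qed
  then have "Idl\<^bsub>?R\<^esub> H \<subseteq> J" by (rule genideal_minimal[OF J])
  moreover have "f \<notin> J"
  proof -
    have "m \<noteq> pair_monom (i, l) (k, j)"
      using fe(2,3) by (auto simp: m_def doubleton_eq_iff dest!: pair_monom_eqD)
    then have "Poly_Mapping.lookup f m = 1"
      by (simp add: fe(1) m_def[symmetric] lookup_minus lookup_single when_def)
    then show ?thesis by (simp add: J_def)
  qed
  moreover have "f \<in> polyomino_ideal P"
    using f(1) inner_minors_generators[of P] genideal_self[of "inner_minors P"]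
    by (auto simp: homogeneous_generators_def)
  ultimately show "Idl\<^bsub>?R\<^esub> H \<noteq> polyomino_ideal P" by blast
qed

text \<open>\<open>L\<close> and \<open>M\<close> may span either diagonal of the interval, and this
  decides the sign of the generator.\<close>

lemma minor_generator:
  assumes "minor P L M X Y"
  obtains f :: "(point, 'k::field) mpoly" where "f \<in> inner_minors P"
    "f = pair_term L M - pair_term X Y \<or> f = pair_term X Y - pair_term L M"
    "{L, M, X, Y} \<subseteq> vertices P" "L \<noteq> M" "pair_monom L M \<noteq> pair_monom X Y"
proof -
  obtain a b where L: "L = (a, b)" by (cases L)
  obtain c d where M: "M = (c, d)" by (cases M)
  have ne: "a \<noteq> c" "b \<noteq> d" and XY: "{X, Y} = {(a, d), (c, b)}"
    and inner: "inner_interval P (min a c, min b d) (max a c, max b d)"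
    using assms by (auto simp: minor_def L M)
  let ?i = "min a c" and ?j = "min b d" and ?k = "max a c" and ?l = "max b d"
  let ?f = "pair_term (?i, ?j) (?k, ?l) - pair_term (?i, ?l) (?k, ?j) :: (point, 'k) mpoly"
  have "?f \<in> inner_minors P" using inner by (auto simp: inner_minors_def Var_mult)
  moreover have "{L, M} = {(?i, ?j), (?k, ?l)} \<and> {X, Y} = {(?i, ?l), (?k, ?j)} \<or>
      {X, Y} = {(?i, ?j), (?k, ?l)} \<and> {L, M} = {(?i, ?l), (?k, ?j)}"
    using ne by (auto simp: XY L M min_def max_def)
  then have "pair_monom L M = pair_monom (?i, ?j) (?k, ?l) \<and> pair_monom X Y = pair_monom (?i, ?l) (?k, ?j) \<or>
      pair_monom X Y = pair_monom (?i, ?j) (?k, ?l) \<and> pair_monom L M = pair_monom (?i, ?l) (?k, ?j)"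
    by (elim disj_forward conj_forward pair_monom_cong)
  then have "?f = pair_term L M - pair_term X Y \<or> ?f = pair_term X Y - pair_term L M"
    by (elim disjE conjE) (simp_all only: simp_thms)
  moreover have "{X, Y, L, M} \<subseteq> vertices P"
  proof -
    have "{(a, d), (c, b)} \<subseteq> vertices P" "{(a, b), (c, d)} \<subseteq> vertices P"
      using inner_interval_vertices[OF inner] by auto
    then show ?thesis unfolding XY[symmetric] L[symmetric] M[symmetric] by blast
  qed
  moreover have "L \<noteq> M" using ne by (simp add: L M)
  moreover have "pair_monom L M \<noteq> pair_monom X Y"
    using ne by (auto simp: XY L M doubleton_eq_iff dest!: pair_monom_eqD)
  ultimately show ?thesis using that[of ?f] by auto
qed

lemma paired_disjoint:
  assumes "distinct (paired qs)" "i < length qs" "j < length qs" "i \<noteq> j"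
    and "qs ! i = (L, M, X, Y)" "qs ! j = (L', M', X', Y')"
  shows "{L, M} \<inter> {L', M'} = {}"
proof -
  let ?ps = "map (\<lambda>(L, M, X, Y). [L, M]) qs"
  have "[] \<notin> set ?ps" by auto
  then have "removeAll [] ?ps = ?ps" by (rule removeAll_id)
  then have *: "distinct ?ps" "\<And>ys zs. ys \<in> set ?ps \<and> zs \<in> set ?ps \<and> ys \<noteq> zs \<Longrightarrow> set ys \<inter> set zs = {}"
    using assms(1) unfolding paired_def distinct_concat_iff by metis+
  have ij: "?ps ! i = [L, M]" "?ps ! j = [L', M']" using assms by auto
  have len: "i < length ?ps" "j < length ?ps" using assms(2,3) by simp_all
  then have "?ps ! i \<noteq> ?ps ! j" using nth_eq_iff_index_eq[OF *(1) len] assms(4) by blast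
  then have "set (?ps ! i) \<inter> set (?ps ! j) = {}" using len by (intro *(2) conjI nth_mem)
  then show ?thesis unfolding ij by simp
qed

lemma koenig_type_minor_system:
  assumes P: "cell_collection P" and sys: "minor_system P w qs" "length qs = card P"
  shows "koenig_type (vertices P) (polyomino_ideal P :: (point, 'k::field) mpoly set)"
proof -
  let ?V = "vertices P" and ?I = "polyomino_ideal P :: (point, 'k) mpoly set" and ?n = "card P"
  let ?R = "mpoly_ring ?V :: (point, 'k) mpoly ring"
  define L where "L i = fst (qs ! i)" for i
  define M where "M i = fst (snd (qs ! i))" for i
  define X where "X i = fst (snd (snd (qs ! i)))" for i
  define Y where "Y i = snd (snd (snd (qs ! i)))" for i
  have q: "qs ! i = (L i, M i, X i, Y i)" for i by (simp add: L_def M_def X_def Y_def)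
  have minor: "minor P (L i) (M i) (X i) (Y i)" and w: "w (X i) + w (Y i) < w (L i) + w (M i)" if "i < ?n" for i
  proof -
    have "(L i, M i, X i, Y i) \<in> set qs" using that sys(2) q by (metis nth_mem)
    then show "minor P (L i) (M i) (X i) (Y i)" "w (X i) + w (Y i) < w (L i) + w (M i)"
      using sys(1) by (auto simp: minor_system_def)
  qed
  have disj: "{L i, M i} \<inter> {L j, M j} = {}" if "i < ?n" "j < ?n" "i \<noteq> j" for i j
    using paired_disjoint[OF _ _ _ that(3) q q] sys that by (simp add: minor_system_def)
  have "\<exists>f :: (point, 'k) mpoly. f \<in> inner_minors P \<and>
      (f = pair_term (L i) (M i) - pair_term (X i) (Y i) \<or> f = pair_term (X i) (Y i) - pair_term (L i) (M i))"
    if "i < ?n" for i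
    using minor_generator[OF minor[OF that]] by metis
  then obtain F :: "nat \<Rightarrow> (point, 'k) mpoly" where F: "\<And>i. i < ?n \<Longrightarrow> F i \<in> inner_minors P"
    "\<And>i. i < ?n \<Longrightarrow> F i = pair_term (L i) (M i) - pair_term (X i) (Y i) \<or> F i = pair_term (X i) (Y i) - pair_term (L i) (M i)"
    by metis
  have mem: "L i \<in> ?V" "M i \<in> ?V" "X i \<in> ?V" "Y i \<in> ?V" and LM: "L i \<noteq> M i"
    and ne: "pair_monom (L i) (M i) \<noteq> pair_monom (X i) (Y i)" if "i < ?n" for i
    using minor_generator[OF minor[OF that]] by (metis insert_subset)+
  obtain r where r: "monomial_order ?V r"
    "\<And>s t. s \<in> monomials ?V \<Longrightarrow> t \<in> monomials ?V \<Longrightarrow> weight w s < weight w t \<Longrightarrow> (s, t) \<in> r"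
    using monomial_order_weight by metis
  have initial: "initial r (F i) = Poly_Mapping.single (pair_monom (L i) (M i)) 1" if i: "i < ?n" for i
  proof (rule initial_eqI[OF r(1)])
    have keys: "Poly_Mapping.keys (F i) = {pair_monom (L i) (M i), pair_monom (X i) (Y i)}"
      using F(2)[OF i] ne[OF i] by (auto simp: in_keys_iff lookup_minus lookup_single when_def split: if_splits)
    then show "pair_monom (L i) (M i) \<in> Poly_Mapping.keys (F i)" by simp
    show sub: "Poly_Mapping.keys (F i) \<subseteq> monomials ?V" using keys mem[OF i] by (simp add: pair_monom_monomials)
    fix t assume "t \<in> Poly_Mapping.keys (F i)"
    then consider "t = pair_monom (L i) (M i)" | "t = pair_monom (X i) (Y i)" using keys by auto
    then show "(t, pair_monom (L i) (M i)) \<in> r"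
    proof cases
      case 1
      have "refl_on (monomials ?V) r"
        using r(1) by (auto simp: monomial_order_def linear_order_on_def partial_order_on_def preorder_on_def)
      then show ?thesis using 1 mem[OF i] pair_monom_monomials by (metis refl_onD)
    next
      case 2
      have "weight w (pair_monom (X i) (Y i)) < weight w (pair_monom (L i) (M i))"
        using w[OF i] by (simp add: pair_monom_def weight_add weight_single)
      then show ?thesis
        unfolding 2 by (intro r(2) pair_monom_monomials mem[OF i])
    qed
  qed
  define fs where "fs = map F [0..<?n]"
  \<comment> \<open>Their initial monomials are pairwise coprime and therefore tell the generators
    apart.\<close>
  have "distinct fs"
    unfolding fs_def distinct_map
  proof (intro conjI inj_onI, simp)
    fix i j assume ij: "i \<in> set [0..<?n]" "j \<in> set [0..<?n]" "F i = F j"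
    then have "Poly_Mapping.single (pair_monom (L i) (M i)) (1 :: 'k) = Poly_Mapping.single (pair_monom (L j) (M j)) 1"
      using initial[of i] initial[of j] by simp
    then have "pair_monom (L i) (M i) = pair_monom (L j) (M j)"
      by (metis lookup_single_eq lookup_single_not_eq zero_neq_one)
    then have "{L i, M i} = {L j, M j}" by (rule pair_monom_eqD)
    then show "i = j" using disj[of i j] ij by auto
  qed
  moreover have "regular_sequence ?R (map (initial r) fs)"
  proof -
    let ?ss = "map (\<lambda>i. pair_monom (L i) (M i)) [0..<?n]"
    have "regular_sequence ?R (map (\<lambda>s. Poly_Mapping.single s 1) ?ss)"
    proof (rule regular_sequence_coprime_monomials)
      show "set ?ss \<subseteq> monomials ?V" using mem by (auto simp: pair_monom_monomials)
      show "0 \<notin> set ?ss" by (auto dest!: arg_cong[of _ _ Poly_Mapping.keys] simp: keys_pair_monom)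
      fix i j assume "i < j" "j < length ?ss"
      then show "Poly_Mapping.keys (?ss ! i) \<inter> Poly_Mapping.keys (?ss ! j) = {}"
        using disj[of i j] by (simp add: keys_pair_monom)
    qed
    moreover have "map (initial r) fs = map (\<lambda>s. Poly_Mapping.single s 1) ?ss"
      by (auto simp: fs_def initial)
    ultimately show ?thesis by simp
  qed
  moreover have "ideal_height ?R ?I = enat (length fs)"
  proof (rule antisym)
    obtain Q :: "(point, 'k) mpoly set" where Q: "primeideal Q ?R" "?I \<subseteq> Q" "prime_height ?R Q \<le> enat ?n"
      using cell_collection_prime[OF P] .
    have "ideal_height ?R ?I \<le> prime_height ?R Q"
      unfolding ideal_height_def using Q by (intro Inf_lower) auto
    then show "ideal_height ?R ?I \<le> enat (length fs)" using Q(3) by (simp add: fs_def)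
    \<comment> \<open>The height is an infimum over primes, and every prime containing the ideal
      contains all binomials of the system.\<close>
    show "enat (length fs) \<le> ideal_height ?R ?I"
      unfolding ideal_height_def
    proof (rule Inf_greatest)
      fix h assume "h \<in> {prime_height ?R p |p. primeideal p ?R \<and> ?I \<subseteq> p}"
      then obtain p where h: "h = prime_height ?R p" and p: "primeideal p ?R" "?I \<subseteq> p" by auto
      have FI: "F i \<in> p" if "i < ?n" for i
      proof -
        have "inner_minors P \<subseteq> ?I"
          using inner_minors_generators[of P] ring.genideal_self[OF cring.axioms(1)[OF cring_mpoly_ring]]
          unfolding homogeneous_generators_def by metis
        then show ?thesis using F(1)[OF that] p(2) by blast
      qed
      have gen: "Poly_Mapping.single (Poly_Mapping.single (L i) 1 + Poly_Mapping.single (M i) 1) 1 -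
          Poly_Mapping.single (Poly_Mapping.single (X i) 1 + Poly_Mapping.single (Y i) 1) 1 \<in> p" if i: "i < ?n" for i
      proof -
        have "pair_term (L i) (M i) - pair_term (X i) (Y i) \<in> {F i, 0 - F i}" using F(2)[OF i] by auto
        moreover have "0 - F i \<in> p"
          using mpoly_ideal(1,4)[OF mpoly_prime(1)[OF p(1)]] FI[OF i] by blast
        ultimately show ?thesis
          using FI[OF i] unfolding pair_monom_def insert_iff empty_iff by (elim disjE) (simp_all only:)
      qed
      have fin: "finite ?V"
      proof -
        have "finite C" if "C \<in> P" for C
          using that P by (auto simp: cell_collection_def is_cell_iff cell_Pair)
        then show ?thesis using P by (auto simp: vertices_def cell_collection_def)
      qed
      have "enat ?n \<le> prime_height ?R p"
        by (rule prime_height_ge[OF p(1) fin mem LM disj w gen])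
      then show "enat (length fs) \<le> h" by (simp add: h fs_def)
    qed
  qed
  moreover have "set fs \<subseteq> inner_minors P" using F(1) by (auto simp: fs_def)
  moreover have "homogeneous_ideal ?V ?I" using inner_minors_generators by (auto simp: homogeneous_ideal_def)
  ultimately show ?thesis
    unfolding koenig_type_def using inner_minors_minimal r(1) by blast
qed

theorem theorem3p12:
  fixes P :: "point set set" and n :: nat and A :: "nat \<Rightarrow> point set"
  assumes "weakly_closed_path P n A"
  shows "koenig_type (vertices P) (polyomino_ideal P :: (point, 'k::field) mpoly set)"
proof -
  have "cell_collection P" using assms unfolding weakly_closed_path_def by (rule conjunct1)
  then show ?thesis using weakly_closed_path_system[OF assms] koenig_type_minor_system by metis
qed

end
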